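(* If $\beta>\beta_0$, then for all $f^s\in[L^2(\Omega^s)]^{\rm dim}$ and $f^d\in L^2(\Omega^d)$ there exists a unique solution $(\boldsymbol{u}_h,\boldsymbol{p}_h)\in\boldsymbol{X}_h$ to $$B_h((\boldsymbol{u}_h,\boldsymbol{p}_h),(\boldsymbol{v}_h,\boldsymbol{q}_h))=\int_{\Omega^s}f^s\cdot v_h\,dx+\int_{\Omega^d}f^dq_h\,dx\qquad\forall(\boldsymbol{v}_h,\boldsymbol{q}_h)\in\boldsymbol{X}_h.$$
   Context: Domain. $\Omega\subset\mathbb{R}^{\rm dim}$, ${\rm dim}\in\{2,3\}$, is a bounded polygonal domain divided into two non-overlapping regions $\Omega^s$, $\Omega^d$ (unions of polygonal subdomains), $\Omega=\Omega^s\cup\Omega^d$, with polygonal interface $\Gamma^I$. $\Gamma^s:=\partial\Omega\cap\partial\Omega^s$, $\Gamma^d:=\partial\Omega\cap\partial\Omega^d$. $\mu,\kappa,\alpha>0$ are constants. $\varepsilon(u):=(\nabla u+(\nabla u)^T)/2$; $(w)^t:=w-(w\cdot n)n$ on $\Gamma^I$ with $n$ the unit normal pointing out of $\Omega^s$. Mesh. For $j=s,d$, $\mathcal{T}^j$ is a triangulation of $\Omega^j$ into non-overlapping cells $K$ (triangles if ${\rm dim}=2$, tetrahedra if ${\rm dim}=3$), the meshes match on $\Gamma^I$, $\mathcal{T}:=\mathcal{T}^s\cup\mathcal{T}^d$; $h_K$ is the diameter of $K$, $h$ the maximum of the $h_K$. $\mathcal{F}^j$ is the set of facets in $\overline{\Omega}^j$,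 $\Gamma_0^j$ their union. $n^j$ is the outward unit normal on $\partial K$, $K\in\mathcal{T}^j$; on $\Gamma^I$ it points out of $\Omega^j$. Discrete spaces ($k\ge1$; $P_k(D)$ = polynomials of degree $k$ on $D$; $L^2_0(\Omega)$ = zero-mean functions in $L^2(\Omega)$). $V_h:=\{v_h\in[L^2(\Omega)]^{\rm dim}: v_h\in[P_k(K)]^{\rm dim}\ \forall K\in\mathcal{T}\}$; $Q_h:=\{q_h\in L^2(\Omega): q_h\in P_{k-1}(K)\ \forall K\in\mathcal{T}\}\cap L^2_0(\Omega)$; $\bar V_h:=\{\bar v_h\in[L^2(\Gamma_0^s)]^{\rm dim}:\bar v_h\in[P_k(F)]^{\rm dim}\ \forall F\in\mathcal{F}^s,\ \bar v_h=0\text{ on }\Gamma^s\}\cap[C^0(\Gamma_0^s)]^{\rm dim}$; $\bar Q_h^j:=\{\bar q_h^j\in L^2(\Gamma_0^j):\bar q_h^j\in P_k(F)\ \forall F\in\mathcal{F}^j\}$. $\boldsymbol{V}_h:=V_h\times\bar V_h\ni\boldsymbol{v}_h=(v_h,\bar v_h)$; $\boldsymbol{Q}_h:=Q_h\times\bar Q_h^s\times\bar Q_h^d\ni\boldsymbol{q}_h=(q_h,\bar q_h^s,\bar q_h^d)$; $\boldsymbol{q}^j:=(q|_{\Omega^j},\bar q^j)$; $\boldsymbol{X}_h:=\boldsymbol{V}_h\times\boldsymbol{Q}_h$. Forms ($\beta>0$ is a penalty parameter). $B_h((\boldsymbol{u},\boldsymbol{p}),(\boldsymbol{v},\boldsymbol{q})):=a_h(\boldsymbol{u},\boldsymbol{v})+\sum_{j=s,d}(b_h^j(\boldsymbol{p}^j,v)+b_h^{I,j}(\bar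 p^j,\bar v))+\sum_{j=s,d}(b_h^j(\boldsymbol{q}^j,u)+b_h^{I,j}(\bar q^j,\bar u))$; $a_h(\boldsymbol{u},\boldsymbol{v}):=a_h^s(\boldsymbol{u},\boldsymbol{v})+a_h^d(u,v)+a_h^I(\bar u,\bar v)$; $a_h^s(\boldsymbol{u},\boldsymbol{v}):=\sum_{K\in\mathcal{T}^s}\int_K2\mu\varepsilon(u):\varepsilon(v)\,dx+\sum_{K\in\mathcal{T}^s}\int_{\partial K}\frac{2\beta\mu}{h_K}(u-\bar u)\cdot(v-\bar v)\,ds-\sum_{K\in\mathcal{T}^s}\int_{\partial K}2\mu\varepsilon(u)n^s\cdot(v-\bar v)\,ds-\sum_{K\in\mathcal{T}^s}\int_{\partial K}2\mu\varepsilon(v)n^s\cdot(u-\bar u)\,ds$; $a_h^d(u,v):=\int_{\Omega^d}\kappa^{-1}u\cdot v\,dx$; $a_h^I(\bar u,\bar v):=\int_{\Gamma^I}\alpha\kappa^{-1/2}\bar u^t\cdot\bar v^t\,ds$; $b_h^j(\boldsymbol{p}^j,v):=-\sum_{K\in\mathcal{T}^j}\int_Kp\,\nabla\cdot v\,dx+\sum_{K\in\mathcal{T}^j}\int_{\partial K}\bar p^jv\cdot n^j\,ds$; $b_h^{I,j}(\bar p^j,\bar v):=-\int_{\Gamma^I}\bar p^j\bar v\cdot n^j\,ds$. Norm. $\|\cdot\|_D$ is the $L^2(D)$-norm. $|||\boldsymbol{v}|||_{v}^2:=\sum_{K\in\mathcal{T}^s}(\|\nabla v\|_K^2+h_K^{-1}\|v-\bar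 v\|_{\partial K}^2)+\|v\|_{\Omega^d}^2+\|\bar v^t\|_{\Gamma^I}^2$. Threshold. $\beta_0>0$ is a constant such that for all $\beta>\beta_0$ there is $C>0$ independent of $h$ with $a_h(\boldsymbol{v}_h,\boldsymbol{v}_h)\ge C|||\boldsymbol{v}_h|||_v^2$ for all $\boldsymbol{v}_h\in\boldsymbol{V}_h$.
   Formalization: For k < dim it is additionally assumed that each interface between a component of Ω^s and one of Ω^d carries some v̄_h in V̄_h, vanishing on the rest of Γ^I, with nonzero total normal flux; without this, uniqueness fails on some coarse meshes (e.g. k=1, two triangles). *)

theory Defs
  imports "HOL-Analysis.Analysis"
begin

section \<open>Polynomials and square integrable functions\<close>

text \<open>Polynomials of total degree at most \<open>k\<close> in the Cartesian coordinates; \<open>e\<close> runs over the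
  multi-indices. Restricted to a flat facet they are exactly the polynomials of degree at most
  \<open>k\<close> in any affine coordinates of that facet.\<close>

definition Pk :: "nat \<Rightarrow> (real^'n \<Rightarrow> real) set" where
  "Pk k = {p. \<exists>c. \<forall>x. p x =
      (\<Sum>e\<in>{e :: 'n \<Rightarrow> nat. sum e UNIV \<le> k}. c e * (\<Prod>i\<in>UNIV. (x $ i) ^ e i))}"

definition Pk_vec :: "nat \<Rightarrow> (real^'n \<Rightarrow> real^'n) set" where
  "Pk_vec k = {p. \<forall>i. (\<lambda>x. p x $ i) \<in> Pk k}"

definition L2_on :: "(real^'n) set \<Rightarrow> (real^'n \<Rightarrow> 'b::euclidean_space) \<Rightarrow> bool" where
  "L2_on D f \<longleftrightarrow> f \<in> borel_measurable (lebesgue_on D) \<and>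
     integrable (lebesgue_on D) (\<lambda>x. (norm (f x))\<^sup>2)"


section \<open>Domain and mesh\<close>

text \<open>The condition \<^term>\<open>interior (closure \<Omega>) = \<Omega>\<close> excludes slits and punctures. A polygonal set
  need not be connected.\<close>

definition polygonal :: "(real^'n) set \<Rightarrow> bool" where
  "polygonal \<Omega> \<longleftrightarrow> \<Omega> \<noteq> {} \<and> interior (closure \<Omega>) = \<Omega> \<and>
     (\<exists>P. finite P \<and> (\<forall>C\<in>P. polytope C) \<and> closure \<Omega> = \<Union>P)"

text \<open>The identity \<open>\<Omega> = \<Omega>\<^sup>s \<union> \<Omega>\<^sup>d\<close> is meant up to the interface, hence the closures.\<close>

definition stokes_darcy_domain ::
    "(real^'n) set \<Rightarrow> (real^'n) set \<Rightarrow> (real^'n) set \<Rightarrow> bool" where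
  "stokes_darcy_domain \<Omega> \<Omega>s \<Omega>d \<longleftrightarrow>
     polygonal \<Omega> \<and> connected \<Omega> \<and> polygonal \<Omega>s \<and> polygonal \<Omega>d \<and>
     \<Omega>s \<inter> \<Omega>d = {} \<and> closure \<Omega> = closure \<Omega>s \<union> closure \<Omega>d"

text \<open>The library's \<^const>\<open>triangulation\<close> requires that two cells meet in a common face;
  imposing it on the union of both meshes makes them match on the interface.\<close>

definition stokes_darcy_mesh ::
    "(real^'n) set \<Rightarrow> (real^'n) set \<Rightarrow> (real^'n) set set \<Rightarrow> (real^'n) set set \<Rightarrow> bool" where
  "stokes_darcy_mesh \<Omega>s \<Omega>d Ts Td \<longleftrightarrow>
     triangulation (Ts \<union> Td) \<and> (\<forall>K\<in>Ts \<union> Td. int CARD('n) simplex K) \<and>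
     \<Union>Ts = closure \<Omega>s \<and> \<Union>Td = closure \<Omega>d"

definition cell_facets :: "(real^'n) set \<Rightarrow> (real^'n) set set" where
  "cell_facets K = {F. F facet_of K}"

definition facets :: "(real^'n) set set \<Rightarrow> (real^'n) set set" where
  "facets T = (\<Union>K\<in>T. cell_facets K)"

definition interface_facets ::
    "(real^'n) set set \<Rightarrow> (real^'n) set set \<Rightarrow> (real^'n) set set" where
  "interface_facets Ts Td = facets Ts \<inter> facets Td"

definition out_normal :: "(real^'n) set \<Rightarrow> (real^'n) set \<Rightarrow> real^'n" where
  "out_normal K F = (THE n. norm n = 1 \<and> (\<forall>x\<in>F. \<forall>y\<in>K. n \<bullet> (y - x) \<le> 0))"

definition tangential :: "real^'n \<Rightarrow> real^'n \<Rightarrow> real^'n" where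
  "tangential n w = w - (w \<bullet> n) *\<^sub>R n"


section \<open>Integration over facets and boundary values\<close>

text \<open>Surface integral over a flat set \<open>F\<close> of codimension one. With
  \<open>\<pi> = closest_point (affine hull F)\<close> the orthogonal projection onto the hyperplane of \<open>F\<close>, the
  right prism with mid-section \<open>F\<close> and thickness 1 is \<open>slab F\<close>. By Fubini, the integral of
  \<open>g \<circ> \<pi>\<close> over this prism is the integral of \<open>g\<close> over \<open>F\<close> with respect to the
  \<open>(n - 1)\<close>-dimensional Lebesgue (equivalently Hausdorff) measure.\<close>

definition slab :: "(real^'n) set \<Rightarrow> (real^'n) set" where
  "slab F = {x. closest_point (affine hull F) x \<in> F \<and>
                dist x (closest_point (affine hull F) x) \<le> 1/2}"

definition facet_integral :: "(real^'n) set \<Rightarrow> (real^'n \<Rightarrow> real) \<Rightarrow> real" where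
  "facet_integral F g = (LINT x:slab F|lebesgue. g (closest_point (affine hull F) x))"

text \<open>The integrand of an integral over \<open>\<partial>K\<close> may depend on the outward normal.\<close>

definition bdry_integral :: "(real^'n) set \<Rightarrow> (real^'n \<Rightarrow> real^'n \<Rightarrow> real) \<Rightarrow> real" where
  "bdry_integral K g = (\<Sum>F\<in>cell_facets K. facet_integral F (g (out_normal K F)))"

text \<open>Integral over the union of the facets in \<open>I\<close>, the normal pointing out of the region
  triangulated by \<open>T\<close>. Every interface facet belongs to exactly one cell of \<open>T\<close>, so it is
  counted once.\<close>

definition interface_integral ::
    "(real^'n) set set \<Rightarrow> (real^'n) set set \<Rightarrow> (real^'n \<Rightarrow> real^'n \<Rightarrow> real) \<Rightarrow> real" where
  "interface_integral T I g =
     (\<Sum>K\<in>T. \<Sum>F\<in>cell_facets K \<inter> I. facet_integral F (g (out_normal K F)))"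

text \<open>Trace on the boundary of \<open>K\<close>, taken from inside \<open>K\<close>.\<close>

definition cell_trace :: "(real^'n) set \<Rightarrow> (real^'n \<Rightarrow> 'b::t2_space) \<Rightarrow> real^'n \<Rightarrow> 'b" where
  "cell_trace K f x = Lim (at x within interior K) f"

definition grad :: "(real^'n \<Rightarrow> real^'n) \<Rightarrow> real^'n \<Rightarrow> real^'n^'n" where
  "grad v x = jacobian v (at x)"

definition strain :: "(real^'n \<Rightarrow> real^'n) \<Rightarrow> real^'n \<Rightarrow> real^'n^'n" where
  "strain v x = (1/2) *\<^sub>R (grad v x + transpose (grad v x))"

definition divergence :: "(real^'n \<Rightarrow> real^'n) \<Rightarrow> real^'n \<Rightarrow> real" where
  "divergence v x = trace (grad v x)"


section \<open>Discrete spaces\<close>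

text \<open>Elements of the discrete spaces are classes of functions up to null sets. Each class is
  represented by its unique member that is polynomial on every open cell (respectively on the
  relative interior of every facet) and zero on the remaining null set and outside the domain of
  definition, so that equality of representatives is equality in the \<open>L\<^sup>2\<close> spaces. The elements
  of \<open>Vbarh\<close> are continuous on the union of the facets and are extended by zero outside it.
  Square integrability is automatic.\<close>

definition Vh :: "nat \<Rightarrow> (real^'n) set set \<Rightarrow> (real^'n \<Rightarrow> real^'n) set" where
  "Vh k T = {v. (\<forall>K\<in>T. \<exists>p\<in>Pk_vec k. \<forall>x\<in>interior K. v x = p x) \<and>
                (\<forall>x. x \<notin> (\<Union>K\<in>T. interior K) \<longrightarrow> v x = 0)}"

definition Qh :: "nat \<Rightarrow> (real^'n) set \<Rightarrow> (real^'n) set set \<Rightarrow> (real^'n \<Rightarrow> real) set" where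
  "Qh k \<Omega> T = {q. (\<forall>K\<in>T. \<exists>p\<in>Pk (k - 1). \<forall>x\<in>interior K. q x = p x) \<and>
                  (\<forall>x. x \<notin> (\<Union>K\<in>T. interior K) \<longrightarrow> q x = 0) \<and>
                  (LINT x:\<Omega>|lebesgue. q x) = 0}"

definition Vbarh :: "nat \<Rightarrow> (real^'n) set \<Rightarrow> (real^'n) set \<Rightarrow> (real^'n) set set \<Rightarrow>
    (real^'n \<Rightarrow> real^'n) set" where
  "Vbarh k \<Omega> \<Omega>s Ts = {v. (\<forall>F\<in>facets Ts. \<exists>p\<in>Pk_vec k. \<forall>x\<in>F. v x = p x) \<and>
                         (\<forall>x\<in>frontier \<Omega> \<inter> frontier \<Omega>s. v x = 0) \<and>
                         continuous_on (\<Union>(facets Ts)) v \<and>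
                         (\<forall>x. x \<notin> \<Union>(facets Ts) \<longrightarrow> v x = 0)}"

definition Qbarh :: "nat \<Rightarrow> (real^'n) set set \<Rightarrow> (real^'n \<Rightarrow> real) set" where
  "Qbarh k T = {q. (\<forall>F\<in>facets T. \<exists>p\<in>Pk k. \<forall>x\<in>rel_interior F. q x = p x) \<and>
                   (\<forall>x. x \<notin> (\<Union>F\<in>facets T. rel_interior F) \<longrightarrow> q x = 0)}"

type_synonym 'n velocity = "(real^'n \<Rightarrow> real^'n) \<times> (real^'n \<Rightarrow> real^'n)"
type_synonym 'n pressure = "(real^'n \<Rightarrow> real) \<times> (real^'n \<Rightarrow> real) \<times> (real^'n \<Rightarrow> real)"

definition Xh :: "nat \<Rightarrow> (real^'n) set \<Rightarrow> (real^'n) set \<Rightarrow> (real^'n) set set \<Rightarrow>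
    (real^'n) set set \<Rightarrow> ('n velocity \<times> 'n pressure) set" where
  "Xh k \<Omega> \<Omega>s Ts Td = (Vh k (Ts \<union> Td) \<times> Vbarh k \<Omega> \<Omega>s Ts) \<times>
                      (Qh k \<Omega> (Ts \<union> Td) \<times> Qbarh k Ts \<times> Qbarh k Td)"


section \<open>Forms\<close>

definition a_stokes :: "real \<Rightarrow> real \<Rightarrow> (real^'n) set set \<Rightarrow> 'n velocity \<Rightarrow> 'n velocity \<Rightarrow> real" where
  "a_stokes \<mu> \<beta> Ts = (\<lambda>(u, ub) (v, vb).
      (\<Sum>K\<in>Ts. LINT x:K|lebesgue. 2 * \<mu> * (strain u x \<bullet> strain v x))
    + (\<Sum>K\<in>Ts. bdry_integral K (\<lambda>n x. 2 * \<beta> * \<mu> / diameter K *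
         ((cell_trace K u x - ub x) \<bullet> (cell_trace K v x - vb x))))
    - (\<Sum>K\<in>Ts. bdry_integral K (\<lambda>n x. 2 * \<mu> *
         ((cell_trace K (strain u) x *v n) \<bullet> (cell_trace K v x - vb x))))
    - (\<Sum>K\<in>Ts. bdry_integral K (\<lambda>n x. 2 * \<mu> *
         ((cell_trace K (strain v) x *v n) \<bullet> (cell_trace K u x - ub x)))))"

definition a_darcy :: "real \<Rightarrow> (real^'n) set \<Rightarrow> (real^'n \<Rightarrow> real^'n) \<Rightarrow> (real^'n \<Rightarrow> real^'n) \<Rightarrow> real" where
  "a_darcy \<kappa> \<Omega>d u v = (LINT x:\<Omega>d|lebesgue. inverse \<kappa> * (u x \<bullet> v x))"

definition a_interface :: "real \<Rightarrow> real \<Rightarrow> (real^'n) set set \<Rightarrow> (real^'n) set set \<Rightarrow>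
    (real^'n \<Rightarrow> real^'n) \<Rightarrow> (real^'n \<Rightarrow> real^'n) \<Rightarrow> real" where
  "a_interface \<kappa> \<alpha> Ts Td ub vb = interface_integral Ts (interface_facets Ts Td)
      (\<lambda>n x. \<alpha> / sqrt \<kappa> * (tangential n (ub x) \<bullet> tangential n (vb x)))"

definition a_h :: "real \<Rightarrow> real \<Rightarrow> real \<Rightarrow> real \<Rightarrow> (real^'n) set \<Rightarrow> (real^'n) set set \<Rightarrow>
    (real^'n) set set \<Rightarrow> 'n velocity \<Rightarrow> 'n velocity \<Rightarrow> real" where
  "a_h \<mu> \<kappa> \<alpha> \<beta> \<Omega>d Ts Td u v =
     a_stokes \<mu> \<beta> Ts u v + a_darcy \<kappa> \<Omega>d (fst u) (fst v) + a_interface \<kappa> \<alpha> Ts Td (snd u) (snd v)"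

text \<open>\<open>b_h T p pb v\<close> and \<open>b_I T I pb vb\<close> are \<open>b\<^sub>h\<^sup>j\<close> and \<open>b\<^sub>h\<^sup>I\<^sup>,\<^sup>j\<close> for the mesh \<open>T\<close> of \<open>\<Omega>\<^sup>j\<close>.\<close>

definition b_h :: "(real^'n) set set \<Rightarrow> (real^'n \<Rightarrow> real) \<Rightarrow> (real^'n \<Rightarrow> real) \<Rightarrow>
    (real^'n \<Rightarrow> real^'n) \<Rightarrow> real" where
  "b_h T p pb v =
     - (\<Sum>K\<in>T. LINT x:K|lebesgue. p x * divergence v x)
     + (\<Sum>K\<in>T. bdry_integral K (\<lambda>n x. pb x * (cell_trace K v x \<bullet> n)))"

definition b_I :: "(real^'n) set set \<Rightarrow> (real^'n) set set \<Rightarrow> (real^'n \<Rightarrow> real) \<Rightarrow>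
    (real^'n \<Rightarrow> real^'n) \<Rightarrow> real" where
  "b_I T I pb vb = - interface_integral T I (\<lambda>n x. pb x * (vb x \<bullet> n))"

definition b_total :: "(real^'n) set set \<Rightarrow> (real^'n) set set \<Rightarrow> 'n pressure \<Rightarrow>
    'n velocity \<Rightarrow> real" where
  "b_total Ts Td = (\<lambda>(p, ps, pd) (v, vb).
      (b_h Ts p ps v + b_I Ts (interface_facets Ts Td) ps vb)
    + (b_h Td p pd v + b_I Td (interface_facets Ts Td) pd vb))"

definition B_h :: "real \<Rightarrow> real \<Rightarrow> real \<Rightarrow> real \<Rightarrow> (real^'n) set \<Rightarrow> (real^'n) set set \<Rightarrow>
    (real^'n) set set \<Rightarrow> 'n velocity \<times> 'n pressure \<Rightarrow> 'n velocity \<times> 'n pressure \<Rightarrow> real" where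
  "B_h \<mu> \<kappa> \<alpha> \<beta> \<Omega>d Ts Td = (\<lambda>(u, p) (v, q).
      a_h \<mu> \<kappa> \<alpha> \<beta> \<Omega>d Ts Td u v + b_total Ts Td p v + b_total Ts Td q u)"


section \<open>Norm, coercivity threshold, interface condition\<close>

definition norm_v_sq :: "(real^'n) set \<Rightarrow> (real^'n) set set \<Rightarrow> (real^'n) set set \<Rightarrow>
    'n velocity \<Rightarrow> real" where
  "norm_v_sq \<Omega>d Ts Td = (\<lambda>(v, vb).
      (\<Sum>K\<in>Ts. (LINT x:K|lebesgue. (norm (grad v x))\<^sup>2) +
         inverse (diameter K) * bdry_integral K (\<lambda>n x. (norm (cell_trace K v x - vb x))\<^sup>2))
    + (LINT x:\<Omega>d|lebesgue. (norm (v x))\<^sup>2)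
    + interface_integral Ts (interface_facets Ts Td) (\<lambda>n x. (norm (tangential n (vb x)))\<^sup>2))"

text \<open>\<open>MM\<close> is the family of meshes under consideration; the constant \<open>C\<close> is uniform over it, in
  particular independent of the mesh size.\<close>

definition coercivity_threshold :: "nat \<Rightarrow> real \<Rightarrow> real \<Rightarrow> real \<Rightarrow> (real^'n) set \<Rightarrow>
    (real^'n) set \<Rightarrow> (real^'n) set \<Rightarrow> ((real^'n) set set \<times> (real^'n) set set) set \<Rightarrow> real \<Rightarrow> bool" where
  "coercivity_threshold k \<mu> \<kappa> \<alpha> \<Omega> \<Omega>s \<Omega>d MM \<beta>0 \<longleftrightarrow> \<beta>0 > 0 \<and>
     (\<forall>\<beta>>\<beta>0. \<exists>C>0. \<forall>(Ts, Td)\<in>MM. \<forall>v\<in>Vh k (Ts \<union> Td) \<times> Vbarh k \<Omega> \<Omega>s Ts.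
        a_h \<mu> \<kappa> \<alpha> \<beta> \<Omega>d Ts Td v v \<ge> C * norm_v_sq \<Omega>d Ts Td v)"

text \<open>Every interface between a component of \<open>\<Omega>\<^sup>s\<close> and a component of \<open>\<Omega>\<^sup>d\<close> carries a facet velocity
  with nonzero total normal flux. If both regions are connected and this fails, then pressures
  constant on each region, with mean zero on \<open>\<Omega>\<close>, lie in the kernel of \<open>B_h\<close>. For example, take
  \<open>k = 1\<close> in two dimensions and a quadrilateral cut into two triangles, one in each region: all
  vertices lie on \<open>\<Gamma>\<^sup>s\<close>, so \<open>Vbarh\<close> is zero.\<close>

definition interface_resolved :: "nat \<Rightarrow> (real^'n) set \<Rightarrow> (real^'n) set \<Rightarrow> (real^'n) set \<Rightarrow>
    (real^'n) set set \<Rightarrow> (real^'n) set set \<Rightarrow> bool" where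
  "interface_resolved k \<Omega> \<Omega>s \<Omega>d Ts Td \<longleftrightarrow>
     (\<forall>S\<in>components \<Omega>s. \<forall>D\<in>components \<Omega>d.
        (\<exists>F\<in>interface_facets Ts Td. F \<subseteq> closure S \<inter> closure D) \<longrightarrow>
        (\<exists>v\<in>Vbarh k \<Omega> \<Omega>s Ts.
           (\<forall>x\<in>\<Union>(interface_facets Ts Td). x \<notin> closure S \<inter> closure D \<longrightarrow> v x = 0) \<and>
           interface_integral Ts (interface_facets Ts Td) (\<lambda>n x. v x \<bullet> n) \<noteq> 0))"

end

theory Submission
  imports Defs "HOL-Library.Function_Algebras"
begin

text \<open>The problem is a square linear system, so existence follows from uniqueness for zero data.
  Testing with \<open>(u, -p)\<close> and coercivity give \<open>|||u||| = 0\<close>: on \<open>\<Omega>\<^sup>s\<close> the velocity is constant on each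
  cell and equal across facets, with vanishing tangential part on the interface. A patch of cells
  carrying a constant \<open>c \<noteq> 0\<close> can then only be left through facets orthogonal to \<open>c\<close>, which is
  impossible for a bounded patch: walk off inside a thin slab orthogonal to \<open>c\<close>. So \<open>u = 0\<close>, and the
  pressure is annihilated by all velocities. Testing on single cells (divergence theorem) shows that
  it is constant on each cell and equal to the facet pressures, hence equal on cells sharing a
  facet. Across the interface, facet velocities with nonzero flux equate the two
  constants. By connectedness the pressure is constant, and its mean is zero.\<close>

section \<open>Linear algebra in function spaces\<close>

text \<open>Existence is a question of injectivity on one fixed mesh, so every kernel argument is
  qualitative: a vanishing integral of a nonnegative continuous function is turned into pointwise
  vanishing. Boundary values alone cannot exclude constant velocities, since
  \<open>\<Gamma>\<^sup>s\<close> is empty when \<open>\<Omega>\<^sup>s\<close> lies well inside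
  \<open>\<Omega>\<close>. Then only the tangential term on the interface is left, and boundedness
  of the region must come in. Cells may also meet in a vertex or an edge only, so walks through the
  mesh follow generic segments. A facet integral is a volume integral over a prism. The divergence
  theorem is therefore derived from volume integrals, by translating a simplex along an edge; the
  maps involved are rank-one updates of the identity with explicit Jacobian. A field along an edge
  crosses a single facet and so isolates a single facet pressure. The dimension enters as the degree
  of the facet bubble, the lowest degree of a nonzero polynomial on a facet that vanishes on its
  relative boundary. For smaller \<open>k\<close> the interface velocities depend on the mesh and
  come from \<open>interface_resolved\<close>.\<close>

instantiation "fun" :: (type, real_vector) real_vector
begin

definition scaleR_fun :: "real \<Rightarrow> ('a \<Rightarrow> 'b) \<Rightarrow> 'a \<Rightarrow> 'b" where
  "scaleR_fun c f = (\<lambda>x. c *\<^sub>R f x)"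

instance
  by standard (auto simp: scaleR_fun_def fun_eq_iff algebra_simps)

end

lemma scaleR_fun_apply [simp]: "(c *\<^sub>R f) x = c *\<^sub>R f x"
  by (simp add: scaleR_fun_def)

lemma sum_fun_apply: "(\<Sum>i\<in>A. f i) x = (\<Sum>i\<in>A. f i x)"
  for f :: "'c \<Rightarrow> 'a \<Rightarrow> 'b::comm_monoid_add"
  by (induction A rule: infinite_finite_induct) auto

text \<open>Linearity is asked on a subspace only: integrals, traces and derivatives are additive on
  piecewise polynomials but not on arbitrary functions.\<close>

definition linear_on :: "'a::real_vector set \<Rightarrow> ('a \<Rightarrow> real) \<Rightarrow> bool" where
  "linear_on V f \<longleftrightarrow> (\<forall>x\<in>V. \<forall>y\<in>V. f (x + y) = f x + f y) \<and> (\<forall>c. \<forall>x\<in>V. f (c *\<^sub>R x) = c * f x)"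

lemma linear_on_add: "linear_on V f \<Longrightarrow> x \<in> V \<Longrightarrow> y \<in> V \<Longrightarrow> f (x + y) = f x + f y"
  and linear_on_scale: "linear_on V f \<Longrightarrow> x \<in> V \<Longrightarrow> f (c *\<^sub>R x) = c * f x"
  by (auto simp: linear_on_def)

lemma linear_on_diff:
  assumes "linear_on V f" "subspace V" "x \<in> V" "y \<in> V"
  shows "f (x - y) = f x - f y"
  using linear_on_add[OF assms(1,3), of "(-1) *\<^sub>R y"] linear_on_scale[OF assms(1,4), of "-1"] assms(2,4)
  by (simp add: subspace_neg)

lemma linear_on_sum:
  assumes "linear_on V f" "subspace V" "\<And>i. i \<in> A \<Longrightarrow> g i \<in> V"
  shows "f (\<Sum>i\<in>A. c i *\<^sub>R g i) = (\<Sum>i\<in>A. c i * f (g i))"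
proof (cases "finite A")
  case True
  then show ?thesis using assms(3)
  proof (induction A)
    case empty
    then show ?case using linear_on_scale[OF assms(1) subspace_0[OF assms(2)], of 0] by simp
  next
    case (insert i A)
    have "(\<Sum>i\<in>A. c i *\<^sub>R g i) \<in> V"
      by (intro subspace_sum subspace_scale assms(2)) (use insert in auto)
    moreover have "c i *\<^sub>R g i \<in> V" by (intro subspace_scale assms(2)) (use insert in auto)
    ultimately show ?case using insert
      by (simp add: linear_on_add[OF assms(1)] linear_on_scale[OF assms(1)])
  qed
next
  case False
  then show ?thesis using linear_on_scale[OF assms(1) subspace_0[OF assms(2)], of 0] by simp
qed

lemma linear_on_combination:
  assumes "linear_on V L" "linear_on V f"
  shows "linear_on V (\<lambda>x. L x - a * f x)"
  using assms by (auto simp: linear_on_def algebra_simps)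

text \<open>Induction on the number of functionals: subtracting a suitable multiple of the new one
  from \<open>L\<close> makes it vanish on the common kernel of the old ones.\<close>

lemma functional_in_span_of_functionals:
  assumes "finite I" "subspace V" "\<And>i. i \<in> I \<Longrightarrow> linear_on V (f i)" "linear_on V L"
    and "\<And>x. x \<in> V \<Longrightarrow> (\<And>i. i \<in> I \<Longrightarrow> f i x = 0) \<Longrightarrow> L x = 0"
  shows "\<exists>c. \<forall>x\<in>V. L x = (\<Sum>i\<in>I. c i * f i x)"
  using assms(1,3-)
proof (induction I arbitrary: L rule: finite_induct)
  case empty
  then show ?case by auto
next
  case (insert j I)
  have fj: "linear_on V (f j)" using insert by auto
  obtain a where a: "\<And>x. x \<in> V \<Longrightarrow> (\<And>i. i \<in> I \<Longrightarrow> f i x = 0) \<Longrightarrow> L x - a * f j x = 0"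
  proof (cases "\<exists>x0\<in>V. (\<forall>i\<in>I. f i x0 = 0) \<and> f j x0 \<noteq> 0")
    case True
    then obtain x0 where x0: "x0 \<in> V" "\<forall>i\<in>I. f i x0 = 0" "f j x0 \<noteq> 0" by auto
    \<comment> \<open>The coefficient is forced by the value at \<open>x0\<close>. Subtracting a
      multiple of \<open>x0\<close> from \<open>x\<close> reaches the kernel of \<open>f j\<close>
      without leaving the other kernels.\<close>
    have "L x - (L x0 / f j x0) * f j x = 0" if x: "x \<in> V" "\<And>i. i \<in> I \<Longrightarrow> f i x = 0" for x
    proof -
      let ?s = "f j x / f j x0"
      have sx: "?s *\<^sub>R x0 \<in> V" using x0 assms(2) by (simp add: subspace_scale)
      have d: "g (x - ?s *\<^sub>R x0) = g x - ?s * g x0" if "linear_on V g" for g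
        using linear_on_diff[OF that assms(2) x(1) sx] linear_on_scale[OF that x0(1)] by simp
      have "L (x - ?s *\<^sub>R x0) = 0"
      proof (rule insert.prems(3))
        show "x - ?s *\<^sub>R x0 \<in> V" using assms(2) x sx by (simp add: subspace_diff)
        show "f i (x - ?s *\<^sub>R x0) = 0" if "i \<in> insert j I" for i
          using that x0 x d[OF insert.prems(1)[OF that]] by auto
      qed
      then show ?thesis using d[OF insert.prems(2)] by (simp add: field_simps)
    qed
    then show ?thesis using that by blast
  next
    case False
    then show ?thesis using that[of 0] insert.prems(3) by auto
  qed
  obtain c where c: "\<forall>x\<in>V. L x - a * f j x = (\<Sum>i\<in>I. c i * f i x)"
    using insert.IH[OF insert.prems(1) linear_on_combination[OF insert.prems(2) fj] a] by blast
  have "(\<Sum>i\<in>insert j I. (c(j := a)) i * f i x) = a * f j x + (\<Sum>i\<in>I. c i * f i x)" for x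
    using insert.hyps by (auto intro!: sum.cong)
  then show ?case using c by (intro exI[of _ "c(j := a)"]) (auto simp: algebra_simps)
qed

text \<open>A common zero of the functionals \<open>B e\<close>, with \<open>e\<close> in a basis,
  lies in the radical and is therefore 0. So \<open>L\<close> is a combination of the
  \<open>B e\<close>, and the same coefficients, applied to the basis vectors, give the solution by
  symmetry.\<close>

lemma symmetric_form_unique_solution:
  assumes V: "subspace V" "finite A" "V \<subseteq> span A"
    and sym: "\<And>x y. x \<in> V \<Longrightarrow> y \<in> V \<Longrightarrow> B x y = B y x"
    and lin: "\<And>x. x \<in> V \<Longrightarrow> linear_on V (B x)"
    and nondeg: "\<And>x. x \<in> V \<Longrightarrow> (\<And>y. y \<in> V \<Longrightarrow> B x y = 0) \<Longrightarrow> x = 0"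
    and L: "linear_on V L"
  shows "\<exists>!w. w \<in> V \<and> (\<forall>y\<in>V. B w y = L y)"
proof -
  obtain E where E: "E \<subseteq> V" "independent E" "V \<subseteq> span E"
    using maximal_independent_subset[of V] by blast
  have "finite E"
    using independent_span_bound[OF V(2) E(2)] E(1) V(3) by auto
  have combination: "\<exists>c. y = (\<Sum>e\<in>E. c e *\<^sub>R e)" if "y \<in> V" for y
    using that E(3) span_finite[OF \<open>finite E\<close>] by auto
  have "\<exists>c. \<forall>x\<in>V. L x = (\<Sum>e\<in>E. c e * B e x)"
  proof (rule functional_in_span_of_functionals[OF \<open>finite E\<close> V(1) _ L])
    show "linear_on V (B e)" if "e \<in> E" for e using that lin E by auto
    fix x assume x: "x \<in> V" "\<And>e. e \<in> E \<Longrightarrow> B e x = 0"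
    have "x = 0"
    proof (rule nondeg[OF x(1)])
      fix y assume "y \<in> V"
      then obtain c where c: "y = (\<Sum>e\<in>E. c e *\<^sub>R e)" using combination by blast
      have "B x y = (\<Sum>e\<in>E. c e * B x e)"
        unfolding c by (rule linear_on_sum[OF lin[OF x(1)] V(1)]) (use E in auto)
      also have "\<dots> = 0" using x sym E by (intro sum.neutral) auto
      finally show "B x y = 0" .
    qed
    then show "L x = 0" using linear_on_scale[OF L x(1), of 0] by simp
  qed
  then obtain c where c: "\<And>x. x \<in> V \<Longrightarrow> L x = (\<Sum>e\<in>E. c e * B e x)" by blast
  define w where "w = (\<Sum>e\<in>E. c e *\<^sub>R e)"
  have w: "w \<in> V" unfolding w_def using E V by (intro subspace_sum subspace_scale) auto
  have Bw: "B w y = L y" if "y \<in> V" for y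
  proof -
    have "B w y = B y w" using sym w that by auto
    also have "\<dots> = (\<Sum>e\<in>E. c e * B y e)"
      unfolding w_def by (rule linear_on_sum[OF lin[OF that] V(1)]) (use E in auto)
    also have "\<dots> = L y" using c that sym E by (auto intro!: sum.cong)
    finally show ?thesis .
  qed
  have "w' = w" if w': "w' \<in> V" "\<forall>y\<in>V. B w' y = L y" for w'
  proof -
    have d: "w' - w \<in> V" using w w' V by (simp add: subspace_diff)
    have "w' - w = 0"
    proof (rule nondeg[OF d])
      fix y assume y: "y \<in> V"
      have "B (w' - w) y = B y (w' - w)" using sym d y by auto
      also have "\<dots> = B y w' - B y w" by (rule linear_on_diff[OF lin[OF y] V(1) w'(1) w])
      also have "\<dots> = 0" using sym[OF y w'(1)] sym[OF y w] w'(2) y Bw by simp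
      finally show "B (w' - w) y = 0" .
    qed
    then show ?thesis by simp
  qed
  then show ?thesis using w Bw by blast
qed

section \<open>Rank-one change of variables\<close>

text \<open>The matrix determinant lemma. It supplies the Jacobian of the affine maps that send
  prisms over a facet to slanted prisms.\<close>

lemma det_rank_one_update:
  fixes u v :: "real^'n"
  shows "det (matrix (\<lambda>x. x + (v \<bullet> x) *\<^sub>R u)) = 1 + v \<bullet> u"
proof (cases "v = 0")
  case True
  have "matrix (\<lambda>x::real^'n. x) = mat 1" by (simp add: matrix_def mat_def axis_def vec_eq_iff)
  then show ?thesis using True by simp
next
  case False
  then obtain k where k: "v $ k \<noteq> 0" by (metis vec_eq_iff zero_index)
  \<comment> \<open>Use \<open>v \<bullet> x\<close> as the \<open>k\<close>-th coordinate; then only the \<open>k\<close>-th column differs from the identity.\<close>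
  define M where "M = matrix (\<lambda>x. x + (v \<bullet> x) *\<^sub>R u)"
  define P :: "real^'n^'n" where "P = (\<chi> i. if i = k then v else axis i 1)"
  define b where "b = P *v u"
  define w where "w = axis k 1 + b"
  define N :: "real^'n^'n" where "N = (\<chi> i j. if j = k then w $ i else mat 1 $ i $ j)"
  have Pv: "P *v x = (\<chi> i. if i = k then v \<bullet> x else x $ i)" for x
  proof -
    have "(P *v x) $ i = P $ i \<bullet> x" for i
      by (simp add: matrix_vector_mult_def inner_vec_def)
    then show ?thesis by (simp add: vec_eq_iff P_def inner_axis')
  qed
  have row1: "row i (mat 1 :: real^'n^'n) = axis i 1" for i
    by (auto simp: vec_eq_iff row_def mat_def axis_def)
  have detP: "det P = v $ k"
  proof -
    have "sum (\<lambda>i. v $ i *s row i (mat 1 :: real^'n^'n)) UNIV = v"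
      unfolding row1 by (rule basis_expansion)
    then have "P = (\<chi> i. if i = k then (\<Sum>i\<in>UNIV. v $ i *s row i (mat 1 :: real^'n^'n)) else row i (mat 1 :: real^'n^'n))"
      by (simp add: P_def row1 vec_eq_iff)
    then show ?thesis
      using cramer_lemma_transpose[where x = v and k = k and A = "mat 1"] by simp
  qed
  have detN: "det N = w $ k"
    using cramer_lemma[where k = k and A = "mat 1" and x = w]
    unfolding matrix_vector_mul_lid N_def by simp
  have Nv: "N *v x = x + (x $ k) *\<^sub>R b" for x
  proof -
    have "(N *v x) $ i = (x + (x $ k) *\<^sub>R b) $ i" for i
    proof -
      have N: "N $ i $ j = (mat 1 :: real^'n^'n) $ i $ j + (if j = k then b $ i else 0)" for j
        by (auto simp: N_def w_def mat_def axis_def)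
      have "(N *v x) $ i = ((mat 1 :: real^'n^'n) *v x) $ i
          + (\<Sum>j\<in>UNIV. (if j = k then b $ i else 0) * x $ j)"
        by (simp only: matrix_vector_mult_def vec_lambda_beta N distrib_right sum.distrib)
      also have "(\<Sum>j\<in>UNIV. (if j = k then b $ i else 0) * x $ j)
          = (\<Sum>j\<in>UNIV. if j = k then b $ i * x $ k else 0)"
        by (rule sum.cong) auto
      finally show ?thesis by simp
    qed
    then show ?thesis by (simp add: vec_eq_iff)
  qed
  have lin: "linear (\<lambda>x. x + (v \<bullet> x) *\<^sub>R u)"
    by (intro linearI) (auto simp: inner_add_right algebra_simps)
  have Mv: "M *v x = x + (v \<bullet> x) *\<^sub>R u" for x
    unfolding M_def using lin by simp
  have "P ** M = N ** P"
    unfolding matrix_eq matrix_vector_mul_assoc[symmetric] Nv Mv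
    by (simp add: Pv b_def vec_eq_iff inner_add_right)
  then have "det P * det M = det N * det P" by (metis det_mul)
  then have "det M = det N" using detP k by simp
  then show ?thesis unfolding M_def detN w_def b_def by (simp add: Pv)
qed

text \<open>The linear change of variables of the library needs a well-ordered index type.\<close>

typedef 'a wo = "UNIV :: 'a set" by auto

instance wo :: (finite) finite
proof
  have "UNIV = range (Abs_wo :: 'a \<Rightarrow> 'a wo)"
    by (metis Rep_wo_inverse surjI)
  then show "finite (UNIV :: 'a wo set)" by (metis finite finite_imageI)
qed

instantiation wo :: (finite) wellorder
begin

definition less_eq_wo :: "'a wo \<Rightarrow> 'a wo \<Rightarrow> bool" where
  "x \<le> y \<longleftrightarrow> to_nat (Rep_wo x) \<le> to_nat (Rep_wo y)"

definition less_wo :: "'a wo \<Rightarrow> 'a wo \<Rightarrow> bool" where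
  "x < y \<longleftrightarrow> to_nat (Rep_wo x) < to_nat (Rep_wo y)"

instance
proof
  fix P :: "'a wo \<Rightarrow> bool" and a
  assume step: "\<And>x. (\<And>y. y < x \<Longrightarrow> P y) \<Longrightarrow> P x"
  show "P a"
  proof (induction a rule: measure_induct_rule[of "\<lambda>a. to_nat (Rep_wo a)"])
    case (less a)
    show ?case by (rule step, rule less) (simp add: less_wo_def)
  qed
qed (auto simp: less_eq_wo_def less_wo_def Rep_wo_inject)

end

text \<open>Lebesgue measure is characterised by its values on boxes. The preimage of a box is its
  image under the inverse map, whose determinant is the reciprocal of
  \<open>1 + v \<bullet> u\<close>.\<close>

lemma lborel_rank_one_wellorder:
  fixes u v :: "real^('n::{finite,wellorder})"
  assumes "1 + v \<bullet> u \<noteq> 0"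
  shows "lborel = density (distr lborel borel (\<lambda>x. x + (v \<bullet> x) *\<^sub>R u)) (\<lambda>_. ennreal \<bar>1 + v \<bullet> u\<bar>)"
    (is "_ = density (distr lborel borel ?M) _")
proof (rule lborel_eqI)
  define d where "d = 1 + v \<bullet> u"
  \<comment> \<open>Sherman-Morrison: the inverse of a rank-one update of the identity is again one,
    with \<open>v\<close> divided by \<open>- d\<close>.\<close>
  define N where "N x = x + ((- (1 / d)) *\<^sub>R v \<bullet> x) *\<^sub>R u" for x
  have d: "d \<noteq> 0" using assms by (simp add: d_def)
  have "det (matrix N) = 1 - (v \<bullet> u) / d"
    using det_rank_one_update[of "(- (1 / d)) *\<^sub>R v" u] by (simp add: N_def[abs_def])
  also have "\<dots> = 1 / d" using d by (simp add: field_simps) (simp add: d_def)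
  finally have detN: "det (matrix N) = 1 / d" .
  have lin: "linear N"
    unfolding N_def[abs_def] by (intro linearI) (auto simp: inner_add_right algebra_simps)
  have vu: "v \<bullet> u = d - 1" by (simp add: d_def)
  have NM: "N (?M x) = x" for x
  proof -
    have "v \<bullet> ?M x = (v \<bullet> x) * d" by (simp add: inner_add_right vu algebra_simps)
    then show ?thesis using d by (simp add: N_def)
  qed
  have MN: "?M (N x) = x" for x
  proof -
    have "v \<bullet> N x = (v \<bullet> x) / d" using d by (simp add: N_def inner_add_right inner_diff_right vu field_simps)
    then show ?thesis using d by (simp add: N_def)
  qed
  fix l r :: "real^'n::_" assume le: "\<And>b. b \<in> Basis \<Longrightarrow> l \<bullet> b \<le> r \<bullet> b"
  have M: "?M \<in> borel \<rightarrow>\<^sub>M borel"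
    by (intro borel_measurable_continuous_onI continuous_intros)
  have pre: "?M -` box l r = N ` box l r"
    by (auto simp: NM MN image_iff) (metis NM)
  have "N ` box l r \<in> sets borel" using M pre by (metis borel_open measurable_sets_borel open_box)
  moreover have "N ` box l r \<in> lmeasurable" by (rule measurable_linear_image[OF lin]) auto
  ultimately have "emeasure lborel (N ` box l r) = ennreal (measure lebesgue (N ` box l r))"
    using emeasure_eq_measure2[of "N ` box l r" lebesgue] by simp
  also have "\<dots> = ennreal (\<bar>1 / d\<bar> * (\<Prod>b\<in>Basis. (r - l) \<bullet> b))"
    using measure_linear_image[OF lin, of "box l r"] le
    by (simp add: detN measure_lborel_box_eq inner_diff_left)
  finally have em: "emeasure lborel (N ` box l r) = ennreal (\<bar>1 / d\<bar> * (\<Prod>b\<in>Basis. (r - l) \<bullet> b))" .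
  have "emeasure (density (distr lborel borel ?M) (\<lambda>_. ennreal \<bar>d\<bar>)) (box l r) = ennreal \<bar>d\<bar> * emeasure lborel (N ` box l r)"
    using M by (simp add: emeasure_density emeasure_distr pre nn_integral_cmult_indicator)
  also have "\<dots> = ennreal (\<bar>d\<bar> * (\<bar>1 / d\<bar> * (\<Prod>b\<in>Basis. (r - l) \<bullet> b)))"
    unfolding em using le by (intro ennreal_mult[symmetric]) (auto intro!: mult_nonneg_nonneg prod_nonneg simp: inner_diff_left)
  also have "\<bar>d\<bar> * (\<bar>1 / d\<bar> * (\<Prod>b\<in>Basis. (r - l) \<bullet> b)) = (\<Prod>b\<in>Basis. (r - l) \<bullet> b)"
    using d by simp
  finally show "emeasure (density (distr lborel borel ?M) (\<lambda>_. ennreal \<bar>1 + v \<bullet> u\<bar>)) (box l r) = (\<Prod>b\<in>Basis. (r - l) \<bullet> b)"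
    by (simp add: d_def)
qed simp

definition to_wo :: "real^'n \<Rightarrow> real^('n wo)" where "to_wo x = (\<chi> i. x $ Rep_wo i)"
definition from_wo :: "real^('n wo) \<Rightarrow> real^'n" where "from_wo x = (\<chi> i. x $ Abs_wo i)"

lemma wo_inverse [simp]: "to_wo (from_wo x) = x" "from_wo (to_wo y) = y"
  by (simp_all add: to_wo_def from_wo_def vec_eq_iff Rep_wo_inverse Abs_wo_inverse)

lemma bij_Rep_wo: "bij Rep_wo"
  by (metis Abs_wo_inverse Rep_wo_inverse UNIV_I bijI')

lemma linear_wo: "linear to_wo" "linear from_wo"
  by (auto intro!: linearI simp: to_wo_def from_wo_def vec_eq_iff)

lemma inner_to_wo: "to_wo x \<bullet> to_wo y = x \<bullet> y"
  unfolding inner_vec_def to_wo_def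
  using sum.reindex_bij_betw[OF bij_Rep_wo, of "\<lambda>i. x $ i \<bullet> y $ i"] by simp

lemma borel_measurable_wo [measurable]: "to_wo \<in> borel \<rightarrow>\<^sub>M borel" "from_wo \<in> borel \<rightarrow>\<^sub>M borel"
  by (intro borel_measurable_continuous_onI linear_continuous_on linear_conv_bounded_linear[THEN iffD1] linear_wo)+

text \<open>Relabelling the coordinates turns boxes into boxes with the same side lengths.\<close>

lemma lborel_from_wo: "lborel = distr lborel borel (from_wo :: _ \<Rightarrow> real^'n)"
proof (rule lborel_eqI)
  fix l u :: "real^'n" assume le: "\<And>b. b \<in> Basis \<Longrightarrow> l \<bullet> b \<le> u \<bullet> b"
  have le': "l $ i \<le> u $ i" for i
    using le[of "axis i 1"] by (auto simp: Basis_vec_def inner_axis)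
  have "from_wo -` box l u = box (to_wo l) (to_wo u)"
    by (auto simp: mem_box_cart to_wo_def from_wo_def) (metis Abs_wo_inverse Rep_wo_inverse UNIV_I)+
  moreover have "(\<Prod>b\<in>Basis. (to_wo u - to_wo l) \<bullet> b) = (\<Prod>b\<in>Basis. (u - l) \<bullet> b)"
  proof -
    have eq: "(\<Prod>b\<in>Basis. (x::real^'m) \<bullet> b) = (\<Prod>i\<in>UNIV. x $ i)" for x
    proof -
      have B: "Basis = (\<lambda>i. axis i (1::real) :: real^'m) ` UNIV"
        by (auto simp: Basis_vec_def)
      show ?thesis unfolding B
        by (subst prod.reindex) (auto simp: inj_on_def axis_eq_axis inner_axis)
    qed
    show ?thesis unfolding eq
      using prod.reindex_bij_betw[OF bij_Rep_wo, of "\<lambda>i. (u - l) $ i"] by (simp add: to_wo_def)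
  qed
  moreover have "(to_wo l \<bullet> b) \<le> (to_wo u \<bullet> b)" if "b \<in> Basis" for b
    using that le' by (auto simp: Basis_vec_def inner_axis to_wo_def)
  ultimately show "emeasure (distr lborel borel from_wo) (box l u) = (\<Prod>b\<in>Basis. (u - l) \<bullet> b)"
    by (simp add: emeasure_distr emeasure_lborel_box_eq)
qed simp

text \<open>The map is transported to the ordered copy of the index type and back. With
  \<open>v = a l\<close>, such maps carry the upright prism over a facet onto the slanted one swept
  by pushing that facet along an edge.\<close>

lemma lebesgue_integral_rank_one:
  fixes u v c :: "real^'n" and h :: "real^'n \<Rightarrow> real"
  assumes "1 + v \<bullet> u \<noteq> 0" and h [measurable]: "h \<in> borel_measurable borel"
  shows "integral\<^sup>L lborel h = \<bar>1 + v \<bullet> u\<bar> * integral\<^sup>L lborel (\<lambda>x. h (c + (x + (v \<bullet> x) *\<^sub>R u)))"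
proof -
  let ?M = "\<lambda>x. x + (v \<bullet> x) *\<^sub>R u"
  let ?N = "\<lambda>x. x + (to_wo v \<bullet> x) *\<^sub>R to_wo u"
  have NM: "from_wo (?N x) = ?M (from_wo x)" for x
  proof -
    have "to_wo v \<bullet> x = v \<bullet> from_wo x" by (metis inner_to_wo wo_inverse(1))
    then show ?thesis by (simp add: linear_add[OF linear_wo(2)] linear_scale[OF linear_wo(2)])
  qed
  have M [measurable]: "?M \<in> borel \<rightarrow>\<^sub>M borel" "?N \<in> borel \<rightarrow>\<^sub>M borel"
    by (intro borel_measurable_continuous_onI continuous_intros)+
  have main: "integral\<^sup>L lborel g = \<bar>1 + v \<bullet> u\<bar> * integral\<^sup>L lborel (\<lambda>x. g (?M x))"
    if g [measurable]: "g \<in> borel_measurable borel" for g :: "real^'n \<Rightarrow> real"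
  proof -
    have "integral\<^sup>L lborel g = integral\<^sup>L lborel (\<lambda>y. g (from_wo y))"
      by (subst lborel_from_wo) (simp add: integral_distr)
    also have "\<dots> = \<bar>1 + v \<bullet> u\<bar> * integral\<^sup>L lborel (\<lambda>y. g (from_wo (?N y)))"
      by (subst lborel_rank_one_wellorder[of "to_wo v" "to_wo u"])
        (use assms(1) in \<open>simp_all add: inner_to_wo integral_density integral_distr\<close>)
    also have "integral\<^sup>L lborel (\<lambda>y. g (from_wo (?N y))) = integral\<^sup>L lborel (\<lambda>x. g (?M x))"
      unfolding NM by (subst (2) lborel_from_wo) (simp add: integral_distr)
    finally show ?thesis .
  qed
  have "integral\<^sup>L lborel h = integral\<^sup>L lborel (\<lambda>x. h (c + x))"
    by (subst lborel_distr_plus[of c, symmetric]) (simp add: integral_distr)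
  also have "\<dots> = \<bar>1 + v \<bullet> u\<bar> * integral\<^sup>L lborel (\<lambda>x. h (c + ?M x))"
    by (rule main) measurable
  finally show ?thesis .
qed

section \<open>Polynomials\<close>

definition mono_fun :: "('n \<Rightarrow> nat) \<Rightarrow> real^'n \<Rightarrow> real" where
  "mono_fun e = (\<lambda>x. \<Prod>i\<in>UNIV. (x $ i) ^ e i)"

lemma finite_multi_indices: "finite {e :: 'n::finite \<Rightarrow> nat. sum e UNIV \<le> k}"
proof (rule finite_subset)
  show "{e :: 'n \<Rightarrow> nat. sum e UNIV \<le> k} \<subseteq> (\<Pi>\<^sub>E i\<in>UNIV. {..k})"
  proof (clarsimp simp: PiE_UNIV_domain)
    fix e :: "'n \<Rightarrow> nat" and i assume "sum e UNIV \<le> k"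
    moreover have "e i \<le> sum e UNIV" by (rule member_le_sum) auto
    ultimately show "e i \<le> k" by simp
  qed
  show "finite (\<Pi>\<^sub>E i\<in>(UNIV::'n set). {..k})" by (intro finite_PiE) auto
qed

text \<open>\<open>Pk\<close> sums over exponents, the span over functions; passing from the span
  back to exponents uses that different exponents give different monomials.\<close>

lemma Pk_eq_span: "Pk k = span (mono_fun ` {e :: 'n::finite \<Rightarrow> nat. sum e UNIV \<le> k})"
proof -
  have inj: "inj_on mono_fun A" for A :: "('n \<Rightarrow> nat) set"
  proof (rule inj_onI)
    fix e f :: "'n \<Rightarrow> nat" assume eq: "mono_fun e = mono_fun f"
    show "e = f"
    proof
      fix i
      \<comment> \<open>Evaluation at the point with \<open>i\<close>-th coordinate 2 and all others
        1 isolates the exponent of \<open>i\<close>.\<close>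
      have "(\<Prod>j\<in>UNIV. ((\<chi> j. if j = i then (2::real) else 1) $ j) ^ g j) = 2 ^ g i" for g :: "'n \<Rightarrow> nat"
      proof -
        have "(\<Prod>j\<in>UNIV. ((\<chi> j. if j = i then (2::real) else 1) $ j) ^ g j)
            = (\<Prod>j\<in>UNIV. if j = i then 2 ^ g j else 1)"
          by (rule prod.cong) auto
        then show ?thesis by simp
      qed
      then have "(2::real) ^ e i = 2 ^ f i"
        using fun_cong[OF eq, of "\<chi> j. if j = i then 2 else 1"] unfolding mono_fun_def by metis
      then show "e i = f i" by simp
    qed
  qed
  have "p \<in> Pk k \<longleftrightarrow> p \<in> span (mono_fun ` {e. sum e UNIV \<le> k})" for p :: "real^'n \<Rightarrow> real"
  proof
    assume "p \<in> Pk k"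
    then obtain c where "\<And>x. p x = (\<Sum>e\<in>{e. sum e UNIV \<le> k}. c e * mono_fun e x)"
      unfolding Pk_def mono_fun_def by blast
    then have "p = (\<Sum>e\<in>{e. sum e UNIV \<le> k}. c e *\<^sub>R mono_fun e)"
      by (auto simp: fun_eq_iff sum_fun_apply)
    moreover have "(\<Sum>e\<in>{e. sum e UNIV \<le> k}. c e *\<^sub>R mono_fun e) \<in> span (mono_fun ` {e. sum e UNIV \<le> k})"
      by (intro span_sum span_scale span_base) auto
    ultimately show "p \<in> span (mono_fun ` {e. sum e UNIV \<le> k})" by simp
  next
    assume "p \<in> span (mono_fun ` {e. sum e UNIV \<le> k})"
    then obtain c where "p = (\<Sum>q\<in>mono_fun ` {e. sum e UNIV \<le> k}. c q *\<^sub>R q)"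
      unfolding span_finite[OF finite_imageI[OF finite_multi_indices]] by blast
    then have "p = (\<Sum>e\<in>{e. sum e UNIV \<le> k}. c (mono_fun e) *\<^sub>R mono_fun e)"
      by (simp add: sum.reindex[OF inj])
    then have "\<forall>x. p x = (\<Sum>e\<in>{e. sum e UNIV \<le> k}. c (mono_fun e) * (\<Prod>i\<in>UNIV. (x $ i) ^ e i))"
      by (simp add: sum_fun_apply mono_fun_def)
    then show "p \<in> Pk k"
      unfolding Pk_def by (auto intro: exI[of _ "\<lambda>e. c (mono_fun e)"])
  qed
  then show ?thesis by blast
qed

lemma subspace_Pk: "subspace (Pk k)"
  unfolding Pk_eq_span by simp

lemma Pk_add: "p \<in> Pk k \<Longrightarrow> q \<in> Pk k \<Longrightarrow> (\<lambda>x. p x + q x) \<in> Pk k"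
  and Pk_diff: "p \<in> Pk k \<Longrightarrow> q \<in> Pk k \<Longrightarrow> (\<lambda>x. p x - q x) \<in> Pk k"
  and Pk_scale: "p \<in> Pk k \<Longrightarrow> (\<lambda>x. c * p x) \<in> Pk k"
  and Pk_zero: "(\<lambda>x. 0) \<in> Pk k"
  using subspace_add[OF subspace_Pk, of p k q] subspace_diff[OF subspace_Pk, of p k q]
    subspace_scale[OF subspace_Pk, of p k c] subspace_0[OF subspace_Pk, of k]
  by (auto simp: plus_fun_def fun_diff_def scaleR_fun_def zero_fun_def)

lemma Pk_sum: "(\<And>i. i \<in> A \<Longrightarrow> p i \<in> Pk k) \<Longrightarrow> (\<lambda>x. \<Sum>i\<in>A. p i x) \<in> Pk k"
  by (induction A rule: infinite_finite_induct) (auto intro: Pk_add Pk_zero)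

lemma Pk_mono: "k \<le> l \<Longrightarrow> Pk k \<subseteq> Pk l"
  unfolding Pk_eq_span by (intro span_mono) auto

lemma mono_fun_in_Pk: "sum e UNIV \<le> k \<Longrightarrow> mono_fun e \<in> Pk k"
  unfolding Pk_eq_span by (auto intro: span_base)

lemma mono_fun_0: "mono_fun (\<lambda>_. 0) = (\<lambda>x. 1)"
  by (simp add: mono_fun_def)

lemma mono_fun_step:
  fixes e :: "'n::finite \<Rightarrow> nat"
  shows "x $ i * mono_fun e x = mono_fun (e(i := Suc (e i))) x"
    and "sum (e(i := Suc (e i))) UNIV = Suc (sum e UNIV)"
proof -
  have "(\<Prod>j\<in>UNIV - {i}. x $ j ^ (e(i := Suc (e i))) j) = (\<Prod>j\<in>UNIV - {i}. x $ j ^ e j)"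
    by (rule prod.cong) auto
  then show "x $ i * mono_fun e x = mono_fun (e(i := Suc (e i))) x"
    unfolding mono_fun_def by (simp add: prod.remove[of UNIV i])
  have "(\<Sum>j\<in>UNIV - {i}. (e(i := Suc (e i))) j) = (\<Sum>j\<in>UNIV - {i}. e j)"
    by (rule sum.cong) auto
  then show "sum (e(i := Suc (e i))) UNIV = Suc (sum e UNIV)"
    by (simp add: sum.remove[of UNIV i])
qed

text \<open>Peeling off one coordinate drives the induction for derivatives and, on a facet, the
  splitting of a monomial along barycentric coordinates.\<close>

lemma mono_fun_cases:
  fixes e :: "'n::finite \<Rightarrow> nat"
  obtains "sum e UNIV = 0" "mono_fun e = (\<lambda>x. 1)"
  | i e' where "sum e UNIV = Suc (sum e' UNIV)" "\<And>x. mono_fun e x = x $ i * mono_fun e' x"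
proof (cases "\<forall>i. e i = 0")
  case True
  then have "e = (\<lambda>_. 0)" by auto
  then show ?thesis using that(1) by (simp add: mono_fun_0)
next
  case False
  then obtain i where i: "e i \<noteq> 0" by auto
  define e' where "e' = e(i := e i - 1)"
  have "e = e'(i := Suc (e' i))" using i by (auto simp: e'_def)
  then show ?thesis using that(2)[of e' i] mono_fun_step(1)[of _ i e'] mono_fun_step(2)[of e' i] by simp
qed

lemma Pk_induct [consumes 1, case_names zero add scale mono]:
  assumes "p \<in> Pk k"
    and "P (\<lambda>x. 0)" "\<And>p q. P p \<Longrightarrow> P q \<Longrightarrow> P (\<lambda>x. p x + q x)" "\<And>c p. P p \<Longrightarrow> P (\<lambda>x. c * p x)"
    and "\<And>e. sum e UNIV \<le> k \<Longrightarrow> P (mono_fun e)"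
  shows "P p"
proof -
  have "subspace (Collect P)"
    using assms(2-4) by (auto simp: subspace_def plus_fun_def scaleR_fun_def zero_fun_def)
  moreover have "mono_fun ` {e. sum e UNIV \<le> k} \<subseteq> Collect P" using assms(5) by auto
  ultimately have "span (mono_fun ` {e. sum e UNIV \<le> k}) \<subseteq> Collect P" by (rule span_minimal[rotated])
  then show ?thesis using assms(1) unfolding Pk_eq_span by auto
qed

lemma Pk_const: "(\<lambda>x. c) \<in> Pk k"
  using Pk_scale[OF mono_fun_in_Pk[of "\<lambda>_. 0" k], of c] by (simp add: mono_fun_0)

lemma Pk_coordinate_mult: "p \<in> Pk k \<Longrightarrow> (\<lambda>x. x $ i * p x) \<in> Pk (Suc k)"
proof (induction rule: Pk_induct)
  case (add p q)
  then show ?case by (simp add: distrib_left Pk_add)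
next
  case (scale c p)
  then show ?case using Pk_scale[OF scale, of c] by (simp add: mult.left_commute)
next
  case (mono e)
  then show ?case unfolding mono_fun_step(1) by (intro mono_fun_in_Pk) (simp only: mono_fun_step(2))
qed (simp add: Pk_zero)

lemma Pk_affine_mult:
  assumes "p \<in> Pk k"
  shows "(\<lambda>x. (a \<bullet> x + b) * p x) \<in> Pk (Suc k)"
proof -
  have "(\<lambda>x. b * p x) \<in> Pk (Suc k)" using assms Pk_mono[of k "Suc k"] by (intro Pk_scale) auto
  moreover have "(\<lambda>x. \<Sum>i\<in>UNIV. a $ i * (x $ i * p x)) \<in> Pk (Suc k)"
    by (intro Pk_sum Pk_scale Pk_coordinate_mult assms)
  ultimately have "(\<lambda>x. b * p x + (\<Sum>i\<in>UNIV. a $ i * (x $ i * p x))) \<in> Pk (Suc k)" by (rule Pk_add)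
  then show ?thesis
    by (simp add: inner_vec_def distrib_right sum_distrib_left sum_distrib_right algebra_simps)
qed

text \<open>Meant for the facet bubble, a product of barycentric coordinates.\<close>

lemma Pk_affine_prod:
  assumes "finite A" "card A \<le> k"
  shows "(\<lambda>x. \<Prod>i\<in>A. a i \<bullet> x + b i) \<in> Pk k"
  using assms
proof (induction A arbitrary: k rule: finite_induct)
  case empty
  then show ?case by (simp add: Pk_const)
next
  case (insert i A)
  then obtain l where "k = Suc l" "card A \<le> l" by (cases k) auto
  then show ?case using Pk_affine_mult[OF insert.IH, of l "a i" "b i"] insert by simp
qed

text \<open>At \<open>k = 0\<close> the natural number \<open>k - 1\<close> is 0 again, and the
  degree bound alone would allow a nonzero constant derivative; the last clause excludes
  this.\<close>

lemma Pk_has_derivative: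
  fixes p :: "real^'n \<Rightarrow> real"
  assumes "p \<in> Pk k"
  obtains D where "\<forall>x. (p has_derivative D x) (at x)" "\<forall>t. (\<lambda>x. D x t) \<in> Pk (k - 1)"
    "k = 0 \<longrightarrow> D = (\<lambda>x t. 0)"
proof -
  let ?P = "\<lambda>k p D. (\<forall>x. (p has_derivative D x) (at x)) \<and> (\<forall>t. (\<lambda>x. D x t) \<in> Pk (k - 1)) \<and>
      (k = 0 \<longrightarrow> D = (\<lambda>x t. 0))"
  have "\<exists>D. ?P k p D"
    using assms
  proof (induction rule: Pk_induct)
    case zero
    then show ?case by (intro exI[of _ "\<lambda>x t. 0"]) (auto intro: Pk_zero)
  next
    case (add p q)
    obtain D where "?P k p D" using add(1) by (elim exE)
    moreover obtain E where "?P k q E" using add(2) by (elim exE)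
    ultimately show ?case
      by (intro exI[of _ "\<lambda>x t. D x t + E x t"]) (auto intro: Pk_add has_derivative_add simp: fun_eq_iff)
  next
    case (scale c p)
    obtain D where "?P k p D" using scale by (elim exE)
    then show ?case
      by (intro exI[of _ "\<lambda>x t. c * D x t"]) (auto intro: Pk_scale has_derivative_mult_right simp: fun_eq_iff)
  next
    case (mono e)
    then show ?case
    proof (induction "sum e UNIV" arbitrary: e k)
      case 0
      show ?case
      proof (cases rule: mono_fun_cases[of e])
        case 1
        show ?thesis unfolding 1(2) by (intro exI[of _ "\<lambda>x t. 0"]) (auto intro: Pk_zero)
      qed (use 0 in simp)
    next
      case (Suc m)
      show ?case
      proof (cases rule: mono_fun_cases[of e])
        case 1
        then show ?thesis using Suc by simp
      next
        case (2 i e')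
        then obtain l where k: "k = Suc l" and e': "sum e' UNIV \<le> l" "m = sum e' UNIV"
          using Suc by (cases k) auto
        obtain D where D: "?P l (mono_fun e') D" using Suc.hyps(1)[OF e'(2) e'(1)] by (elim exE)
        have "(mono_fun e has_derivative (\<lambda>t. x $ i * D x t + t $ i * mono_fun e' x)) (at x)" for x
        proof -
          have "((\<lambda>x. x $ i * mono_fun e' x) has_derivative (\<lambda>t. x $ i * D x t + t $ i * mono_fun e' x)) (at x)"
            using D by (intro has_derivative_mult bounded_linear_imp_has_derivative bounded_linear_vec_nth) auto
          moreover have "mono_fun e = (\<lambda>x. x $ i * mono_fun e' x)" using 2(2) by (rule ext)
          ultimately show ?thesis by (simp only:)
        qed
        moreover have "(\<lambda>x. x $ i * D x t + t $ i * mono_fun e' x) \<in> Pk l" for t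
        proof (rule Pk_add)
          show "(\<lambda>x. t $ i * mono_fun e' x) \<in> Pk l" by (intro Pk_scale mono_fun_in_Pk e')
          \<comment> \<open>At \<open>l = 0\<close> multiplication by a coordinate would raise the
            degree to 1, but there \<open>D\<close> is zero.\<close>
          show "(\<lambda>x. x $ i * D x t) \<in> Pk l"
            using D Pk_coordinate_mult[of "\<lambda>x. D x t" "l - 1" i]
            by (cases l) (auto intro: Pk_zero)
        qed
        ultimately show ?thesis
          by (intro exI[of _ "\<lambda>x t. x $ i * D x t + t $ i * mono_fun e' x"]) (simp add: k)
      qed
    qed
  qed
  then obtain D where "?P k p D" by (elim exE)
  then show ?thesis using that[of D] by auto
qed

lemma Pk_continuous_on:
  assumes "p \<in> Pk k"
  shows "continuous_on S p"
proof -
  obtain D where "\<forall>x. (p has_derivative D x) (at x)" "\<forall>t. (\<lambda>x. D x t) \<in> Pk (k - 1)"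
      "k = 0 \<longrightarrow> D = (\<lambda>x t. 0)"
    using Pk_has_derivative[OF assms] .
  then show ?thesis
    by (intro continuous_at_imp_continuous_on) (blast intro: has_derivative_continuous)
qed

lemma Pk_vec_scaleR: "p \<in> Pk k \<Longrightarrow> (\<lambda>x. p x *\<^sub>R t) \<in> Pk_vec k"
  using Pk_scale[of p k] by (auto simp: Pk_vec_def mult.commute[of "p _"])

lemma Pk_vec_continuous_on: "p \<in> Pk_vec k \<Longrightarrow> continuous_on S p"
  unfolding Pk_vec_def by (subst continuous_on_componentwise) (auto simp: Basis_vec_def inner_axis intro: Pk_continuous_on)

lemma subspace_Pk_vec: "subspace (Pk_vec k)"
  by (auto simp: subspace_def Pk_vec_def Pk_zero Pk_add Pk_scale)

lemma Pk_vec_has_derivative: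
  fixes p :: "real^'n \<Rightarrow> real^'n"
  assumes "p \<in> Pk_vec k"
  obtains D where "\<forall>x. (p has_derivative D x) (at x)" "\<forall>t. continuous_on UNIV (\<lambda>x. D x t)"
proof -
  have "\<exists>D. (\<forall>x. ((\<lambda>x. p x $ i) has_derivative D x) (at x)) \<and> (\<forall>t. (\<lambda>x. D x t) \<in> Pk (k - 1))" for i
  proof -
    have "(\<lambda>x. p x $ i) \<in> Pk k" using assms unfolding Pk_vec_def by simp
    from this obtain D where "\<forall>x. ((\<lambda>x. p x $ i) has_derivative D x) (at x)" "\<forall>t. (\<lambda>x. D x t) \<in> Pk (k - 1)"
        "k = 0 \<longrightarrow> D = (\<lambda>x t. 0)"
      by (rule Pk_has_derivative)
    then show ?thesis by (intro exI[of _ D]) simp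
  qed
  then have "\<exists>D. \<forall>i. (\<forall>x. ((\<lambda>x. p x $ i) has_derivative D i x) (at x)) \<and> (\<forall>t. (\<lambda>x. D i x t) \<in> Pk (k - 1))"
    by (intro choice) simp
  then obtain D where "\<forall>i. (\<forall>x. ((\<lambda>x. p x $ i) has_derivative D i x) (at x)) \<and> (\<forall>t. (\<lambda>x. D i x t) \<in> Pk (k - 1))"
    by (elim exE)
  then have D: "\<And>i x. ((\<lambda>x. p x $ i) has_derivative D i x) (at x)"
      "\<And>i t. (\<lambda>x. D i x t) \<in> Pk (k - 1)"
    by simp_all
  have "(p has_derivative (\<lambda>t. \<chi> i. D i x t)) (at x)" for x
    by (subst has_derivative_componentwise_within) (auto simp: Basis_vec_def inner_axis D(1))
  moreover have "continuous_on UNIV (\<lambda>x. \<chi> i. D i x t)" for t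
    by (intro continuous_on_vec_lambda Pk_continuous_on[OF D(2)])
  ultimately show ?thesis by (intro that) auto
qed

section \<open>Barycentric coordinates of a simplex\<close>

lemma open_Collect_finite_ball:
  assumes "finite A" "\<And>m. m \<in> A \<Longrightarrow> open {x. P m x}"
  shows "open {x. \<forall>m\<in>A. P m x}"
proof -
  have "{x. \<forall>m\<in>A. P m x} = (\<Inter>m\<in>A. {x. P m x})" by auto
  then show ?thesis using assms by (simp add: open_INT)
qed

text \<open>Barycentric coordinates are carried as explicit affine functions with gradient
  \<open>a m\<close>. Facets, normals, projections and prisms then all become equations and
  inequalities in these functions.\<close>

locale full_simplex =
  fixes C :: "(real^'n) set" and a :: "real^'n \<Rightarrow> real^'n" and b :: "real^'n \<Rightarrow> real"
  assumes dim_ge_2: "2 \<le> CARD('n)"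
    and indep: "\<not> affine_dependent C" and card_C: "card C = CARD('n) + 1"
    and coord_vertex: "\<And>m v. m \<in> C \<Longrightarrow> v \<in> C \<Longrightarrow> a m \<bullet> v + b m = (if v = m then 1 else 0)"
begin

definition lam :: "real^'n \<Rightarrow> real^'n \<Rightarrow> real" where "lam m x = a m \<bullet> x + b m"

abbreviation fac :: "real^'n \<Rightarrow> (real^'n) set" where "fac l \<equiv> convex hull (C - {l})"

abbreviation K :: "(real^'n) set" where "K \<equiv> convex hull C"

lemma finite_C: "finite C"
  using indep aff_independent_finite by blast

lemma lam_vertex: "m \<in> C \<Longrightarrow> v \<in> C \<Longrightarrow> lam m v = (if v = m then 1 else 0)"
  using coord_vertex by (simp add: lam_def)

lemma lam_combination:
  assumes "m \<in> C" "S \<subseteq> C" "sum u S = 1"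
  shows "lam m (\<Sum>v\<in>S. u v *\<^sub>R v) = (if m \<in> S then u m else 0)"
proof -
  have fin: "finite S" using assms(2) finite_C finite_subset by blast
  have "lam m (\<Sum>v\<in>S. u v *\<^sub>R v) = (\<Sum>v\<in>S. u v * (a m \<bullet> v)) + sum u S * b m"
    using assms(3) by (simp add: lam_def inner_sum_right)
  also have "\<dots> = (\<Sum>v\<in>S. u v * lam m v)"
    by (simp add: lam_def sum_distrib_right sum.distrib distrib_left)
  also have "\<dots> = (\<Sum>v\<in>S. if v = m then u m else 0)"
    by (rule sum.cong) (use assms lam_vertex in auto)
  finally show ?thesis using fin by simp
qed

lemma affine_hull_C: "affine hull C = UNIV"
proof -
  have "aff_dim C = int CARD('n)"
    using indep card_C affine_independent_iff_card[of C] by simp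
  then show ?thesis using aff_dim_eq_full[of C] by simp
qed

text \<open>The vertices affinely span the whole space, so this holds for every point and not only
  inside the simplex.\<close>

lemma sum_lam: "(\<Sum>m\<in>C. lam m x) = 1"
  and combination_lam: "(\<Sum>m\<in>C. lam m x *\<^sub>R m) = x"
proof -
  have "x \<in> affine hull C" by (simp add: affine_hull_C)
  then obtain u where u: "sum u C = 1" "(\<Sum>v\<in>C. u v *\<^sub>R v) = x"
    unfolding affine_hull_finite[OF finite_C] by auto
  have "lam m x = u m" if "m \<in> C" for m
    using lam_combination[OF that order_refl u(1)] u(2) that by simp
  with u show "(\<Sum>m\<in>C. lam m x) = 1" "(\<Sum>m\<in>C. lam m x *\<^sub>R m) = x" by simp_all
qed

lemma combination_minus:
  assumes "l \<in> C" "lam l x = 0"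
  shows "(\<Sum>m\<in>C - {l}. lam m x) = 1" "(\<Sum>m\<in>C - {l}. lam m x *\<^sub>R m) = x"
  using sum_lam[of x] combination_lam[of x] assms
  by (simp_all add: sum.remove[OF finite_C assms(1)])

lemma mem_K: "x \<in> K \<longleftrightarrow> (\<forall>m\<in>C. 0 \<le> lam m x)"
proof
  assume "x \<in> K"
  then obtain u where u: "\<forall>v\<in>C. 0 \<le> u v" "sum u C = 1" "(\<Sum>v\<in>C. u v *\<^sub>R v) = x"
    unfolding convex_hull_finite[OF finite_C] by auto
  then show "\<forall>m\<in>C. 0 \<le> lam m x" using lam_combination[OF _ order_refl u(2)] by auto
next
  assume "\<forall>m\<in>C. 0 \<le> lam m x"
  then show "x \<in> K" unfolding convex_hull_finite[OF finite_C] using sum_lam[of x] combination_lam[of x]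
    by (intro CollectI exI[of _ "\<lambda>m. lam m x"]) auto
qed

lemma mem_fac:
  assumes "l \<in> C"
  shows "x \<in> fac l \<longleftrightarrow> x \<in> K \<and> lam l x = 0"
proof
  assume x: "x \<in> fac l"
  then obtain u where u: "sum u (C - {l}) = 1" "(\<Sum>v\<in>C-{l}. u v *\<^sub>R v) = x"
    unfolding convex_hull_finite[OF finite_Diff[OF finite_C]] by auto
  show "x \<in> K \<and> lam l x = 0"
    using x hull_mono[of "C - {l}" C convex] lam_combination[OF assms Diff_subset u(1)] u(2) by auto
next
  assume "x \<in> K \<and> lam l x = 0"
  then show "x \<in> fac l"
    unfolding convex_hull_finite[OF finite_Diff[OF finite_C]] mem_K using combination_minus[OF assms, of x]
    by (intro CollectI exI[of _ "\<lambda>m. lam m x"]) auto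
qed

lemma C_other: "\<exists>m. m \<in> C \<and> m \<noteq> l"
proof (rule ccontr)
  assume "\<not> ?thesis"
  then have "C \<subseteq> {l}" by auto
  then show False using card_mono[of "{l}" C] card_C by simp
qed

lemma C_third: "\<exists>m. m \<in> C \<and> m \<noteq> l \<and> m \<noteq> l'"
proof (rule ccontr)
  assume "\<not> ?thesis"
  then have "C \<subseteq> {l, l'}" by auto
  then have "card C \<le> 2" using card_mono[of "{l, l'}" C] card_insert_le_m1[of 2 "{l'}" l] by simp
  then show False using card_C dim_ge_2 by simp
qed

lemma a_nonzero: "m \<in> C \<Longrightarrow> a m \<noteq> 0"
  using C_other[of m] lam_vertex[of m m] lam_vertex[of m] by (fastforce simp: lam_def)

lemma continuous_lam [continuous_intros]: "continuous_on S (lam m)"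
  unfolding lam_def by (intro continuous_intros)

lemma open_lam_pos: "A \<subseteq> C \<Longrightarrow> open {x. \<forall>m\<in>A. 0 < lam m x}"
  using finite_subset[OF _ finite_C] by (intro open_Collect_finite_ball open_Collect_less continuous_intros) auto

lemma rel_interior_hull:
  assumes "S \<subseteq> C"
  shows "rel_interior (convex hull S) = {x. (\<forall>m\<in>S. 0 < lam m x) \<and> (\<forall>m\<in>C - S. lam m x = 0)}"
proof -
  have S: "\<not> affine_dependent S" using indep assms affine_independent_subset by blast
  have fin: "finite S" using assms finite_C finite_subset by blast
  show ?thesis
    unfolding rel_interior_convex_hull_explicit[OF S]
  proof (intro set_eqI iffI)
    fix x assume "x \<in> {y. \<exists>u. (\<forall>x\<in>S. 0 < u x) \<and> sum u S = 1 \<and> (\<Sum>x\<in>S. u x *\<^sub>R x) = y}"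
    then obtain u where "\<forall>x\<in>S. 0 < u x" "sum u S = 1" "(\<Sum>x\<in>S. u x *\<^sub>R x) = x" by auto
    then show "x \<in> {x. (\<forall>m\<in>S. 0 < lam m x) \<and> (\<forall>m\<in>C - S. lam m x = 0)}"
      using lam_combination[OF _ assms, of _ u] assms by auto
  next
    fix x assume x: "x \<in> {x. (\<forall>m\<in>S. 0 < lam m x) \<and> (\<forall>m\<in>C - S. lam m x = 0)}"
    have "(\<Sum>m\<in>S. lam m x) = 1" "(\<Sum>m\<in>S. lam m x *\<^sub>R m) = x"
      using sum.mono_neutral_left[OF finite_C assms, of "\<lambda>m. lam m x"] x sum_lam[of x]
        sum.mono_neutral_left[OF finite_C assms, of "\<lambda>m. lam m x *\<^sub>R m"] combination_lam[of x] by simp_all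
    then show "x \<in> {y. \<exists>u. (\<forall>x\<in>S. 0 < u x) \<and> sum u S = 1 \<and> (\<Sum>x\<in>S. u x *\<^sub>R x) = y}"
      using x by (intro CollectI exI[of _ "\<lambda>m. lam m x"]) auto
  qed
qed

lemma interior_K: "interior K = {x. \<forall>m\<in>C. 0 < lam m x}"
  using rel_interior_interior[of K] rel_interior_hull[OF order_refl] affine_hull_C by simp

lemma rel_interior_fac:
  "l \<in> C \<Longrightarrow> rel_interior (fac l) = {x. lam l x = 0 \<and> (\<forall>m\<in>C - {l}. 0 < lam m x)}"
  using rel_interior_hull[of "C - {l}"] by auto

lemma affine_hull_fac:
  assumes "l \<in> C"
  shows "affine hull (fac l) = {x. lam l x = 0}"
proof -
  have eq: "affine hull (fac l) = affine hull (C - {l})" by (rule affine_hull_convex_hull)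
  show ?thesis unfolding eq affine_hull_finite[OF finite_Diff[OF finite_C]]
  proof (intro set_eqI iffI)
    fix x assume "x \<in> {y. \<exists>u. sum u (C - {l}) = 1 \<and> (\<Sum>v\<in>C - {l}. u v *\<^sub>R v) = y}"
    then show "x \<in> {x. lam l x = 0}" using lam_combination[OF assms Diff_subset] by auto
  next
    fix x assume "x \<in> {x. lam l x = 0}"
    then show "x \<in> {y. \<exists>u. sum u (C - {l}) = 1 \<and> (\<Sum>v\<in>C - {l}. u v *\<^sub>R v) = y}"
      using combination_minus[OF assms, of x] by auto
  qed
qed

lemma cell_facets_K: "cell_facets K = fac ` C"
  unfolding cell_facets_def
  using facet_of_convex_hull_affine_independent_alt[OF indep] card_C dim_ge_2 by auto

lemma inj_fac: "inj_on fac C"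
proof (rule inj_onI)
  fix l m assume lm: "l \<in> C" "m \<in> C" "fac l = fac m"
  show "l = m"
  proof (rule ccontr)
    assume "l \<noteq> m"
    then have "l \<in> fac m" using lm by (intro hull_inc) auto
    then have "l \<in> fac l" using lm by simp
    then show False using mem_fac[OF lm(1)] lam_vertex[of l l] lm by auto
  qed
qed

lemma frontier_K_subset: "K - interior K \<subseteq> \<Union>(fac ` C)"
proof
  fix x assume x: "x \<in> K - interior K"
  then obtain m where m: "m \<in> C" "\<not> 0 < lam m x" unfolding interior_K by auto
  moreover have "0 \<le> lam m x" using x m mem_K by blast
  ultimately have "x \<in> fac m" using x mem_fac[OF m(1)] by auto
  then show "x \<in> \<Union>(fac ` C)" using m by blast
qed

text \<open>\<open>lam l\<close> vanishes on the facet opposite \<open>l\<close> and grows into the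
  simplex, so the outward direction is against its gradient.\<close>

definition nrm :: "real^'n \<Rightarrow> real^'n" where "nrm l = (- 1 / norm (a l)) *\<^sub>R a l"

lemma norm_nrm: "l \<in> C \<Longrightarrow> norm (nrm l) = 1"
  using a_nonzero by (simp add: nrm_def)

text \<open>That \<open>nrm l\<close> qualifies is the sign of \<open>lam l\<close> on the simplex.
  Conversely, the inequality used in both directions between two facet vertices makes any candidate
  orthogonal to the facet; sign and length are then forced.\<close>

lemma out_normal_fac:
  assumes l: "l \<in> C"
  shows "out_normal K (fac l) = nrm l"
  unfolding out_normal_def
proof (rule the_equality)
  have "nrm l \<bullet> (y - x) \<le> 0" if "x \<in> fac l" "y \<in> K" for x y
  proof -
    have "a l \<bullet> (y - x) = lam l y - lam l x" by (simp add: lam_def inner_diff_right)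
    then have "a l \<bullet> (y - x) \<ge> 0" using that l unfolding mem_fac[OF l] mem_K by simp
    then show ?thesis using a_nonzero[OF l] by (simp add: nrm_def)
  qed
  then show "norm (nrm l) = 1 \<and> (\<forall>x\<in>fac l. \<forall>y\<in>K. nrm l \<bullet> (y - x) \<le> 0)"
    using norm_nrm[OF l] by blast
next
  fix n assume n: "norm n = 1 \<and> (\<forall>x\<in>fac l. \<forall>y\<in>K. n \<bullet> (y - x) \<le> 0)"
  obtain v0 where v0: "v0 \<in> C" "v0 \<noteq> l" using C_other by blast
  \<comment> \<open>\<open>a l\<close> has inner product 1 with the edge from \<open>v0\<close> to
    \<open>l\<close>, so subtracting \<open>s *\<^sub>R a l\<close> removes this component of
    \<open>n\<close>. The remainder \<open>w\<close> will be orthogonal to all edges from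
    \<open>v0\<close>, hence zero.\<close>
  define s where "s = n \<bullet> (l - v0)"
  define w where "w = n - s *\<^sub>R a l"
  have infac: "v \<in> fac l" if "v \<in> C" "v \<noteq> l" for v using that by (intro hull_inc) auto
  have inK: "v \<in> K" if "v \<in> C" for v using that by (rule hull_inc)
  have s: "s \<le> 0" using n infac[OF v0] inK[OF l] by (auto simp: s_def)
  have av: "a l \<bullet> (v - v0) = lam l v" if "v \<in> C" for v
    using lam_vertex[OF l v0(1)] v0 by (simp add: lam_def inner_diff_right)
  have w0: "w \<bullet> (v - v0) = 0" if "v \<in> C" for v
  proof (cases "v = l")
    case True
    then show ?thesis using av[OF l] lam_vertex[OF l l] by (simp add: w_def s_def inner_diff_left)
  next
    case False
    have "n \<bullet> (v - v0) \<le> 0" "n \<bullet> (v0 - v) \<le> 0"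
      using n infac[OF v0] inK[OF that] infac[OF that False] inK[OF v0(1)] by auto
    then have "n \<bullet> (v - v0) = 0" by (simp add: inner_diff_right)
    then show ?thesis using av[OF that] lam_vertex[OF l that] False by (simp add: w_def inner_diff_left)
  qed
  have "w \<bullet> (x - v0) = 0" for x
  proof -
    have "x - v0 = (\<Sum>v\<in>C. lam v x *\<^sub>R v) - (\<Sum>v\<in>C. lam v x) *\<^sub>R v0"
      using sum_lam[of x] combination_lam[of x] by simp
    also have "\<dots> = (\<Sum>v\<in>C. lam v x *\<^sub>R (v - v0))"
      by (simp add: scaleR_sum_left sum_subtractf scaleR_diff_right)
    finally show ?thesis using w0 by (simp add: inner_sum_right)
  qed
  from this[of "w + v0"] have "w = 0" by simp
  then have ns: "n = s *\<^sub>R a l" by (simp add: w_def)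
  then have "- s * norm (a l) = 1" using n s by auto
  then have "s = - 1 / norm (a l)" using a_nonzero[OF l] by (simp add: field_simps)
  then show "n = nrm l" using ns by (simp add: nrm_def)
qed

lemma nrm_inner_edge: "l \<in> C \<Longrightarrow> m \<in> C \<Longrightarrow> i \<in> C \<Longrightarrow> nrm i \<bullet> (m - l) = (lam i l - lam i m) / norm (a i)"
  by (simp add: nrm_def lam_def inner_diff_right diff_divide_distrib)

definition proj :: "real^'n \<Rightarrow> real^'n \<Rightarrow> real^'n" where
  "proj l x = x - (lam l x / (norm (a l))\<^sup>2) *\<^sub>R a l"

lemma lam_proj: "l \<in> C \<Longrightarrow> lam l (proj l x) = 0"
  using a_nonzero by (simp add: proj_def lam_def inner_diff_right power2_norm_eq_inner)

lemma continuous_proj [continuous_intros]: "continuous_on S (proj l)"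
  unfolding proj_def divide_inverse by (intro continuous_intros)

lemma proj_fixed: "lam l x = 0 \<Longrightarrow> proj l x = x"
  by (simp add: proj_def)

text \<open>Pythagoras: \<open>x - proj l x\<close> is parallel to \<open>a l\<close>, and
  differences inside the hyperplane are orthogonal to it.\<close>

lemma closest_point_fac:
  assumes l: "l \<in> C"
  shows "closest_point (affine hull (fac l)) x = proj l x"
proof (rule closest_point_unique[symmetric])
  show "proj l x \<in> affine hull fac l" using lam_proj[OF l] affine_hull_fac[OF l] by simp
  show "\<forall>z\<in>affine hull fac l. dist x (proj l x) \<le> dist x z"
  proof
    fix z assume "z \<in> affine hull fac l"
    then have "a l \<bullet> (proj l x - z) = 0"
      using lam_proj[OF l, of x] affine_hull_fac[OF l] by (simp add: lam_def inner_diff_right)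
    then have "orthogonal (x - proj l x) (proj l x - z)"
      by (simp add: orthogonal_def proj_def)
    then have "(norm (x - z))\<^sup>2 = (norm (x - proj l x))\<^sup>2 + (norm (proj l x - z))\<^sup>2"
      using norm_add_Pythagorean by fastforce
    then show "dist x (proj l x) \<le> dist x z"
      by (simp add: dist_norm power2_le_imp_le)
  qed
qed (auto simp: affine_imp_convex)

lemma mem_slab:
  assumes l: "l \<in> C"
  shows "x \<in> slab (fac l) \<longleftrightarrow> proj l x \<in> fac l \<and> \<bar>lam l x\<bar> \<le> norm (a l) / 2"
proof -
  have "dist x (proj l x) = \<bar>lam l x\<bar> / norm (a l)"
    using a_nonzero[OF l] by (simp add: dist_norm proj_def power2_eq_square)
  then have "dist x (proj l x) \<le> 1/2 \<longleftrightarrow> \<bar>lam l x\<bar> \<le> norm (a l) / 2"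
    using a_nonzero[OF l] by (simp add: pos_divide_le_eq)
  then show ?thesis unfolding slab_def closest_point_fac[OF l] by simp
qed

lemma compact_fac: "compact (fac l)"
  using finite_C by (simp add: finite_imp_compact_convex_hull)

lemma compact_K: "compact K"
  using finite_C by (simp add: finite_imp_compact_convex_hull)

lemma compact_slab:
  assumes l: "l \<in> C"
  shows "compact (slab (fac l))"
proof -
  have "slab (fac l) = proj l -` fac l \<inter> {x. \<bar>lam l x\<bar> \<le> norm (a l) / 2}"
    using mem_slab[OF l] by auto
  moreover have "closed (proj l -` fac l)"
    using continuous_proj[of UNIV] compact_imp_closed[OF compact_fac] by (auto intro: continuous_closed_vimage simp: continuous_on_eq_continuous_at)
  moreover have "closed {x. \<bar>lam l x\<bar> \<le> norm (a l) / 2}"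
    by (intro closed_Collect_le continuous_intros)
  ultimately have "closed (slab (fac l))" by (simp add: closed_Int)
  moreover have "bounded (slab (fac l))"
  proof -
    obtain B where B: "\<And>x. x \<in> fac l \<Longrightarrow> norm x \<le> B"
      using compact_imp_bounded[OF compact_fac] unfolding bounded_iff by blast
    have "norm x \<le> B + 1/2" if "x \<in> slab (fac l)" for x
    proof -
      have "dist x (proj l x) \<le> 1/2" "proj l x \<in> fac l"
        using that unfolding slab_def closest_point_fac[OF l] by auto
      then show ?thesis using B[of "proj l x"] norm_triangle_ineq2[of x "proj l x"] by (simp add: dist_norm)
    qed
    then show ?thesis by (auto simp: bounded_iff)
  qed
  ultimately show ?thesis by (simp add: compact_eq_bounded_closed)
qed

text \<open>Facet functions are prescribed on the relative interior only. This null set makes facet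
  integrals blind to their values on the relative boundary.\<close>

lemma slab_null:
  assumes l: "l \<in> C"
  shows "negligible {x \<in> slab (fac l). proj l x \<notin> rel_interior (fac l)}"
proof -
  have "negligible {x. lam m (proj l x) = 0}" if m: "m \<in> C" "m \<noteq> l" for m
  proof -
    define c where "c = (a m \<bullet> a l) / (norm (a l))\<^sup>2"
    have eq: "lam m (proj l x) = (a m - c *\<^sub>R a l) \<bullet> x + (b m - c * b l)" for x
      by (simp add: lam_def proj_def c_def inner_diff_left inner_diff_right algebra_simps add_divide_distrib)
    have "a m - c *\<^sub>R a l \<noteq> 0"
    proof
      assume "a m - c *\<^sub>R a l = 0"
      \<comment> \<open>Dimension at least 2 provides a third vertex. \<open>lam m\<close> separates
        it from \<open>m\<close>, and \<open>proj l\<close> fixes both.\<close>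
      moreover obtain v where v: "v \<in> C" "v \<noteq> l" "v \<noteq> m" using C_third by blast
      ultimately have "lam m (proj l m) = lam m (proj l v)" unfolding eq by simp
      moreover have "proj l m = m" "proj l v = v" using lam_vertex l m v by (auto intro!: proj_fixed)
      ultimately show False using lam_vertex m v by auto
    qed
    then have "negligible {x. (a m - c *\<^sub>R a l) \<bullet> x = - (b m - c * b l)}" by (intro negligible_hyperplane) simp
    moreover have "{x. lam m (proj l x) = 0} = {x. (a m - c *\<^sub>R a l) \<bullet> x = - (b m - c * b l)}"
      unfolding eq by (auto simp: add_eq_0_iff2)
    ultimately show ?thesis by simp
  qed
  then have "negligible (\<Union>m\<in>C - {l}. {x. lam m (proj l x) = 0})"
    using finite_C by (intro negligible_Union) auto
  moreover have "{x \<in> slab (fac l). proj l x \<notin> rel_interior (fac l)} \<subseteq> (\<Union>m\<in>C - {l}. {x. lam m (proj l x) = 0})"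
    unfolding mem_slab[OF l] mem_fac[OF l] mem_K rel_interior_fac[OF l] by force
  ultimately show ?thesis by (rule negligible_subset)
qed

text \<open>Gives an open set inside the domain of integration, as is necessary for concluding
  pointwise vanishing from a zero facet integral.\<close>

lemma rel_interior_in_interior_slab:
  assumes l: "l \<in> C" and x: "x \<in> rel_interior (fac l)"
  shows "x \<in> interior (slab (fac l))"
proof (rule interiorI)
  let ?U = "{x. (\<forall>m\<in>C - {l}. 0 < lam m (proj l x)) \<and> \<bar>lam l x\<bar> < norm (a l) / 2}"
  have "continuous_on UNIV (\<lambda>x. lam m (proj l x))" for m
    unfolding lam_def by (intro continuous_intros)
  then show "open ?U"
    using finite_C by (intro open_Collect_conj open_Collect_finite_ball open_Collect_less continuous_intros) auto
  show "x \<in> ?U" using x proj_fixed a_nonzero[OF l] unfolding rel_interior_fac[OF l] by auto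
  show "?U \<subseteq> slab (fac l)"
    using lam_proj[OF l] unfolding mem_slab[OF l] mem_fac[OF l] mem_K subset_iff
    by (metis (mono_tags, lifting) DiffI less_imp_le mem_Collect_eq order_refl singletonD)
qed

text \<open>Near a point of the open facet the other barycentric coordinates stay positive, so
  \<open>lam l\<close> alone decides membership.\<close>

lemma half_ball:
  assumes l: "l \<in> C" and y: "y \<in> rel_interior (fac l)"
  obtains e where "e > 0" "\<And>x. dist y x < e \<Longrightarrow> lam l x \<ge> 0 \<Longrightarrow> x \<in> K"
    "\<And>x. dist y x < e \<Longrightarrow> lam l x > 0 \<Longrightarrow> x \<in> interior K"
proof -
  have "open {x. \<forall>m\<in>C - {l}. 0 < lam m x}" by (rule open_lam_pos) auto
  moreover have "y \<in> {x. \<forall>m\<in>C - {l}. 0 < lam m x}" using y rel_interior_fac[OF l] by auto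
  ultimately obtain e where e: "e > 0" "ball y e \<subseteq> {x. \<forall>m\<in>C - {l}. 0 < lam m x}"
    by (auto simp: open_contains_ball)
  have pos: "0 < lam m x" if "dist y x < e" "m \<in> C" "m \<noteq> l" for x m
    using e(2) that by auto
  show ?thesis
  proof (rule that[OF e(1)])
    show "x \<in> K" if "dist y x < e" "lam l x \<ge> 0" for x
      unfolding mem_K using pos[OF that(1)] that(2) by (metis less_imp_le)
    show "x \<in> interior K" if "dist y x < e" "lam l x > 0" for x
      unfolding interior_K using pos[OF that(1)] that(2) by auto
  qed
qed

lemma closure_interior_K: "closure (interior K) = K"
proof -
  have "rel_interior K = interior K" using rel_interior_interior[of K] affine_hull_C by simp
  then show ?thesis using convex_closure_rel_interior[of K] compact_imp_closed[OF compact_K] by simp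
qed

end

text \<open>The coordinate of a vertex is the affine function vanishing on the hyperplane through
  the other vertices, scaled to be 1 at that vertex.\<close>

lemma full_simplex_exists:
  fixes K :: "(real^'n) set"
  assumes K: "int CARD('n) simplex K" and n: "2 \<le> CARD('n)"
  obtains C a b where "full_simplex C a b" "K = convex hull C"
proof -
  obtain C where C: "\<not> affine_dependent C" "int (card C) = int CARD('n) + 1" "K = convex hull C"
    using K unfolding simplex_def by auto
  have fin: "finite C" using C aff_independent_finite by blast
  have "\<exists>am bm. \<forall>v\<in>C. am \<bullet> v + bm = (if v = m then 1 else 0)" if m: "m \<in> C" for m
  proof -
    have "\<not> affine_dependent (C - {m})" using C affine_independent_Diff by blast
    then have "aff_dim (C - {m}) = int CARD('n) - 1"
      using affine_independent_iff_card[of "C - {m}"] card_Diff_singleton[OF m] C m fin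
      by (simp add: of_nat_diff Suc_leI card_gt_0_iff)
    then obtain \<alpha> \<beta> where h: "\<alpha> \<noteq> 0" "affine hull (C - {m}) = {x. \<alpha> \<bullet> x = \<beta>}"
      using aff_dim_eq_hyperplane[of "C - {m}"] by auto
    have "m \<notin> affine hull (C - {m})" using C m unfolding affine_dependent_def by blast
    then have ne: "\<alpha> \<bullet> m - \<beta> \<noteq> 0" using h by simp
    have 0: "\<alpha> \<bullet> v = \<beta>" if "v \<in> C" "v \<noteq> m" for v
      using hull_inc[of v "C - {m}" affine] h that by auto
    have "\<forall>v\<in>C. ((1 / (\<alpha> \<bullet> m - \<beta>)) *\<^sub>R \<alpha>) \<bullet> v + (- \<beta> / (\<alpha> \<bullet> m - \<beta>)) = (if v = m then 1 else 0)"
      using ne 0 by (auto simp: diff_divide_distrib[symmetric])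
    then show ?thesis by blast
  qed
  then obtain a b where "\<And>m v. m \<in> C \<Longrightarrow> v \<in> C \<Longrightarrow> a m \<bullet> v + b m = (if v = m then 1 else 0)"
    by metis
  then show ?thesis using C n by (intro that[of C a b] full_simplex.intro) auto
qed

section \<open>Integrals of piecewise continuous functions\<close>

lemma set_integral_spike:
  fixes f g :: "real^'n \<Rightarrow> real"
  assumes "set_integrable lebesgue S f" "negligible N" "\<And>x. x \<in> S - N \<Longrightarrow> g x = f x"
  shows "set_integrable lebesgue S g" "(LINT x:S|lebesgue. g x) = (LINT x:S|lebesgue. f x)"
proof -
  show g: "set_integrable lebesgue S g" by (rule absolutely_integrable_spike[OF assms])
  show "(LINT x:S|lebesgue. g x) = (LINT x:S|lebesgue. f x)"
    unfolding set_lebesgue_integral_eq_integral(2)[OF g] set_lebesgue_integral_eq_integral(2)[OF assms(1)]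
    by (rule integral_spike[OF assms(2)]) (use assms(3) in auto)
qed

lemma set_integral_compact:
  fixes f :: "real^'n \<Rightarrow> real"
  assumes "compact S" "continuous_on S f"
  shows "set_integrable lborel S f" "set_integrable lebesgue S f"
    "(LINT x:S|lebesgue. f x) = (LINT x:S|lborel. f x)"
proof -
  have i: "integrable lborel (\<lambda>x. indicator S x *\<^sub>R f x)"
    by (rule borel_integrable_compact[OF assms])
  then have "(\<lambda>x. indicator S x *\<^sub>R f x) \<in> borel_measurable lborel" by (rule borel_measurable_integrable)
  then show "set_integrable lborel S f" "set_integrable lebesgue S f"
    "(LINT x:S|lebesgue. f x) = (LINT x:S|lborel. f x)"
    unfolding set_integrable_def set_lebesgue_integral_def
    using i integrable_completion integral_completion by blast+
qed

text \<open>The points of \<open>U\<close> where \<open>f\<close> is nonzero form an open null set,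
  and this is empty.\<close>

lemma set_integral_zero_imp_zero:
  fixes f :: "real^'n \<Rightarrow> real"
  assumes f: "set_integrable lebesgue S f" "\<And>x. x \<in> S \<Longrightarrow> 0 \<le> f x" "(LINT x:S|lebesgue. f x) = 0"
    and U: "open U" "U \<subseteq> S" "continuous_on U f" and x: "x \<in> U"
  shows "f x = 0"
proof -
  have "AE x in lebesgue. indicator S x *\<^sub>R f x = 0"
    using f integral_nonneg_eq_0_iff_AE[of lebesgue "\<lambda>x. indicator S x *\<^sub>R f x"]
    unfolding set_integrable_def set_lebesgue_integral_def by (auto simp: indicator_def)
  then have ae: "AE x in lebesgue. x \<in> U \<inter> {x. f x \<noteq> 0} \<longrightarrow> x \<in> {}"
    by eventually_elim (use U in auto)
  have eq: "U \<inter> {x. f x \<noteq> 0} = U \<inter> f -` (- {0})" by auto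
  have op: "open (U \<inter> {x. f x \<noteq> 0})"
    unfolding eq using continuous_on_open_vimage[OF U(1)] U(3) by (metis Int_commute closed_singleton open_Compl)
  show ?thesis
    using mem_closed_if_AE_lebesgue_open[OF op closed_empty] ae x by auto
qed

text \<open>Continuity on an open cell would not bound a function near the boundary. A
  representative continuous on the whole space does, and it also provides the traces.\<close>

definition regular_on :: "(real^'n) set \<Rightarrow> (real^'n \<Rightarrow> 'b::topological_space) \<Rightarrow> bool" where
  "regular_on D g \<longleftrightarrow> (\<exists>p. continuous_on UNIV p \<and> (\<forall>x\<in>D. g x = p x))"

lemma regular_onI: "continuous_on UNIV p \<Longrightarrow> (\<And>x. x \<in> D \<Longrightarrow> g x = p x) \<Longrightarrow> regular_on D g"
  by (auto simp: regular_on_def)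

lemma regular_on_subset: "regular_on D g \<Longrightarrow> E \<subseteq> D \<Longrightarrow> regular_on E g"
  by (auto simp: regular_on_def)

lemma regular_on_const [intro]: "regular_on D (\<lambda>x. c)"
  by (rule regular_onI[of "\<lambda>x. c"]) auto

lemma regular_on_map:
  assumes "continuous_on UNIV h" "regular_on D g"
  shows "regular_on D (\<lambda>x. h (g x))"
proof -
  obtain p where "continuous_on UNIV p" "\<forall>x\<in>D. g x = p x" using assms unfolding regular_on_def by blast
  then show ?thesis
    using continuous_on_compose2[OF assms(1)] by (intro regular_onI[of "\<lambda>x. h (p x)"]) auto
qed

lemma regular_on_map2:
  assumes "continuous_on UNIV (\<lambda>(x, y). h x y)" "regular_on D f" "regular_on D g"
  shows "regular_on D (\<lambda>x. h (f x) (g x))"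
proof -
  obtain p where p: "continuous_on UNIV p" "\<forall>x\<in>D. f x = p x" using assms unfolding regular_on_def by blast
  obtain q where q: "continuous_on UNIV q" "\<forall>x\<in>D. g x = q x" using assms unfolding regular_on_def by blast
  have "continuous_on UNIV (\<lambda>x. (p x, q x))" using p q by (intro continuous_intros)
  then have "continuous_on UNIV (\<lambda>x. h (p x) (q x))"
    using continuous_on_compose2[OF assms(1), of UNIV "\<lambda>x. (p x, q x)"] by auto
  then show ?thesis using p q by (intro regular_onI[of "\<lambda>x. h (p x) (q x)"]) auto
qed

lemma regular_on_add:
  fixes f g :: "real^'n \<Rightarrow> 'b::real_normed_vector"
  shows "regular_on D f \<Longrightarrow> regular_on D g \<Longrightarrow> regular_on D (\<lambda>x. f x + g x)"
  by (rule regular_on_map2[of "(+)"]) (auto simp: case_prod_beta intro!: continuous_intros)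

lemma regular_on_diff:
  fixes f g :: "real^'n \<Rightarrow> 'b::real_normed_vector"
  shows "regular_on D f \<Longrightarrow> regular_on D g \<Longrightarrow> regular_on D (\<lambda>x. f x - g x)"
  by (rule regular_on_map2[of "(-)"]) (auto simp: case_prod_beta intro!: continuous_intros)

lemma regular_on_scaleR:
  fixes s and g :: "real^'n \<Rightarrow> 'b::real_normed_vector"
  shows "regular_on D s \<Longrightarrow> regular_on D g \<Longrightarrow> regular_on D (\<lambda>x. s x *\<^sub>R g x)"
  by (rule regular_on_map2[of "(*\<^sub>R)"]) (auto simp: case_prod_beta intro!: continuous_intros)

lemma regular_on_mult:
  fixes f g :: "real^'n \<Rightarrow> real"
  shows "regular_on D f \<Longrightarrow> regular_on D g \<Longrightarrow> regular_on D (\<lambda>x. f x * g x)"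
  by (rule regular_on_map2[of "(*)"]) (auto simp: case_prod_beta intro!: continuous_intros)

lemma regular_on_inner:
  fixes f g :: "real^'n \<Rightarrow> 'b::real_inner"
  shows "regular_on D f \<Longrightarrow> regular_on D g \<Longrightarrow> regular_on D (\<lambda>x. f x \<bullet> g x)"
  by (rule regular_on_map2[of "(\<bullet>)"]) (auto simp: case_prod_beta intro!: continuous_intros)

lemma regular_on_sum:
  fixes f :: "'i \<Rightarrow> real^'n \<Rightarrow> 'b::real_normed_vector"
  shows "(\<And>i. i \<in> A \<Longrightarrow> regular_on D (f i)) \<Longrightarrow> regular_on D (\<lambda>x. \<Sum>i\<in>A. f i x)"
  by (induction A rule: infinite_finite_induct) (auto intro: regular_on_add)

lemma cell_integrable:
  fixes g :: "real^'n \<Rightarrow> real"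
  assumes "compact K" "convex K" "regular_on (interior K) g"
  shows "set_integrable lebesgue K g"
proof -
  obtain p where p: "continuous_on UNIV p" "\<forall>x\<in>interior K. g x = p x"
    using assms unfolding regular_on_def by blast
  show ?thesis
  proof (rule set_integral_spike(1))
    show "set_integrable lebesgue K p"
      using p by (intro set_integral_compact(2)[OF assms(1)]) (auto intro: continuous_on_subset)
    show "negligible (frontier K)" by (rule negligible_convex_frontier[OF assms(2)])
    show "g x = p x" if "x \<in> K - frontier K" for x
      using that p closure_subset[of K] by (auto simp: frontier_def)
  qed
qed

lemma cell_integral_cong:
  fixes f g :: "real^'n \<Rightarrow> real"
  assumes "compact K" "convex K" "regular_on (interior K) f" "\<And>x. x \<in> interior K \<Longrightarrow> g x = f x"
  shows "(LINT x:K|lebesgue. g x) = (LINT x:K|lebesgue. f x)"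
proof (rule set_integral_spike(2))
  show "set_integrable lebesgue K f" by (rule cell_integrable[OF assms(1-3)])
  show "negligible (frontier K)" by (rule negligible_convex_frontier[OF assms(2)])
  show "g x = f x" if "x \<in> K - frontier K" for x
    using that assms(4) closure_subset[of K] by (auto simp: frontier_def)
qed

lemma cell_integral_zero_imp_zero:
  fixes g :: "real^'n \<Rightarrow> real"
  assumes K: "compact K" "convex K" and g: "regular_on (interior K) g" "\<And>x. x \<in> interior K \<Longrightarrow> 0 \<le> g x"
    and zero: "(LINT x:K|lebesgue. g x) = 0" and x: "x \<in> interior K"
  shows "g x = 0"
proof -
  obtain p where p: "continuous_on UNIV p" "\<forall>x\<in>interior K. g x = p x"
    using g unfolding regular_on_def by blast
  \<comment> \<open>Nothing is known about \<open>g\<close> on the boundary of the cell, where it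
    could be negative; it is replaced by zero there.\<close>
  let ?f = "\<lambda>x. if x \<in> interior K then g x else 0"
  have f: "regular_on (interior K) ?f" by (rule regular_onI[OF p(1)]) (use p in auto)
  have "?f x = 0"
  proof (rule set_integral_zero_imp_zero[OF cell_integrable[OF K f] _ _ open_interior interior_subset _ x])
    show "(LINT x:K|lebesgue. ?f x) = 0" using cell_integral_cong[OF K g(1), of ?f] zero by simp
    show "continuous_on (interior K) ?f"
      using continuous_on_subset[OF p(1)] p(2) by (subst continuous_on_cong[OF refl, of _ _ p]) auto
  qed (use g in auto)
  then show ?thesis using x by simp
qed

text \<open>Integration over a facet does not refer to an adjacent cell, so any simplex with this
  facet may serve as witness.\<close>

definition is_facet :: "(real^'n) set \<Rightarrow> bool" where
  "is_facet F \<longleftrightarrow> (\<exists>C a b l. full_simplex C a b \<and> l \<in> C \<and> F = convex hull (C - {l}))"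

lemma slab_integral_spike:
  assumes F: "is_facet F" and p: "continuous_on UNIV p" "\<And>x. x \<in> rel_interior F \<Longrightarrow> g x = p x"
  shows "set_integrable lebesgue (slab F) (\<lambda>x. g (closest_point (affine hull F) x))"
    "facet_integral F g = (LINT x:slab F|lborel. p (closest_point (affine hull F) x))"
    "facet_integral F g = facet_integral F p"
proof -
  obtain C a b l where s: "full_simplex C a b" and l: "l \<in> C" and Feq: "F = convex hull (C - {l})"
    using F unfolding is_facet_def by blast
  interpret full_simplex C a b by (rule s)
  let ?cp = "closest_point (affine hull F)"
  have cp: "?cp x = proj l x" for x unfolding Feq by (rule closest_point_fac[OF l])
  have "continuous_on UNIV (\<lambda>x. p (?cp x))"
    unfolding cp using continuous_proj by (intro continuous_on_compose2[OF p(1)]) auto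
  then have c: "continuous_on (slab F) (\<lambda>x. p (?cp x))" by (rule continuous_on_subset) auto
  note i = set_integral_compact[OF compact_slab[OF l, folded Feq] c]
  have eq: "g (?cp x) = p (?cp x)" if "x \<in> slab F - {x \<in> slab F. proj l x \<notin> rel_interior F}" for x
    using that p(2) unfolding cp by auto
  note sp = set_integral_spike[OF i(2) slab_null[OF l, folded Feq] eq]
  show "set_integrable lebesgue (slab F) (\<lambda>x. g (?cp x))" using sp(1) by simp
  show "facet_integral F g = facet_integral F p" using sp(2) unfolding facet_integral_def by simp
  then show "facet_integral F g = (LINT x:slab F|lborel. p (?cp x))"
    using i(3) unfolding facet_integral_def by simp
qed

lemma facet_integrable:
  fixes g :: "real^'n \<Rightarrow> real"
  assumes "is_facet F" "regular_on (rel_interior F) g"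
  shows "set_integrable lebesgue (slab F) (\<lambda>x. g (closest_point (affine hull F) x))"
  using assms slab_integral_spike(1)[of F _ g] unfolding regular_on_def by blast

lemma facet_integral_cong:
  fixes f g :: "real^'n \<Rightarrow> real"
  assumes "is_facet F" "regular_on (rel_interior F) f" "\<And>x. x \<in> rel_interior F \<Longrightarrow> g x = f x"
  shows "facet_integral F g = facet_integral F f"
proof -
  obtain p where p: "continuous_on UNIV p" "\<forall>x\<in>rel_interior F. f x = p x"
    using assms unfolding regular_on_def by blast
  show ?thesis
    using slab_integral_spike(3)[OF assms(1) p(1), of f] slab_integral_spike(3)[OF assms(1) p(1), of g] p(2) assms(3)
    by auto
qed

lemma facet_integral_add:
  fixes f g :: "real^'n \<Rightarrow> real"
  assumes "is_facet F" "regular_on (rel_interior F) f" "regular_on (rel_interior F) g"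
  shows "facet_integral F (\<lambda>x. f x + g x) = facet_integral F f + facet_integral F g"
  unfolding facet_integral_def using assms by (intro set_integral_add facet_integrable)

lemma facet_integral_scale: "facet_integral F (\<lambda>x. c * g x) = c * facet_integral F g"
  unfolding facet_integral_def by simp

lemma facet_integral_zero [simp]: "facet_integral F (\<lambda>x. 0) = 0"
  unfolding facet_integral_def set_lebesgue_integral_def by simp

lemma facet_integral_diff:
  fixes f g :: "real^'n \<Rightarrow> real"
  assumes "is_facet F" "regular_on (rel_interior F) f" "regular_on (rel_interior F) g"
  shows "facet_integral F (\<lambda>x. f x - g x) = facet_integral F f - facet_integral F g"
  unfolding facet_integral_def using assms by (intro set_integral_diff facet_integrable)

lemma facet_integral_sum:
  fixes f :: "'i \<Rightarrow> real^'n \<Rightarrow> real"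
  assumes F: "is_facet F" and f: "\<And>i. i \<in> A \<Longrightarrow> regular_on (rel_interior F) (f i)"
  shows "facet_integral F (\<lambda>x. \<Sum>i\<in>A. f i x) = (\<Sum>i\<in>A. facet_integral F (f i))"
  using f
proof (induction A rule: infinite_finite_induct)
  case (insert i A)
  then show ?case
    using facet_integral_add[OF F, of "f i" "\<lambda>x. \<Sum>i\<in>A. f i x"] by (simp add: regular_on_sum)
qed simp_all

lemma facet_integral_nonneg:
  fixes g :: "real^'n \<Rightarrow> real"
  assumes F: "is_facet F" and g: "regular_on (rel_interior F) g" "\<And>x. x \<in> rel_interior F \<Longrightarrow> 0 \<le> g x"
  shows "0 \<le> facet_integral F g"
    and "facet_integral F g = 0 \<Longrightarrow> x \<in> rel_interior F \<Longrightarrow> g x = 0"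
proof -
  obtain p where p: "continuous_on UNIV p" "\<forall>x\<in>rel_interior F. g x = p x"
    using g unfolding regular_on_def by blast
  obtain C a b l where s: "full_simplex C a b" and l: "l \<in> C" and Feq: "F = convex hull (C - {l})"
    using F unfolding is_facet_def by blast
  interpret full_simplex C a b by (rule s)
  let ?cp = "closest_point (affine hull F)"
  \<comment> \<open>Cutting \<open>p\<close> off at zero changes nothing on the open facet and makes
    the integrand nonnegative on the whole prism.\<close>
  let ?q = "\<lambda>x. max 0 (p x)"
  have q: "continuous_on UNIV ?q" using p by (intro continuous_intros)
  have gq: "g x = ?q x" if "x \<in> rel_interior F" for x using that p g by auto
  note sp = slab_integral_spike[OF F q gq]
  have eq: "facet_integral F g = facet_integral F ?q" by (rule sp(3))
  have "0 \<le> facet_integral F ?q"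
    unfolding facet_integral_def set_lebesgue_integral_def by (rule integral_nonneg_AE) auto
  then show "0 \<le> facet_integral F g" using eq by simp
  have cp: "?cp x = proj l x" for x unfolding Feq by (rule closest_point_fac[OF l])
  assume zero: "facet_integral F g = 0" and x: "x \<in> rel_interior F"
  have lx: "lam l x = 0" using x rel_interior_fac[OF l] Feq by auto
  have "?q (?cp x) = 0"
  proof (rule set_integral_zero_imp_zero[where S = "slab F" and U = "interior (slab F)"
        and f = "\<lambda>x. ?q (?cp x)"])
    show "set_integrable lebesgue (slab F) (\<lambda>x. ?q (?cp x))"
      by (rule slab_integral_spike(1)[OF F q]) simp
    show "(LINT x:slab F|lebesgue. ?q (?cp x)) = 0" using zero eq unfolding facet_integral_def by simp
    show "continuous_on (interior (slab F)) (\<lambda>x. ?q (?cp x))"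
      unfolding cp using continuous_proj by (intro continuous_on_compose2[OF q]) auto
    show "x \<in> interior (slab F)" using rel_interior_in_interior_slab[OF l] x Feq by simp
  qed (simp_all add: interior_subset)
  then show "g x = 0" using gq[OF x] proj_fixed[OF lx] unfolding cp by simp
qed

section \<open>The divergence theorem on a simplex\<close>

context full_simplex
begin

text \<open>The vector field \<open>lam m x * \<phi> x\<close> in the direction of the edge from \<open>l\<close> to \<open>m\<close> has flux
  through the facet opposite \<open>l\<close> only: it vanishes on the facet opposite \<open>m\<close> and is tangent to the
  others. The proof compares the integral of its positive part over the simplex with the integral over
  the simplex translated by a small multiple \<open>e\<close> of the edge; the difference lives in a prism of
  thickness proportional to \<open>e\<close> above the facet.\<close>

lemma divergence_theorem_edge:
  assumes l: "l \<in> C" and m: "m \<in> C" and lm: "l \<noteq> m"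
    and der: "\<And>x. (\<phi> has_derivative D x) (at x)" and contD: "continuous_on UNIV (\<lambda>x. D x (m - l))"
  shows "(LINT x:K|lebesgue. \<phi> x + lam m x * D x (m - l)) =
    (nrm l \<bullet> (m - l)) * facet_integral (fac l) (\<lambda>x. lam m x * \<phi> x)"
proof -
  define t where "t = m - l"
  define \<alpha> where "\<alpha> = norm (a l)"
  have \<alpha>: "\<alpha> > 0" using a_nonzero[OF l] by (simp add: \<alpha>_def)
  have at: "a i \<bullet> t = (if i = m then 1 else if i = l then - 1 else 0)" if "i \<in> C" for i
  proof -
    have "a i \<bullet> t = lam i m - lam i l" by (simp add: t_def lam_def inner_diff_right)
    then show ?thesis using lam_vertex[OF that] l m lm by auto
  qed
  have shift: "lam i (x + s *\<^sub>R t) = lam i x + s * (a i \<bullet> t)" for i x s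
    by (simp add: lam_def inner_add_right)
  have shift': "lam i (x - s *\<^sub>R t) = lam i x - s * (a i \<bullet> t)" for i x s
    by (simp add: lam_def inner_diff_right)
  have cont\<phi>: "continuous_on UNIV \<phi>"
    by (intro continuous_at_imp_continuous_on ballI) (use der has_derivative_continuous in blast)
  \<comment> \<open>The positive part continues the field by zero beyond the facet opposite
    \<open>m\<close>, so that this facet never contributes to the comparison.\<close>
  define g where "g = (\<lambda>x. max 0 (lam m x) * \<phi> x)"
  have contg: "continuous_on UNIV g"
    unfolding g_def by (intro continuous_intros cont\<phi>)
  have contg': "continuous_on A (\<lambda>x. g (q x))" if "continuous_on A q" for A and q :: "'b::topological_space \<Rightarrow> real^'n"
    using that by (rule continuous_on_compose2[OF contg]) auto
  \<comment> \<open>Along \<open>t\<close> only \<open>lam l\<close> decreases, so the simplex can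
    only be left through the facet opposite \<open>l\<close>.\<close>
  have forward: "y + s *\<^sub>R t \<in> K" if "y \<in> K" "s \<ge> 0" "lam l (y + s *\<^sub>R t) \<ge> 0" for y s
    unfolding mem_K
  proof
    fix i assume i: "i \<in> C"
    show "0 \<le> lam i (y + s *\<^sub>R t)"
      using that i unfolding mem_K by (cases "i = l") (auto simp: shift at)
  qed
  \<comment> \<open>Against \<open>t\<close> only \<open>lam m\<close> decreases, so a point that
    has left has negative \<open>lam m\<close>, where \<open>g\<close> is zero.\<close>
  have backward: "g (y - s *\<^sub>R t) = 0" if y: "y \<in> K" "s \<ge> 0" and ys: "y - s *\<^sub>R t \<notin> K" for y s
  proof -
    obtain i where i: "i \<in> C" "lam i (y - s *\<^sub>R t) < 0" using ys unfolding mem_K by force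
    have "i = m" using i y unfolding mem_K shift' by (auto simp: at split: if_splits)
    then show ?thesis using i by (simp add: g_def)
  qed
  \<comment> \<open>Height in the prism over the facet, rescaled to run from 0 to 1 as
    \<open>lam l z\<close> falls from \<open>\<alpha> / 2\<close> to
    \<open>- \<alpha> / 2\<close>.\<close>
  define s where "s z = 1/2 - lam l z / \<alpha>" for z
  have key: "(LINT x|lborel. indicator K x * ((g x - g (x - e *\<^sub>R t)) / e))
      = (1/\<alpha>) * (LINT z|lborel. indicator (slab (fac l)) z * g (proj l z - (e * (1 - s z)) *\<^sub>R t))"
    if e: "e > 0" for e
  proof -
    define f where "f = (\<lambda>x. indicator K x * g x)"
    \<comment> \<open>The part of the translate of \<open>f\<close> beyond the facet opposite
      \<open>l\<close>. Elsewhere, by \<open>forward\<close> and \<open>backward\<close>, the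
      translate is that of \<open>g\<close>, cut off to the original simplex.\<close>
    define h where "h x = (if lam l x < 0 then f (x - e *\<^sub>R t) else 0)" for x
    have f_int: "integrable lborel f"
      using borel_integrable_compact[OF compact_K continuous_on_subset[OF contg]] by (simp add: f_def)
    have [measurable]: "f \<in> borel_measurable borel"
      using borel_measurable_integrable[OF f_int] by simp
    have ge_int: "integrable lborel (\<lambda>x. indicator K x * g (x - e *\<^sub>R t))"
    proof -
      have "continuous_on K (\<lambda>x. g (x - e *\<^sub>R t))" by (intro contg' continuous_intros)
      then show ?thesis using borel_integrable_compact[OF compact_K] by fastforce
    qed
    have f_shift: "f (x - e *\<^sub>R t) = indicator K x * g (x - e *\<^sub>R t) + h x" for x
    proof (cases "lam l x < 0")
      case True
      then have "x \<notin> K" using l unfolding mem_K by force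
      then show ?thesis using True by (simp add: h_def)
    next
      case False
      show ?thesis
      proof (cases "x \<in> K")
        case True
        then show ?thesis using False backward[OF True, of e] e by (auto simp: h_def f_def indicator_def)
      next
        case xK: False
        have "x - e *\<^sub>R t \<notin> K"
          using forward[of "x - e *\<^sub>R t" e] e False xK by auto
        then show ?thesis using False xK by (simp add: h_def f_def)
      qed
    qed
    have h_eq: "h = (\<lambda>x. f (x - e *\<^sub>R t) - indicator K x * g (x - e *\<^sub>R t))"
      using f_shift by auto
    have [measurable]: "(\<lambda>x. indicator K x * g (x - e *\<^sub>R t)) \<in> borel_measurable borel"
      using borel_measurable_integrable[OF ge_int] by simp
    have [measurable]: "h \<in> borel_measurable borel"
      unfolding h_eq by measurable
    have translate: "distr lborel borel ((+) (- e *\<^sub>R t)) = lborel" by (rule lborel_distr_plus)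
    have fe_int: "integrable lborel (\<lambda>x. f (x - e *\<^sub>R t))"
    proof -
      have "integrable (distr lborel borel ((+) (- e *\<^sub>R t))) f" using f_int translate by simp
      then show ?thesis by (subst (asm) integrable_distr_eq) auto
    qed
    \<comment> \<open>Translation invariance: what is lost over the simplex is exactly what has
      moved beyond the facet.\<close>
    have "(LINT x|lborel. f x) = (LINT x|distr lborel borel ((+) (- e *\<^sub>R t)). f x)"
      using translate by simp
    also have "\<dots> = (LINT x|lborel. f (x - e *\<^sub>R t))"
      by (subst integral_distr) auto
    also have "\<dots> = (LINT x|lborel. indicator K x * g (x - e *\<^sub>R t)) + (LINT x|lborel. h x)"
      unfolding h_eq using fe_int ge_int by simp
    finally have split: "(LINT x|lborel. h x) = (LINT x|lborel. f x) - (LINT x|lborel. indicator K x * g (x - e *\<^sub>R t))"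
      by simp
    \<comment> \<open>The coefficients of \<open>u\<close> and \<open>c\<close> are read off from
      \<open>proj l z + (e * s z) *\<^sub>R t\<close>, which apart from the summand \<open>z\<close>
      depends on \<open>z\<close> only through \<open>a l \<bullet> z\<close>.\<close>
    define u where "u = (- 1 / \<alpha>\<^sup>2) *\<^sub>R a l + (- (e / \<alpha>)) *\<^sub>R t"
    define c where "c = (- (b l) / \<alpha>\<^sup>2) *\<^sub>R a l + (e * (1/2 - b l / \<alpha>)) *\<^sub>R t"
    have \<Phi>: "c + (z + (a l \<bullet> z) *\<^sub>R u) = proj l z + (e * s z) *\<^sub>R t" for z
    proof -
      have "proj l z + (e * s z) *\<^sub>R t
          = z + (- (a l \<bullet> z) / \<alpha>\<^sup>2 + - b l / \<alpha>\<^sup>2) *\<^sub>R a l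
              + (e * (1/2 - b l / \<alpha>) + (a l \<bullet> z) * - (e / \<alpha>)) *\<^sub>R t"
        by (simp add: proj_def s_def lam_def \<alpha>_def[symmetric] add_divide_distrib diff_divide_distrib
            right_diff_distrib distrib_left mult.commute scaleR_left_diff_distrib scaleR_add_left)
      then show ?thesis
        by (simp add: c_def u_def scaleR_add_left scaleR_add_right algebra_simps)
    qed
    have "a l \<bullet> a l = \<alpha>\<^sup>2" by (simp add: \<alpha>_def power2_norm_eq_inner)
    moreover have "a l \<bullet> u = (- 1 / \<alpha>\<^sup>2) * (a l \<bullet> a l) + (- (e / \<alpha>)) * (a l \<bullet> t)"
      unfolding u_def inner_add_right inner_scaleR_right by (rule refl)
    \<comment> \<open>Projection along the normal contributes -1, cancelling the 1; the shear along
      \<open>t\<close> contributes \<open>e / \<alpha>\<close> because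
      \<open>a l \<bullet> t = - 1\<close>.\<close>
    ultimately have det: "1 + a l \<bullet> u = e / \<alpha>"
      using \<alpha> at[OF l] lm by simp
    have "(LINT x|lborel. h x) = (e / \<alpha>) * (LINT z|lborel. h (proj l z + (e * s z) *\<^sub>R t))"
      using lebesgue_integral_rank_one[of "a l" u h c] det \<alpha> e unfolding \<Phi> by simp
    also have "(LINT z|lborel. h (proj l z + (e * s z) *\<^sub>R t))
        = (LINT z|lborel. indicator (slab (fac l)) z * g (proj l z - (e * (1 - s z)) *\<^sub>R t))"
    proof (rule integral_cong_AE)
      have cs: "continuous_on UNIV s" unfolding s_def divide_inverse by (intro continuous_intros)
      have "(\<lambda>z. proj l z + (e * s z) *\<^sub>R t) \<in> borel_measurable borel"
        by (intro borel_measurable_continuous_onI continuous_intros cs)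
      then show "(\<lambda>z. h (proj l z + (e * s z) *\<^sub>R t)) \<in> borel_measurable lborel" by measurable
      have "(\<lambda>z. g (proj l z - (e * (1 - s z)) *\<^sub>R t)) \<in> borel_measurable borel"
        by (intro borel_measurable_continuous_onI contg' continuous_intros cs)
      moreover have "slab (fac l) \<in> sets borel" using compact_slab[OF l] by (simp add: borel_compact)
      ultimately show "(\<lambda>z. indicator (slab (fac l)) z * g (proj l z - (e * (1 - s z)) *\<^sub>R t)) \<in> borel_measurable lborel"
        by simp
      \<comment> \<open>At height 0 the strict inequality in \<open>h\<close> fails although the
        closed prism contains the point; the hyperplane where this happens is null.\<close>
      have "negligible {z. a l \<bullet> z = \<alpha> / 2 - b l}" using a_nonzero[OF l] by (intro negligible_hyperplane) simp
      moreover have "{z. s z = 0} = {z. a l \<bullet> z = \<alpha> / 2 - b l}"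
        using \<alpha> by (auto simp: s_def lam_def field_simps)
      ultimately have "{z. s z = 0} \<in> null_sets lborel"
        using continuous_closed_vimage[of "{0}" s] cs
        by (simp add: negligible_iff_null_sets null_sets_completion_iff closed_hyperplane)
      then have "AE z in lborel. z \<notin> {z. s z = 0}" by (rule AE_not_in)
      then show "AE z in lborel. h (proj l z + (e * s z) *\<^sub>R t) = indicator (slab (fac l)) z * g (proj l z - (e * (1 - s z)) *\<^sub>R t)"
      proof eventually_elim
        case (elim z)
        then have s0: "s z \<noteq> 0" by simp
        let ?w = "proj l z - (e * (1 - s z)) *\<^sub>R t"
        have w: "proj l z + (e * s z) *\<^sub>R t - e *\<^sub>R t = ?w" by (simp add: algebra_simps)
        have laml: "lam l (proj l z + (e * s z) *\<^sub>R t) = - (e * s z)"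
          using at[OF l] lm by (simp add: shift lam_proj[OF l])
        have lamw: "lam l ?w = e * (1 - s z)"
          using at[OF l] lm by (simp add: shift' lam_proj[OF l])
        have s_abs: "\<bar>lam l z\<bar> \<le> norm (a l) / 2 \<longleftrightarrow> 0 \<le> s z \<and> s z \<le> 1"
          using \<alpha> unfolding s_def \<alpha>_def[symmetric] by (auto simp: field_simps abs_if)
        have hw: "h (proj l z + (e * s z) *\<^sub>R t) = (if 0 < s z then indicator K ?w * g ?w else 0)"
          using e unfolding h_def laml w f_def by (auto simp: zero_less_mult_iff)
        show ?case
        proof (cases "0 < s z")
          case False
          then have "z \<notin> slab (fac l)" using s0 unfolding mem_slab[OF l] s_abs by auto
          then show ?thesis using False hw by simp
        next
          case True
          show ?thesis
          proof (cases "z \<in> slab (fac l)")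
            case zs: True
            then have "proj l z \<in> K" "s z \<le> 1" unfolding mem_slab[OF l] s_abs mem_fac[OF l] by auto
            then have "g ?w = 0" if "?w \<notin> K" using backward[of "proj l z" "e * (1 - s z)"] e that by simp
            then show ?thesis using True zs hw by (cases "?w \<in> K") auto
          next
            case zs: False
            have "?w \<notin> K"
            proof
              assume wK: "?w \<in> K"
              then have "0 \<le> e * (1 - s z)" using l lamw unfolding mem_K by force
              then have s1: "s z \<le> 1" using e by (simp add: zero_le_mult_iff)
              have "?w + (e * (1 - s z)) *\<^sub>R t \<in> K"
                by (rule forward[OF wK]) (use e s1 in \<open>simp_all add: lam_proj[OF l]\<close>)
              then have "proj l z \<in> K" by simp
              then show False using zs True s1 unfolding mem_slab[OF l] s_abs mem_fac[OF l] by (simp add: lam_proj[OF l])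
            qed
            then show ?thesis using zs hw by simp
          qed
        qed
      qed
    qed
    finally have "(LINT x|lborel. f x) - (LINT x|lborel. indicator K x * g (x - e *\<^sub>R t))
       = (e / \<alpha>) * (LINT z|lborel. indicator (slab (fac l)) z * g (proj l z - (e * (1 - s z)) *\<^sub>R t))"
      using split by simp
    moreover have "(LINT x|lborel. indicator K x * ((g x - g (x - e *\<^sub>R t)) / e))
       = ((LINT x|lborel. f x) - (LINT x|lborel. indicator K x * g (x - e *\<^sub>R t))) / e"
      using f_int ge_int unfolding f_def
      by (simp add: right_diff_distrib diff_divide_distrib)
    ultimately show ?thesis using e by simp
  qed
  define e :: "nat \<Rightarrow> real" where "e n = inverse (real (Suc n))" for n
  have e: "0 < e n" "e n \<le> 1" for n by (simp_all add: e_def inverse_le_1_iff)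
  have e0: "e \<longlonglongrightarrow> 0" unfolding e_def by (rule LIMSEQ_inverse_real_of_nat)
  have cs: "continuous_on A (\<lambda>x. s (q x))" if "continuous_on A q" for A and q :: "'b::topological_space \<Rightarrow> real^'n"
    unfolding s_def lam_def divide_inverse by (intro continuous_intros that)
  have cp: "continuous_on A (\<lambda>x. proj l (q x))" if "continuous_on A q" for A and q :: "'b::topological_space \<Rightarrow> real^'n"
    using that by (rule continuous_on_compose2[OF continuous_proj[of UNIV]]) auto
  have slab_borel: "slab (fac l) \<in> sets borel" "K \<in> sets borel"
    using compact_slab[OF l] compact_K by (simp_all add: borel_compact)
  \<comment> \<open>The displacement along \<open>t\<close> shrinks to zero, and only the projection
    onto the facet remains.\<close>
  have lim_slab: "(\<lambda>n. LINT z|lborel. indicator (slab (fac l)) z * g (proj l z - (e n * (1 - s z)) *\<^sub>R t))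
      \<longlonglongrightarrow> (LINT z|lborel. indicator (slab (fac l)) z * g (proj l z))"
  proof -
    have "bounded ((\<lambda>(r, z). g (proj l z - (r * (1 - s z)) *\<^sub>R t)) ` ({0..1} \<times> slab (fac l)))"
      unfolding case_prod_beta
      by (intro compact_imp_bounded compact_continuous_image compact_Times compact_slab[OF l] contg' continuous_intros cs cp) auto
    then obtain B where "\<forall>y\<in>(\<lambda>(r, z). g (proj l z - (r * (1 - s z)) *\<^sub>R t)) ` ({0..1} \<times> slab (fac l)). norm y \<le> B"
      unfolding bounded_iff by blast
    then have B: "\<And>r z. r \<in> {0..1} \<Longrightarrow> z \<in> slab (fac l) \<Longrightarrow> \<bar>g (proj l z - (r * (1 - s z)) *\<^sub>R t)\<bar> \<le> B"
      by force
    show ?thesis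
    proof (rule integral_dominated_convergence)
      have "(\<lambda>z. g (proj l z - (r * (1 - s z)) *\<^sub>R t)) \<in> borel_measurable borel" for r
        by (intro borel_measurable_continuous_onI contg' continuous_intros cs)
      then show "(\<lambda>z. indicator (slab (fac l)) z * g (proj l z - (e n * (1 - s z)) *\<^sub>R t)) \<in> borel_measurable lborel" for n
        using slab_borel by simp
      have "(\<lambda>z. g (proj l z)) \<in> borel_measurable borel"
        by (intro borel_measurable_continuous_onI contg' continuous_intros)
      then show "(\<lambda>z. indicator (slab (fac l)) z * g (proj l z)) \<in> borel_measurable lborel"
        using slab_borel by simp
      show "integrable lborel (\<lambda>z. indicator (slab (fac l)) z *\<^sub>R B)"
        by (rule borel_integrable_compact[OF compact_slab[OF l]]) auto
      show "AE z in lborel. norm (indicator (slab (fac l)) z * g (proj l z - (e n * (1 - s z)) *\<^sub>R t)) \<le> indicator (slab (fac l)) z *\<^sub>R B" for n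
        using B[of "e n"] e[of n] by (auto simp: indicator_def less_imp_le)
      have "(\<lambda>n. g (proj l z - (e n * (1 - s z)) *\<^sub>R t)) \<longlonglongrightarrow> g (proj l z)" for z
      proof -
        have "(\<lambda>n. proj l z - (e n * (1 - s z)) *\<^sub>R t) \<longlonglongrightarrow> proj l z - (0 * (1 - s z)) *\<^sub>R t"
          by (intro tendsto_intros e0)
        then show ?thesis
          using continuous_on_tendsto_compose[OF contg] by fastforce
      qed
      then show "AE z in lborel. (\<lambda>n. indicator (slab (fac l)) z * g (proj l z - (e n * (1 - s z)) *\<^sub>R t)) \<longlonglongrightarrow> indicator (slab (fac l)) z * g (proj l z)"
        by (intro AE_I2 tendsto_intros)
    qed
  qed
  have line: "((\<lambda>r. \<phi> (x - r *\<^sub>R t)) has_real_derivative - D (x - r *\<^sub>R t) t) (at r)" for x r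
  proof -
    have "((\<lambda>r. x - r *\<^sub>R t) has_derivative (\<lambda>r. - r *\<^sub>R t)) (at r)"
      by (auto intro!: derivative_eq_intros)
    from has_derivative_compose[OF this der]
    have "((\<lambda>r. \<phi> (x - r *\<^sub>R t)) has_derivative (\<lambda>r'. D (x - r *\<^sub>R t) (- r' *\<^sub>R t))) (at r)" .
    moreover have "D (x - r *\<^sub>R t) (- r' *\<^sub>R t) = - D (x - r *\<^sub>R t) t * r'" for r'
      using linear_scale[OF has_derivative_linear[OF der], of _ "- r'" t] by simp
    moreover have "(*) (- D (x - r *\<^sub>R t) t) = (\<lambda>r'. - D (x - r *\<^sub>R t) t * r')" by (rule refl)
    ultimately show ?thesis unfolding has_field_derivative_def by simp
  qed
  have lim_K: "(\<lambda>n. LINT x|lborel. indicator K x * ((g x - g (x - e n *\<^sub>R t)) / e n))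
      \<longlonglongrightarrow> (LINT x|lborel. indicator K x * (\<phi> x + lam m x * D x t))"
  proof -
    define KK where "KK = (\<lambda>(r, x). x - r *\<^sub>R t) ` ({0..1} \<times> K)"
    have "compact KK"
      unfolding KK_def case_prod_beta
      by (intro compact_continuous_image compact_Times compact_K continuous_intros) auto
    have "bounded (\<phi> ` KK)" "bounded ((\<lambda>x. D x t) ` KK)"
      using contD unfolding t_def[symmetric]
      by (intro compact_imp_bounded compact_continuous_image \<open>compact KK\<close> continuous_on_subset[OF cont\<phi>];
          auto intro: continuous_on_subset)+
    then obtain B1 B2 where B1: "\<And>x. x \<in> KK \<Longrightarrow> \<bar>\<phi> x\<bar> \<le> B1" and B2: "\<And>x. x \<in> KK \<Longrightarrow> \<bar>D x t\<bar> \<le> B2"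
      unfolding bounded_iff by fastforce
    have KK: "x - r *\<^sub>R t \<in> KK" if "x \<in> K" "0 \<le> r" "r \<le> 1" for x r
      using that unfolding KK_def by force
    have bound: "\<bar>(g x - g (x - r *\<^sub>R t)) / r\<bar> \<le> B1 + B2" if x: "x \<in> K" and r: "0 < r" "r \<le> 1" for x r
    proof -
      \<comment> \<open>The mean value theorem bounds the difference quotient independently of the
        step, which yields the dominating constant.\<close>
      obtain z where z: "0 < z" "z < r" "\<phi> (x - r *\<^sub>R t) - \<phi> (x - 0 *\<^sub>R t) = (r - 0) * - D (x - z *\<^sub>R t) t"
        using MVT2[OF r(1), of "\<lambda>r. \<phi> (x - r *\<^sub>R t)" "\<lambda>r. - D (x - r *\<^sub>R t) t"] line by blast
      have zK: "x - z *\<^sub>R t \<in> KK" using z r x by (intro KK) auto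
      let ?M = "\<lambda>x. max 0 (lam m x)"
      have M1: "0 \<le> ?M x" "?M x \<le> 1"
      proof -
        have "lam m x \<le> (\<Sum>i\<in>C. lam i x)"
          using x m finite_C unfolding mem_K by (intro member_le_sum) auto
        then show "0 \<le> ?M x" "?M x \<le> 1" using sum_lam[of x] by auto
      qed
      \<comment> \<open>\<open>lam m\<close> has slope 1 along \<open>t\<close>, and taking the
        positive part does not increase differences.\<close>
      have M2: "\<bar>?M x - ?M (x - r *\<^sub>R t)\<bar> \<le> r"
        using r at[OF m] by (simp add: shift' abs_if max_def)
      have "g x - g (x - r *\<^sub>R t) = ?M x * (r * D (x - z *\<^sub>R t) t) + (?M x - ?M (x - r *\<^sub>R t)) * \<phi> (x - r *\<^sub>R t)"
      proof -
        have "\<phi> x = \<phi> (x - r *\<^sub>R t) + r * D (x - z *\<^sub>R t) t" using z(3) by simp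
        then show ?thesis unfolding g_def by (simp add: algebra_simps)
      qed
      also have "\<bar>\<dots>\<bar> \<le> \<bar>?M x * (r * D (x - z *\<^sub>R t) t)\<bar> + \<bar>(?M x - ?M (x - r *\<^sub>R t)) * \<phi> (x - r *\<^sub>R t)\<bar>"
        by (rule abs_triangle_ineq)
      also have "\<dots> \<le> 1 * (r * B2) + r * B1"
        unfolding abs_mult
      proof (intro add_mono mult_mono)
        show "\<bar>\<phi> (x - r *\<^sub>R t)\<bar> \<le> B1" using r x by (intro B1 KK) auto
        show "\<bar>D (x - z *\<^sub>R t) t\<bar> \<le> B2" by (rule B2[OF zK])
      qed (use M1 M2 r in auto)
      finally have "\<bar>g x - g (x - r *\<^sub>R t)\<bar> \<le> r * (B1 + B2)" by (simp add: algebra_simps)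
      then show ?thesis using r by (simp add: abs_divide pos_divide_le_eq mult.commute)
    qed
    \<comment> \<open>In the interior \<open>lam m\<close> is positive and stays so for small steps.
      The positive part is then invisible, and the limit is given by the product rule.\<close>
    have limit: "(\<lambda>n. (g x - g (x - e n *\<^sub>R t)) / e n) \<longlonglongrightarrow> \<phi> x + lam m x * D x t" if x: "x \<in> interior K" for x
    proof -
      have pos: "0 < lam m x" using x m unfolding interior_K by auto
      have "((\<lambda>h. (\<phi> (x - (0 + h) *\<^sub>R t) - \<phi> (x - 0 *\<^sub>R t)) / h) \<longlongrightarrow> - D (x - 0 *\<^sub>R t) t) (at 0)"
        using line[of x 0] unfolding DERIV_def by simp
      then have "((\<lambda>h. (\<phi> (x - h *\<^sub>R t) - \<phi> x) / h) \<longlongrightarrow> - D x t) (at 0)" by simp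
      moreover have "filterlim e (at 0) sequentially"
        using e0 e(1) by (auto simp: filterlim_at intro!: always_eventually) (metis less_irrefl)
      ultimately have d: "(\<lambda>n. (\<phi> (x - e n *\<^sub>R t) - \<phi> x) / e n) \<longlonglongrightarrow> - D x t"
        by (rule filterlim_compose)
      have "(\<lambda>n. x - e n *\<^sub>R t) \<longlonglongrightarrow> x - 0 *\<^sub>R t" by (intro tendsto_intros e0)
      then have c: "(\<lambda>n. \<phi> (x - e n *\<^sub>R t)) \<longlonglongrightarrow> \<phi> x"
        using continuous_on_tendsto_compose[OF cont\<phi>] by fastforce
      have "(\<lambda>n. \<phi> (x - e n *\<^sub>R t) - lam m x * ((\<phi> (x - e n *\<^sub>R t) - \<phi> x) / e n)) \<longlonglongrightarrow> \<phi> x - lam m x * - D x t"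
        by (intro tendsto_intros c d)
      moreover have "\<forall>\<^sub>F n in sequentially. \<phi> (x - e n *\<^sub>R t) - lam m x * ((\<phi> (x - e n *\<^sub>R t) - \<phi> x) / e n)
          = (g x - g (x - e n *\<^sub>R t)) / e n"
      proof -
        have "\<forall>\<^sub>F n in sequentially. e n < lam m x" using order_tendstoD(2)[OF e0 pos] .
        then show ?thesis
        proof eventually_elim
          case (elim n)
          have "g x = lam m x * \<phi> x" "g (x - e n *\<^sub>R t) = (lam m x - e n) * \<phi> (x - e n *\<^sub>R t)"
            using pos elim at[OF m] by (simp_all add: g_def shift')
          then show ?case using e(1)[of n] by (simp add: field_simps)
        qed
      qed
      ultimately show ?thesis by (simp add: filterlim_cong[OF refl refl])
    qed
    show ?thesis
    proof (rule integral_dominated_convergence)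
      have "(\<lambda>x. (g x - g (x - r *\<^sub>R t)) / r) \<in> borel_measurable borel" for r
        unfolding divide_inverse
        by (intro borel_measurable_continuous_onI contg' continuous_intros)
      then show "(\<lambda>x. indicator K x * ((g x - g (x - e n *\<^sub>R t)) / e n)) \<in> borel_measurable lborel" for n
        using slab_borel by (simp del: times_divide_eq_right)
      have "(\<lambda>x. \<phi> x + lam m x * D x t) \<in> borel_measurable borel"
        using contD unfolding t_def by (intro borel_measurable_continuous_onI continuous_intros cont\<phi>)
      then show "(\<lambda>x. indicator K x * (\<phi> x + lam m x * D x t)) \<in> borel_measurable lborel"
        using slab_borel by simp
      show "integrable lborel (\<lambda>x. indicator K x *\<^sub>R (B1 + B2))"
        by (rule borel_integrable_compact[OF compact_K]) auto
      show "AE x in lborel. norm (indicator K x * ((g x - g (x - e n *\<^sub>R t)) / e n)) \<le> indicator K x *\<^sub>R (B1 + B2)" for n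
        using bound[OF _ e(1)[of n] e(2)[of n]] by (intro AE_I2) (auto simp: indicator_def)
      have "frontier K \<in> null_sets lborel"
        using negligible_convex_frontier[OF convex_convex_hull, of C]
        by (simp add: negligible_iff_null_sets null_sets_completion_iff)
      then have "AE x in lborel. x \<notin> frontier K" by (rule AE_not_in)
      then show "AE x in lborel. (\<lambda>n. indicator K x * ((g x - g (x - e n *\<^sub>R t)) / e n)) \<longlonglongrightarrow> indicator K x * (\<phi> x + lam m x * D x t)"
      proof eventually_elim
        case (elim x)
        show ?case
        proof (cases "x \<in> K")
          case True
          then have "x \<in> interior K" using elim closure_subset[of K] by (auto simp: frontier_def)
          then show ?thesis using limit True by simp
        qed simp
      qed
    qed
  qed
  have "(\<lambda>n. (1/\<alpha>) * (LINT z|lborel. indicator (slab (fac l)) z * g (proj l z - (e n * (1 - s z)) *\<^sub>R t)))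
      \<longlonglongrightarrow> (1/\<alpha>) * (LINT z|lborel. indicator (slab (fac l)) z * g (proj l z))"
    by (intro tendsto_intros lim_slab)
  then have eq: "(LINT x|lborel. indicator K x * (\<phi> x + lam m x * D x t))
      = (1/\<alpha>) * (LINT z|lborel. indicator (slab (fac l)) z * g (proj l z))"
    using lim_K key[OF e(1)] LIMSEQ_unique by simp
  have "facet_integral (fac l) (\<lambda>x. lam m x * \<phi> x)
      = (LINT z:slab (fac l)|lborel. g (closest_point (affine hull fac l) z))"
  proof (rule slab_integral_spike(2)[OF _ contg])
    show "is_facet (fac l)" unfolding is_facet_def using l full_simplex_axioms by blast
    show "lam m x * \<phi> x = g x" if "x \<in> rel_interior (fac l)" for x
      using that m lm unfolding rel_interior_fac[OF l] g_def by auto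
  qed
  then have F: "facet_integral (fac l) (\<lambda>x. lam m x * \<phi> x)
      = (LINT z|lborel. indicator (slab (fac l)) z * g (proj l z))"
    unfolding closest_point_fac[OF l] set_lebesgue_integral_def by simp
  have "continuous_on K (\<lambda>x. \<phi> x + lam m x * D x t)"
    using contD unfolding t_def by (intro continuous_intros) (auto intro: continuous_on_subset[OF cont\<phi>] continuous_on_subset)
  then have "(LINT x:K|lebesgue. \<phi> x + lam m x * D x t) = (LINT x|lborel. indicator K x * (\<phi> x + lam m x * D x t))"
    using set_integral_compact(3)[OF compact_K] unfolding set_lebesgue_integral_def by simp
  moreover have "nrm l \<bullet> (m - l) = 1 / \<alpha>"
    using nrm_inner_edge[OF l m l] lam_vertex l m lm by (simp add: \<alpha>_def)
  ultimately show ?thesis using eq F unfolding t_def by simp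
qed

end

section \<open>Cells and facets of a mesh\<close>

lemma cell_data:
  fixes K :: "(real^'n) set"
  assumes "int CARD('n) simplex K" "2 \<le> CARD('n)"
  shows "compact K" "convex K" "interior K \<noteq> {}" "closure (interior K) = K"
    "K - interior K \<subseteq> \<Union>(cell_facets K)" "finite (cell_facets K)" "aff_dim K = int CARD('n)"
proof -
  obtain C a b where s: "full_simplex C a b" and K: "K = convex hull C"
    using full_simplex_exists[OF assms] .
  interpret full_simplex C a b by (rule s)
  show "compact K" "convex K" unfolding K using compact_K by auto
  show cl: "closure (interior K) = K" unfolding K by (rule closure_interior_K)
  have "C \<noteq> {}" using C_other by blast
  then have "K \<noteq> {}" using K by simp
  then show "interior K \<noteq> {}" using cl by auto
  show "K - interior K \<subseteq> \<Union>(cell_facets K)" "finite (cell_facets K)"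
    using frontier_K_subset finite_C unfolding K cell_facets_K by auto
  show "aff_dim K = int CARD('n)"
    unfolding K aff_dim_convex_hull using indep card_C affine_independent_iff_card[of C] by simp
qed

lemma cell_facet_data:
  fixes K :: "(real^'n) set"
  assumes "int CARD('n) simplex K" "2 \<le> CARD('n)" "F \<in> cell_facets K"
  obtains C a b l where "full_simplex C a b" "K = convex hull C" "l \<in> C" "F = convex hull (C - {l})"
proof -
  obtain C a b where s: "full_simplex C a b" and K: "K = convex hull C"
    using full_simplex_exists[OF assms(1,2)] .
  interpret full_simplex C a b by (rule s)
  show ?thesis using assms(3) that[OF s K] unfolding K cell_facets_K by blast
qed

lemma cell_facet_basic:
  fixes K :: "(real^'n) set"
  assumes K: "int CARD('n) simplex K" "2 \<le> CARD('n)" and F: "F \<in> cell_facets K"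
  shows "is_facet F" "F \<subseteq> K" "compact F" "convex F" "rel_interior F \<noteq> {}"
    "norm (out_normal K F) = 1" "\<And>x y. x \<in> F \<Longrightarrow> y \<in> F \<Longrightarrow> out_normal K F \<bullet> x = out_normal K F \<bullet> y"
    "F \<inter> interior K = {}"
proof -
  obtain C a b l where s: "full_simplex C a b" and Keq: "K = convex hull C" and l: "l \<in> C"
    and Feq: "F = convex hull (C - {l})"
    using cell_facet_data[OF assms] .
  interpret full_simplex C a b by (rule s)
  show "is_facet F" using s l Feq unfolding is_facet_def by blast
  show "F \<subseteq> K" unfolding Keq Feq by (intro hull_mono) auto
  show "compact F" "convex F" unfolding Feq using compact_fac by auto
  have "F \<noteq> {}" using F by (auto simp: cell_facets_def facet_of_def)
  then show "rel_interior F \<noteq> {}" using \<open>convex F\<close> rel_interior_eq_empty by blast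
  show "norm (out_normal K F) = 1" unfolding Keq Feq out_normal_fac[OF l] by (rule norm_nrm[OF l])
  show "out_normal K F \<bullet> x = out_normal K F \<bullet> y" if "x \<in> F" "y \<in> F" for x y
    using that unfolding Keq Feq out_normal_fac[OF l] mem_fac[OF l] by (simp add: nrm_def lam_def)
  show "F \<inter> interior K = {}" unfolding Keq Feq interior_K using mem_fac[OF l] l by force
qed

text \<open>\<open>half_ball\<close> in terms of the outward normal, so that two cells sharing a
  facet can be compared although their barycentric coordinates differ.\<close>

lemma facet_below_normal:
  fixes K :: "(real^'n) set"
  assumes K: "int CARD('n) simplex K" "2 \<le> CARD('n)" and F: "F \<in> cell_facets K" and y: "y \<in> rel_interior F"
  shows "\<exists>e>0. \<forall>x. dist y x < e \<longrightarrow> (out_normal K F \<bullet> (x - y) \<le> 0 \<longrightarrow> x \<in> K) \<and>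
    (out_normal K F \<bullet> (x - y) < 0 \<longrightarrow> x \<in> interior K)"
proof -
  obtain C a b l where s: "full_simplex C a b" and Keq: "K = convex hull C" and l: "l \<in> C"
    and Feq: "F = convex hull (C - {l})"
    using cell_facet_data[OF assms(1-3)] .
  interpret full_simplex C a b by (rule s)
  have "lam l y = 0" using y rel_interior_fac[OF l] Feq by auto
  then have aly: "a l \<bullet> y = - b l" by (simp add: lam_def)
  have n: "out_normal K F \<bullet> (x - y) = - lam l x / norm (a l)" for x
    unfolding Keq Feq out_normal_fac[OF l] by (simp add: nrm_def lam_def inner_diff_right aly diff_divide_distrib)
  have "0 < norm (a l)" using a_nonzero[OF l] by simp
  then have n': "out_normal K F \<bullet> (x - y) \<le> 0 \<longleftrightarrow> 0 \<le> lam l x" "out_normal K F \<bullet> (x - y) < 0 \<longleftrightarrow> 0 < lam l x" for x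
    unfolding n by (simp_all add: zero_le_divide_iff zero_less_divide_iff)
  obtain e where "e > 0" "\<And>x. dist y x < e \<Longrightarrow> lam l x \<ge> 0 \<Longrightarrow> x \<in> K"
    "\<And>x. dist y x < e \<Longrightarrow> lam l x > 0 \<Longrightarrow> x \<in> interior K"
    using half_ball[OF l y[unfolded Feq]] unfolding Keq by blast
  then show ?thesis using n' by (intro exI[of _ e]) auto
qed

lemma affine_hull_facet_normal:
  fixes K :: "(real^'n) set"
  assumes K: "int CARD('n) simplex K" "2 \<le> CARD('n)" and F: "F \<in> cell_facets K" and y: "y \<in> F"
  shows "affine hull F = {x. out_normal K F \<bullet> (x - y) = 0}"
proof -
  obtain C a b l where s: "full_simplex C a b" and Keq: "K = convex hull C" and l: "l \<in> C"
    and Feq: "F = convex hull (C - {l})"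
    using cell_facet_data[OF assms(1-3)] .
  interpret full_simplex C a b by (rule s)
  have "lam l y = 0" using y mem_fac[OF l] Feq by auto
  then have aly: "a l \<bullet> y = - b l" by (simp add: lam_def)
  have "out_normal K F \<bullet> (x - y) = - lam l x / norm (a l)" for x
    unfolding Keq Feq out_normal_fac[OF l] by (simp add: nrm_def lam_def inner_diff_right aly diff_divide_distrib)
  then show ?thesis using a_nonzero[OF l] affine_hull_fac[OF l] unfolding Feq by auto
qed

locale mesh =
  fixes T :: "(real^'n) set set"
  assumes dim2: "2 \<le> CARD('n)" and tri: "triangulation T"
    and cells: "\<And>K. K \<in> T \<Longrightarrow> int CARD('n) simplex K"
begin

lemma finite_T: "finite T"
  using tri by (simp add: triangulation_def)

lemmas cell = cell_data[OF cells dim2]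
lemmas cell_facet = cell_facet_basic[OF cells dim2]

lemma closed_Union_cells: "W \<subseteq> T \<Longrightarrow> closed (\<Union>W)"
  using finite_subset[OF _ finite_T] cell(1) compact_imp_closed by (intro closed_Union) auto

lemma Int_face: "K \<in> T \<Longrightarrow> K' \<in> T \<Longrightarrow> K \<inter> K' face_of K"
  using tri by (simp add: triangulation_def)

text \<open>Otherwise one cell would be a proper face of another and have smaller dimension, but all
  cells are full-dimensional.\<close>

lemma Int_proper:
  assumes "K \<in> T" "K' \<in> T" "K \<noteq> K'"
  shows "K \<inter> K' \<noteq> K"
proof
  assume eq: "K \<inter> K' = K"
  then have "K face_of K'" using Int_face[OF assms(2,1)] by (simp add: Int_commute)
  then have "aff_dim K < aff_dim K'" using face_of_aff_dim_lt[OF cell(2)[OF assms(2)]] assms(3) by blast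
  then show False using cell(7) assms by simp
qed

lemma interior_disjoint: "K \<in> T \<Longrightarrow> K' \<in> T \<Longrightarrow> K \<noteq> K' \<Longrightarrow> interior K \<inter> K' = {}"
  using face_of_disjoint_interior[OF Int_face Int_proper, of K K'] interior_subset[of K] by blast

lemma interior_eq: "K \<in> T \<Longrightarrow> K' \<in> T \<Longrightarrow> x \<in> interior K \<Longrightarrow> x \<in> interior K' \<Longrightarrow> K = K'"
  using interior_disjoint[of K K'] interior_subset[of K'] by blast

lemma Int_facet:
  assumes "K \<in> T" "K' \<in> T" "K \<noteq> K'" "aff_dim (K \<inter> K') \<ge> int CARD('n) - 1"
  shows "K \<inter> K' \<in> cell_facets K"
proof -
  have "aff_dim (K \<inter> K') < aff_dim K"
    using face_of_aff_dim_lt[OF cell(2) Int_face Int_proper] assms by blast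
  then have "aff_dim (K \<inter> K') = aff_dim K - 1" using assms cell(7) by simp
  moreover have "K \<inter> K' \<noteq> {}" using assms dim2 by auto
  ultimately show ?thesis using Int_face assms by (simp add: cell_facets_def facet_of_def)
qed

text \<open>Both are unit normals of the hyperplane spanned by the facet. If they were equal, both
  cells would fill the same half ball at a point of the open facet, and their interiors would
  overlap.\<close>

lemma opposite_normals:
  assumes K: "K \<in> T" "K' \<in> T" "K \<noteq> K'" and F: "F \<in> cell_facets K" "F \<in> cell_facets K'"
  shows "out_normal K' F = - out_normal K F"
proof -
  define \<nu> where "\<nu> = out_normal K F"
  define \<nu>' where "\<nu>' = out_normal K' F"
  have norms: "norm \<nu> = 1" "norm \<nu>' = 1"
    using cell_facet(6) K F by (simp_all add: \<nu>_def \<nu>'_def)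
  obtain y where y: "y \<in> rel_interior F" using cell_facet(5)[OF K(1) F(1)] by blast
  then have yF: "y \<in> F" using rel_interior_subset by blast
  have h: "\<nu> \<bullet> (x - y) = 0 \<longleftrightarrow> \<nu>' \<bullet> (x - y) = 0" for x
    using affine_hull_facet_normal[OF cells[OF K(1)] dim2 F(1) yF] affine_hull_facet_normal[OF cells[OF K(2)] dim2 F(2) yF]
    unfolding \<nu>_def[symmetric] \<nu>'_def[symmetric] by blast
  have h': "\<nu> \<bullet> w = 0 \<longleftrightarrow> \<nu>' \<bullet> w = 0" for w using h[of "w + y"] by simp
  have \<nu>\<nu>: "\<nu> \<bullet> \<nu> = 1" using norms by (simp add: norm_eq_1)
  define c where "c = \<nu>' \<bullet> \<nu>"
  have par: "\<nu>' = c *\<^sub>R \<nu>"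
  proof -
    define w where "w = \<nu>' - c *\<^sub>R \<nu>"
    have "\<nu> \<bullet> w = 0" using \<nu>\<nu> by (simp add: w_def c_def inner_diff_right inner_commute)
    then have "\<nu>' \<bullet> w = 0" using h' by blast
    then have "w \<bullet> w = 0" using \<open>\<nu> \<bullet> w = 0\<close> by (simp add: w_def inner_diff_left)
    then show ?thesis by (simp add: w_def)
  qed
  have "\<not> c > 0"
  proof
    assume c: "c > 0"
    obtain e where e: "e > 0" "\<forall>x. dist y x < e \<longrightarrow> (\<nu> \<bullet> (x - y) \<le> 0 \<longrightarrow> x \<in> K) \<and>
        (\<nu> \<bullet> (x - y) < 0 \<longrightarrow> x \<in> interior K)"
      using facet_below_normal[OF cells[OF K(1)] dim2 F(1) y] unfolding \<nu>_def[symmetric] by (elim exE conjE)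
    obtain e' where e': "e' > 0" "\<forall>x. dist y x < e' \<longrightarrow> (\<nu>' \<bullet> (x - y) \<le> 0 \<longrightarrow> x \<in> K') \<and>
        (\<nu>' \<bullet> (x - y) < 0 \<longrightarrow> x \<in> interior K')"
      using facet_below_normal[OF cells[OF K(2)] dim2 F(2) y] unfolding \<nu>'_def[symmetric] by (elim exE conjE)
    define x where "x = y - (min e e' / 2) *\<^sub>R \<nu>"
    have "dist y x = min e e' / 2" using norms e e' by (simp add: x_def dist_norm)
    moreover have "\<nu> \<bullet> (x - y) < 0" using e e' \<nu>\<nu> by (simp add: x_def)
    moreover have "\<nu>' \<bullet> (x - y) < 0" using e e' \<nu>\<nu> c by (simp add: x_def par)
    moreover have "min e e' / 2 < e" "min e e' / 2 < e'" using e(1) e'(1) by auto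
    ultimately have "x \<in> interior K" "x \<in> interior K'" using e(2) e'(2) by simp_all
    then show False using interior_eq K by blast
  qed
  moreover have "\<bar>c\<bar> = 1" using norms par by simp
  ultimately have "c = - 1" by linarith
  then show ?thesis using par by (simp add: \<nu>_def \<nu>'_def)
qed

text \<open>Three cells would give three pairwise opposite unit vectors.\<close>

lemma two_cells_per_facet:
  assumes "K1 \<in> T" "K2 \<in> T" "K3 \<in> T" "F \<in> cell_facets K1" "F \<in> cell_facets K2" "F \<in> cell_facets K3"
    "K1 \<noteq> K2" "K1 \<noteq> K3"
  shows "K2 = K3"
proof (rule ccontr)
  assume "K2 \<noteq> K3"
  then have "out_normal K3 F = - out_normal K2 F" using opposite_normals assms by blast
  moreover have "out_normal K2 F = - out_normal K1 F" "out_normal K3 F = - out_normal K1 F"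
    using opposite_normals[of K1] assms by blast+
  ultimately have "2 *\<^sub>R out_normal K1 F = 0" by (simp add: scaleR_2)
  then have "out_normal K1 F = 0" by simp
  then show False using cell_facet(6)[of K1 F] assms by simp
qed

text \<open>The intersection of the two cells is a face of \<open>K\<close> that meets the relative
  interior of \<open>F\<close>, hence contains \<open>F\<close>. Being a proper face, it has no room
  for a larger dimension.\<close>

lemma rel_interior_facet_cell:
  assumes K: "K \<in> T" "K' \<in> T" "K \<noteq> K'" and F: "F \<in> cell_facets K" and y: "y \<in> rel_interior F" "y \<in> K'"
  shows "F \<in> cell_facets K'"
proof -
  have Fd: "F face_of K" "aff_dim F = int CARD('n) - 1"
    using F cell(7)[OF K(1)] by (auto simp: cell_facets_def facet_of_def)
  have "y \<in> K" using y cell_facet(2)[OF K(1) F] rel_interior_subset by blast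
  then have sub: "F \<subseteq> K \<inter> K'"
    using subset_of_face_of[OF Int_face[OF K(1,2)], of F] cell_facet(2)[OF K(1) F] y by blast
  have K'F: "K' \<inter> K \<in> cell_facets K'"
    using Int_facet[of K' K] K aff_dim_subset[OF sub] Fd(2) by (simp add: Int_commute)
  have KF: "K \<inter> K' \<in> cell_facets K"
    using Int_facet[of K K'] K aff_dim_subset[OF sub] Fd(2) by simp
  have "F face_of (K \<inter> K')" using face_of_subset[OF Fd(1) sub] by simp
  moreover have "convex (K \<inter> K')" using cell(2) K convex_Int by blast
  moreover have "aff_dim (K \<inter> K') = aff_dim F" using KF Fd cell(7)[OF K(1)] by (auto simp: cell_facets_def facet_of_def)
  ultimately have "K \<inter> K' = F" using face_of_aff_dim_lt[of "K \<inter> K'" F] by auto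
  then show "F \<in> cell_facets K'" using K'F by (simp add: Int_commute)
qed

section \<open>Crossing facets\<close>

text \<open>A generic segment inside \<open>S\<close> avoids all intersections of codimension two or more, hence leaves
  \<open>\<Union>W\<close> through the relative interior of facets.\<close>

lemma crossing:
  assumes S: "convex S" "open S" and W: "W \<subseteq> T" "K0 \<in> W" "S \<inter> interior K0 \<noteq> {}" "\<not> S \<subseteq> \<Union>W"
  shows "\<exists>y. y \<in> S \<and> y \<in> \<Union>W \<and> y \<in> closure (- \<Union>W) \<and>
    (\<forall>K\<in>T. \<forall>K'\<in>T. K \<noteq> K' \<longrightarrow> y \<in> K \<longrightarrow> y \<in> K' \<longrightarrow> K \<inter> K' \<in> cell_facets K)"
proof -
  define \<E> where "\<E> = {E \<in> (\<lambda>(K, K'). K \<inter> K') ` (T \<times> T). aff_dim E < int CARD('n) - 1}"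
  have fin: "finite \<E>" using finite_T by (simp add: \<E>_def)
  have neg: "negligible E" if "aff_dim E < int CARD('n)" for E :: "(real^'n) set"
    using that aff_lowdim_subset_hyperplane[of E] negligible_hyperplane negligible_subset by (metis DIM_cart DIM_real mult.right_neutral)
  have "negligible (\<Union>\<E>)"
    using fin neg by (intro negligible_Union) (auto simp: \<E>_def)
  moreover have "\<not> negligible (S \<inter> interior K0)" using S W by (intro open_not_negligible) auto
  ultimately have "\<not> S \<inter> interior K0 \<subseteq> \<Union>\<E>" using negligible_subset by blast
  then obtain a where a: "a \<in> S" "a \<in> interior K0" "a \<notin> \<Union>\<E>" by blast
  \<comment> \<open>The affine span of \<open>a\<close> and such an intersection is at most a
    hyperplane, so almost every \<open>b\<close> avoids all of these spans.\<close>
  have "negligible (\<Union>E\<in>\<E>. affine hull (insert a E))"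
  proof (intro negligible_Union ballI)
    show "finite ((\<lambda>E. affine hull insert a E) ` \<E>)" using fin by simp
    fix X assume "X \<in> (\<lambda>E. affine hull insert a E) ` \<E>"
    then obtain E where "E \<in> \<E>" "X = affine hull (insert a E)" by blast
    then have "aff_dim X < int CARD('n)" unfolding \<E>_def by (auto simp: aff_dim_insert)
    then show "negligible X" by (rule neg)
  qed
  moreover have "\<not> negligible (S - \<Union>W)"
    using S W closed_Union_cells[OF W(1)] by (intro open_not_negligible) auto
  ultimately have "\<not> S - \<Union>W \<subseteq> (\<Union>E\<in>\<E>. affine hull (insert a E))" using negligible_subset by blast
  then obtain b where b: "b \<in> S" "b \<notin> \<Union>W" "\<And>E. E \<in> \<E> \<Longrightarrow> b \<notin> affine hull (insert a E)" by blast
  have avoid: "x \<notin> E" if x: "x \<in> closed_segment a b" and E: "E \<in> \<E>" for x E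
  proof
    assume xE: "x \<in> E"
    obtain r where r: "0 \<le> r" "x = (1 - r) *\<^sub>R a + r *\<^sub>R b" using x by (auto simp: in_segment)
    have "a \<notin> E" using a(3) E by blast
    then have "r \<noteq> 0" using r xE by auto
    \<comment> \<open>If the segment met \<open>E\<close> in \<open>x\<close>, then \<open>b\<close>
      would lie on the line through \<open>a\<close> and \<open>x\<close>, inside the span it was
      chosen to avoid.\<close>
    then have "b = (1 - 1 / r) *\<^sub>R a + (1 / r) *\<^sub>R x"
      unfolding r(2) by (simp add: algebra_simps)
    moreover have "a \<in> affine hull (insert a E)" "x \<in> affine hull (insert a E)"
      using xE by (auto intro: hull_inc)
    ultimately have "b \<in> affine hull (insert a E)"
      using mem_affine[OF affine_affine_hull, of a "insert a E" x "1 - 1/r" "1/r"] by simp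
    then show False using b(3) E by blast
  qed
  have seg: "closed_segment a b \<subseteq> S" using a b S by (simp add: closed_segment_subset)
  have "closed_segment a b \<inter> frontier (\<Union>W) \<noteq> {}"
  proof (rule connected_Int_frontier)
    have "a \<in> \<Union>W" using a W interior_subset by blast
    then show "closed_segment a b \<inter> \<Union>W \<noteq> {}" by auto
    show "closed_segment a b - \<Union>W \<noteq> {}" using b by auto
  qed simp
  then obtain y where y: "y \<in> closed_segment a b" "y \<in> frontier (\<Union>W)" by blast
  show ?thesis
  proof (intro exI[of _ y] conjI ballI impI)
    show "y \<in> S" using y seg by blast
    show "y \<in> \<Union>W" "y \<in> closure (- \<Union>W)"
      using y closed_Union_cells[OF W(1)] by (auto simp: frontier_closures closure_closed)
    fix K K' assume K: "K \<in> T" "K' \<in> T" "K \<noteq> K'" "y \<in> K" "y \<in> K'"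
    then have "K \<inter> K' \<notin> \<E>" using avoid[OF y(1)] by blast
    then have "aff_dim (K \<inter> K') \<ge> int CARD('n) - 1" using K by (force simp: \<E>_def)
    then show "K \<inter> K' \<in> cell_facets K" using Int_facet K by blast
  qed
qed

text \<open>The cells with the value of \<open>f\<close> at \<open>K1\<close> and the remaining ones
  form two closed sets covering the connected \<open>U\<close>, so they meet in \<open>U\<close>.
  They may meet in a low-dimensional face only; a generic crossing in a small ball finds a common
  facet nearby, where \<open>step\<close> gives a contradiction.\<close>

lemma cells_constant:
  assumes U: "open U" "connected U" "U \<subseteq> \<Union>T0" and T0: "T0 \<subseteq> T"
    and step: "\<And>K K'. K \<in> T0 \<Longrightarrow> K' \<in> T0 \<Longrightarrow> K \<noteq> K' \<Longrightarrow> K \<inter> K' \<in> cell_facets K \<Longrightarrow>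
      K \<inter> K' \<in> cell_facets K' \<Longrightarrow> f K = f K'"
    and K: "K1 \<in> T0" "K2 \<in> T0" "interior K1 \<inter> U \<noteq> {}" "interior K2 \<inter> U \<noteq> {}"
  shows "f K1 = f K2"
proof (rule ccontr)
  assume ne: "f K1 \<noteq> f K2"
  define W where "W = {K \<in> T0. f K = f K1}"
  define W' where "W' = T0 - W"
  have WT: "W \<subseteq> T" "W' \<subseteq> T" using T0 by (auto simp: W_def W'_def)
  have cover: "U \<subseteq> \<Union>W \<union> \<Union>W'" using U(3) by (auto simp: W_def W'_def)
  have mem: "K1 \<in> W" "K2 \<in> W'" using K(1,2) ne by (auto simp: W_def W'_def)
  have "U \<inter> \<Union>W \<noteq> {}" using mem(1) K(3) interior_subset[of K1] by blast
  moreover have "U \<inter> \<Union>W' \<noteq> {}" using mem(2) K(4) interior_subset[of K2] by blast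
  ultimately have "\<Union>W \<inter> \<Union>W' \<inter> U \<noteq> {}"
    using connected_closedD[OF U(2) _ cover closed_Union_cells[OF WT(1)] closed_Union_cells[OF WT(2)]]
    by (metis Int_commute)
  then obtain x K K' where x: "x \<in> U" "x \<in> K" "x \<in> K'" "K \<in> W" "K' \<in> W'" by blast
  obtain e where e: "e > 0" "ball x e \<subseteq> U" using U(1) x(1) by (auto simp: open_contains_ball)
  have meet: "ball x e \<inter> interior L \<noteq> {}" if "x \<in> L" "L \<in> T" for L
  proof -
    have "x \<in> closure (interior L)" using cell(4)[OF that(2)] that by simp
    then obtain z where "z \<in> interior L" "dist z x < e" using e unfolding closure_approachable by blast
    then show ?thesis by (auto simp: dist_commute)
  qed
  \<comment> \<open>The ball contains interior points of \<open>K'\<close>, and these belong to no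
    other cell.\<close>
  have leave: "\<not> ball x e \<subseteq> \<Union>W"
  proof
    assume "ball x e \<subseteq> \<Union>W"
    then obtain z L where z: "z \<in> interior K'" "z \<in> L" "L \<in> W"
      using meet[of K'] x WT by blast
    then have "K' = L" using interior_disjoint[of K' L] x WT by blast
    then show False using z x by (auto simp: W'_def)
  qed
  obtain y where y: "y \<in> ball x e" "y \<in> \<Union>W" "y \<in> closure (- \<Union>W)"
      and fct: "\<forall>K\<in>T. \<forall>K'\<in>T. K \<noteq> K' \<longrightarrow> y \<in> K \<longrightarrow> y \<in> K' \<longrightarrow> K \<inter> K' \<in> cell_facets K"
    using crossing[OF convex_ball open_ball WT(1) x(4) meet[OF x(2) subsetD[OF WT(1) x(4)]] leave]
    by (elim exE conjE)
  \<comment> \<open>Points of the ball outside \<open>\<Union>W\<close> lie in cells of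
    \<open>W'\<close>. These are finitely many closed sets, so the limit point \<open>y\<close>
    belongs to one of them too.\<close>
  have "y \<in> closure (ball x e \<inter> - \<Union>W)" using open_Int_closure_subset[of "ball x e"] y by blast
  moreover have "ball x e \<inter> - \<Union>W \<subseteq> \<Union>W'" using e cover by blast
  ultimately have "y \<in> \<Union>W'" using closure_minimal[OF _ closed_Union_cells[OF WT(2)]] by blast
  then obtain L L' where L: "y \<in> L" "L \<in> W" "y \<in> L'" "L' \<in> W'" using y by blast
  then have "L \<noteq> L'" by (auto simp: W'_def)
  then have "L \<inter> L' \<in> cell_facets L" "L \<inter> L' \<in> cell_facets L'"
    using fct[rule_format, of L L'] fct[rule_format, of L' L] L WT by (auto simp: Int_commute)
  then have "f L = f L'" using step[of L L'] L \<open>L \<noteq> L'\<close> by (auto simp: W_def W'_def)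
  then show False using L by (auto simp: W_def W'_def)
qed

end

section \<open>Geometry of the coupled mesh\<close>

locale stokes_darcy =
  fixes \<Omega> \<Omega>s \<Omega>d :: "(real^'n) set" and Ts Td :: "(real^'n) set set"
  assumes dims: "2 \<le> CARD('n)" and domain: "stokes_darcy_domain \<Omega> \<Omega>s \<Omega>d"
    and the_mesh: "stokes_darcy_mesh \<Omega>s \<Omega>d Ts Td"
begin

sublocale mesh "Ts \<union> Td"
  using dims the_mesh by unfold_locales (auto simp: stokes_darcy_mesh_def)

lemma finite_Ts: "finite Ts" and finite_Td: "finite Td"
  using finite_T by auto

lemma regions_open: "open \<Omega>" "open \<Omega>s" "open \<Omega>d"
  using domain unfolding stokes_darcy_domain_def polygonal_def by (metis open_interior)+

lemma Union_Ts: "\<Union>Ts = closure \<Omega>s" and Union_Td: "\<Union>Td = closure \<Omega>d"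
  using the_mesh by (auto simp: stokes_darcy_mesh_def)

lemma closure_\<Omega>: "closure \<Omega> = \<Union>(Ts \<union> Td)"
  using domain Union_Ts Union_Td by (auto simp: stokes_darcy_domain_def)

lemma interior_closure: "interior (closure \<Omega>) = \<Omega>" "interior (closure \<Omega>s) = \<Omega>s" "interior (closure \<Omega>d) = \<Omega>d"
  using domain by (auto simp: stokes_darcy_domain_def polygonal_def)

lemma interior_Ts:
  assumes "K \<in> Ts"
  shows "interior K \<subseteq> \<Omega>s"
proof -
  have "interior K \<subseteq> interior (\<Union>Ts)" using assms by (intro interior_mono) blast
  then show ?thesis unfolding Union_Ts interior_closure .
qed

lemma interior_Td:
  assumes "K \<in> Td"
  shows "interior K \<subseteq> \<Omega>d"
proof -
  have "interior K \<subseteq> interior (\<Union>Td)" using assms by (intro interior_mono) blast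
  then show ?thesis unfolding Union_Td interior_closure .
qed

lemma regions_subset: "\<Omega>s \<subseteq> \<Omega>" "\<Omega>d \<subseteq> \<Omega>"
proof -
  have "closure \<Omega>s \<subseteq> closure \<Omega>" "closure \<Omega>d \<subseteq> closure \<Omega>" using domain by (auto simp: stokes_darcy_domain_def)
  then show "\<Omega>s \<subseteq> \<Omega>" "\<Omega>d \<subseteq> \<Omega>" using interior_mono interior_closure by metis+
qed

lemma regions_disjoint: "\<Omega>s \<inter> \<Omega>d = {}"
  using domain by (simp add: stokes_darcy_domain_def)

lemma meshes_disjoint: "Ts \<inter> Td = {}"
proof (rule ccontr)
  assume "Ts \<inter> Td \<noteq> {}"
  then obtain K where K: "K \<in> Ts" "K \<in> Td" by blast
  then show False using interior_Ts interior_Td regions_disjoint cell(3)[of K] by blast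
qed

lemma no_rigid_patch:
  assumes c: "c \<noteq> 0" and W: "W \<subseteq> Ts" "W \<noteq> {}"
    and stokes: "\<And>K K'. K \<in> W \<Longrightarrow> K' \<in> Ts \<Longrightarrow> K \<noteq> K' \<Longrightarrow> K \<inter> K' \<in> cell_facets K \<Longrightarrow>
      K \<inter> K' \<in> cell_facets K' \<Longrightarrow> K' \<in> W"
    and darcy: "\<And>K K'. K \<in> W \<Longrightarrow> K' \<in> Td \<Longrightarrow> K \<inter> K' \<in> cell_facets K \<Longrightarrow>
      K \<inter> K' \<in> cell_facets K' \<Longrightarrow> \<exists>r. \<forall>x\<in>K \<inter> K'. c \<bullet> x = r"
    and bdry: "\<And>K F. K \<in> W \<Longrightarrow> F \<in> cell_facets K \<Longrightarrow> F \<inter> (frontier \<Omega> \<inter> frontier \<Omega>s) = {}"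
  shows False
proof -
  \<comment> \<open>The facets where the patch \<open>W\<close> can be left lie in finitely many hyperplanes orthogonal to \<open>c\<close>;
     a slab between them meets the bounded patch but is unbounded.\<close>
  obtain \<rho> where \<rho>: "\<And>K K' x. K \<in> W \<Longrightarrow> K' \<in> Td \<Longrightarrow> K \<inter> K' \<in> cell_facets K \<Longrightarrow>
      K \<inter> K' \<in> cell_facets K' \<Longrightarrow> x \<in> K \<inter> K' \<Longrightarrow> c \<bullet> x = \<rho> K K'"
    using darcy by metis
  define R where "R = (\<lambda>(K, K'). \<rho> K K') ` (W \<times> Td)"
  have WT: "W \<subseteq> Ts \<union> Td" using W by blast
  have finW: "finite W" using W finite_Ts finite_subset by blast
  then have finR: "finite R" using finite_Td by (simp add: R_def)
  obtain K0 where K0: "K0 \<in> W" using W by blast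
  have "negligible (\<Union>r\<in>R. {x. c \<bullet> x = r})"
    using finR c by (intro negligible_Union) (auto intro: negligible_hyperplane)
  moreover have "\<not> negligible (interior K0)" using cell(3) K0 WT by (intro open_not_negligible) auto
  ultimately have "\<not> interior K0 \<subseteq> (\<Union>r\<in>R. {x. c \<bullet> x = r})" using negligible_subset by blast
  then obtain a0 where a0: "a0 \<in> interior K0" "c \<bullet> a0 \<notin> R" by blast
  have "open (- R)" using finR by (simp add: finite_imp_closed open_Compl)
  then obtain \<delta> where \<delta>: "\<delta> > 0" "ball (c \<bullet> a0) \<delta> \<subseteq> - R" using a0 by (auto simp: open_contains_ball)
  define S where "S = {x. c \<bullet> x < c \<bullet> a0 + \<delta>} \<inter> {x. c \<bullet> x > c \<bullet> a0 - \<delta>}"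
  have S: "convex S" "open S" unfolding S_def
    by (intro convex_Int convex_halfspace_lt convex_halfspace_gt open_Int open_halfspace_lt open_halfspace_gt)+
  obtain d where d: "d \<noteq> 0" "c \<bullet> d = 0"
  proof -
    \<comment> \<open>In dimension at least 2 a hyperplane contains a nonzero direction, and moving
      along it keeps \<open>c \<bullet> x\<close> fixed.\<close>
    have "dim {x. c \<bullet> x = 0} \<noteq> 0" using dim_hyperplane[OF c] dims by simp
    then have "\<not> {x. c \<bullet> x = 0} \<subseteq> {0}" by (simp add: dim_eq_0)
    then show ?thesis using that by blast
  qed
  have leave: "\<not> S \<subseteq> \<Union>W"
  proof
    assume sub: "S \<subseteq> \<Union>W"
    have "bounded (\<Union>W)" using finW cell(1) WT compact_imp_bounded by (intro bounded_Union) blast+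
    then obtain B where B: "\<And>x. x \<in> \<Union>W \<Longrightarrow> norm x \<le> B" unfolding bounded_iff by blast
    \<comment> \<open>Long enough that the point at distance \<open>s\<close> times the norm of
      \<open>d\<close> from \<open>a0\<close> has norm at least
      \<open>\<bar>B\<bar> + 1\<close>.\<close>
    define s where "s = (\<bar>B\<bar> + norm a0 + 1) / norm d"
    have "a0 + s *\<^sub>R d \<in> S" using d \<delta> by (simp add: S_def inner_add_right)
    then have "norm (a0 + s *\<^sub>R d) \<le> B" using sub B by blast
    moreover have "norm (s *\<^sub>R d) = \<bar>B\<bar> + norm a0 + 1" using d by (simp add: s_def abs_of_nonneg)
    ultimately show False using norm_diff_ineq[of "s *\<^sub>R d" a0] by (simp add: add.commute)
  qed
  have "a0 \<in> S" using \<delta>(1) by (simp add: S_def)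
  then have meet: "S \<inter> interior K0 \<noteq> {}" using a0 by blast
  obtain y where y: "y \<in> S" "y \<in> \<Union>W" "y \<in> closure (- \<Union>W)"
      and fct: "\<forall>K\<in>Ts \<union> Td. \<forall>K'\<in>Ts \<union> Td. K \<noteq> K' \<longrightarrow> y \<in> K \<longrightarrow> y \<in> K' \<longrightarrow> K \<inter> K' \<in> cell_facets K"
    using crossing[OF S WT K0 meet leave] by (elim exE conjE)
  obtain K where K: "y \<in> K" "K \<in> W" using y by blast
  \<comment> \<open>Inside \<open>\<Omega>\<close> the exit point lies on a cell outside the patch,
    and the common facet is either impossible or at a level the slab avoids. Otherwise it lies on
    \<open>\<Gamma>\<^sup>s\<close>, which no facet of the patch meets.\<close>
  show False
  proof (cases "y \<in> \<Omega>")
    case True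
    have "y \<in> closure (\<Omega> \<inter> - \<Union>W)" using open_Int_closure_subset[OF regions_open(1)] True y by blast
    moreover have "\<Omega> \<inter> - \<Union>W \<subseteq> \<Union>(Ts \<union> Td - W)" using closure_\<Omega> closure_subset[of \<Omega>] by blast
    ultimately have "y \<in> \<Union>(Ts \<union> Td - W)"
      using closure_minimal[OF _ closed_Union_cells[of "Ts \<union> Td - W"]] by blast
    then obtain K' where K': "y \<in> K'" "K' \<in> Ts \<union> Td" "K' \<notin> W" by blast
    have ne: "K \<noteq> K'" using K K' by blast
    have f: "K \<inter> K' \<in> cell_facets K" "K \<inter> K' \<in> cell_facets K'"
      using fct[rule_format, of K K'] fct[rule_format, of K' K] K K' ne WT by (auto simp: Int_commute)
    show False
    proof (cases "K' \<in> Ts")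
      case True
      then show False using stokes[OF K(2) True ne f] K' by blast
    next
      case False
      then have Td: "K' \<in> Td" using K' by blast
      then have "c \<bullet> y = \<rho> K K'" using \<rho>[OF K(2) Td f] K K' by blast
      moreover have "\<rho> K K' \<in> R" using K Td by (force simp: R_def)
      moreover have "c \<bullet> y \<in> ball (c \<bullet> a0) \<delta>" using y(1) by (auto simp: S_def dist_real_def)
      ultimately show False using \<delta>(2) by auto
    qed
  next
    case False
    have "y \<in> closure \<Omega>s" using K W Union_Ts by blast
    moreover have "y \<in> closure \<Omega>" using K WT closure_\<Omega> by blast
    ultimately have "y \<in> frontier \<Omega> \<inter> frontier \<Omega>s"
      using False regions_subset regions_open by (auto simp: frontier_def interior_open)
    moreover have "y \<in> K - interior K" using False K interior_Ts regions_subset W by blast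
    moreover have "K \<in> Ts \<union> Td" using K WT by blast
    ultimately show False using cell(5)[of K] bdry[OF K(2)] by blast
  qed
qed

end

section \<open>Linear functionals given by integrals\<close>

lemma linear_on_sum_functionals:
  "(\<And>i. i \<in> A \<Longrightarrow> linear_on V (f i)) \<Longrightarrow> linear_on V (\<lambda>v. \<Sum>i\<in>A. f i v)"
  by (auto simp: linear_on_def sum.distrib sum_distrib_left)

lemma linear_on_plus: "linear_on V f \<Longrightarrow> linear_on V g \<Longrightarrow> linear_on V (\<lambda>v. f v + g v)"
  and linear_on_minus: "linear_on V f \<Longrightarrow> linear_on V g \<Longrightarrow> linear_on V (\<lambda>v. f v - g v)"
  and linear_on_cmult: "linear_on V f \<Longrightarrow> linear_on V (\<lambda>v. c * f v)"
  and linear_on_uminus: "linear_on V f \<Longrightarrow> linear_on V (\<lambda>v. - f v)"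
  by (auto simp: linear_on_def algebra_simps)

lemma linear_on_compose:
  assumes "linear h" "h ` V \<subseteq> W" "linear_on W f"
  shows "linear_on V (\<lambda>v. f (h v))"
  using assms by (auto simp: linear_on_def image_subset_iff linear_add linear_scale)

lemma linear_on_cell:
  fixes G :: "'v::real_vector \<Rightarrow> real^'n \<Rightarrow> real"
  assumes K: "compact K" "convex K" and reg: "\<And>v. v \<in> V \<Longrightarrow> regular_on (interior K) (G v)"
    and lin: "\<And>x. x \<in> interior K \<Longrightarrow> linear_on V (\<lambda>v. G v x)"
  shows "linear_on V (\<lambda>v. LINT x:K|lebesgue. G v x)"
  unfolding linear_on_def
proof (intro conjI ballI allI)
  fix v w assume vw: "v \<in> V" "w \<in> V"
  have "(LINT x:K|lebesgue. G (v + w) x) = (LINT x:K|lebesgue. G v x + G w x)"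
    by (intro cell_integral_cong K regular_on_add reg vw linear_on_add[OF lin])
  also have "\<dots> = (LINT x:K|lebesgue. G v x) + (LINT x:K|lebesgue. G w x)"
    by (intro set_integral_add cell_integrable K reg vw)
  finally show "(LINT x:K|lebesgue. G (v + w) x) = (LINT x:K|lebesgue. G v x) + (LINT x:K|lebesgue. G w x)" .
next
  fix c v assume v: "v \<in> V"
  have "(LINT x:K|lebesgue. G (c *\<^sub>R v) x) = (LINT x:K|lebesgue. c * G v x)"
    by (intro cell_integral_cong K regular_on_mult regular_on_const reg v linear_on_scale[OF lin])
  then show "(LINT x:K|lebesgue. G (c *\<^sub>R v) x) = c * (LINT x:K|lebesgue. G v x)" by simp
qed

lemma linear_on_facet:
  fixes G :: "'v::real_vector \<Rightarrow> real^'n \<Rightarrow> real"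
  assumes F: "is_facet F" and reg: "\<And>v. v \<in> V \<Longrightarrow> regular_on (rel_interior F) (G v)"
    and lin: "\<And>x. x \<in> rel_interior F \<Longrightarrow> linear_on V (\<lambda>v. G v x)"
  shows "linear_on V (\<lambda>v. facet_integral F (G v))"
  unfolding linear_on_def
proof (intro conjI ballI allI)
  fix v w assume vw: "v \<in> V" "w \<in> V"
  have "facet_integral F (G (v + w)) = facet_integral F (\<lambda>x. G v x + G w x)"
    by (intro facet_integral_cong F regular_on_add reg vw linear_on_add[OF lin])
  also have "\<dots> = facet_integral F (G v) + facet_integral F (G w)"
    by (intro facet_integral_add F reg vw)
  finally show "facet_integral F (G (v + w)) = facet_integral F (G v) + facet_integral F (G w)" .
next
  fix c v assume v: "v \<in> V"
  have "facet_integral F (G (c *\<^sub>R v)) = facet_integral F (\<lambda>x. c * G v x)"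
    by (intro facet_integral_cong F regular_on_mult regular_on_const reg v linear_on_scale[OF lin])
  then show "facet_integral F (G (c *\<^sub>R v)) = c * facet_integral F (G v)" by (simp add: facet_integral_scale)
qed

section \<open>Gradients and traces of piecewise polynomials\<close>

lemma grad_eqI: "(v has_derivative (\<lambda>h. A *v h)) (at x) \<Longrightarrow> grad v x = A"
  unfolding grad_def jacobian_def by (metis frechet_derivative_at matrix_of_matrix_vector_mul)

lemma grad_has_derivative: "v differentiable (at x) \<Longrightarrow> (v has_derivative (\<lambda>h. grad v x *v h)) (at x)"
  unfolding grad_def using jacobian_works by blast

lemma grad_add:
  assumes "u differentiable (at x)" "v differentiable (at x)"
  shows "grad (u + v) x = grad u x + grad v x"
proof (rule grad_eqI)
  show "((u + v) has_derivative (\<lambda>h. (grad u x + grad v x) *v h)) (at x)"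
    using has_derivative_add[OF grad_has_derivative[OF assms(1)] grad_has_derivative[OF assms(2)]]
    by (simp add: plus_fun_def matrix_vector_mult_add_rdistrib)
qed

lemma grad_scaleR:
  assumes "v differentiable (at x)"
  shows "grad (c *\<^sub>R v) x = c *\<^sub>R grad v x"
proof (rule grad_eqI)
  show "((c *\<^sub>R v) has_derivative (\<lambda>h. (c *\<^sub>R grad v x) *v h)) (at x)"
    using has_derivative_scaleR_right[OF grad_has_derivative[OF assms], of c]
    by (simp add: scaleR_fun_def scaleR_matrix_vector_assoc)
qed

lemma transpose_linear: "transpose (A + B) = transpose A + transpose B" "transpose (c *\<^sub>R A) = c *\<^sub>R transpose A"
  for A B :: "real^'n^'n"
  by (simp_all add: transpose_def vec_eq_iff)

lemma strain_linear:
  assumes "u differentiable (at x)" "v differentiable (at x)"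
  shows "strain (u + v) x = strain u x + strain v x" "strain (c *\<^sub>R v) x = c *\<^sub>R strain v x"
  using assms by (simp_all add: strain_def grad_add grad_scaleR transpose_linear algebra_simps)

lemma divergence_linear:
  assumes "u differentiable (at x)" "v differentiable (at x)"
  shows "divergence (u + v) x = divergence u x + divergence v x" "divergence (c *\<^sub>R v) x = c * divergence v x"
  using assms by (simp_all add: divergence_def grad_add grad_scaleR trace_def sum.distrib sum_distrib_left)

lemma grad_zero: "grad 0 x = 0"
  by (rule grad_eqI) (simp add: zero_fun_def)

lemma Vh_cell:
  assumes "v \<in> Vh k T" "K \<in> T"
  shows "\<exists>p D. p \<in> Pk_vec k \<and> (\<forall>x. (p has_derivative D x) (at x)) \<and>
    (\<forall>t. continuous_on UNIV (\<lambda>x. D x t)) \<and> (\<forall>x\<in>interior K. v x = p x)"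
proof -
  obtain p where p: "p \<in> Pk_vec k" "\<forall>x\<in>interior K. v x = p x"
    using assms by (auto simp: Vh_def)
  obtain D where "\<forall>x. (p has_derivative D x) (at x)" "\<forall>t. continuous_on UNIV (\<lambda>x. D x t)"
    using Pk_vec_has_derivative[OF p(1)] .
  then show ?thesis using p by blast
qed

lemma Vh_regular: "v \<in> Vh k T \<Longrightarrow> K \<in> T \<Longrightarrow> regular_on (interior K) v"
  unfolding Vh_def regular_on_def using Pk_vec_continuous_on by blast

lemma Vh_differentiable:
  assumes "v \<in> Vh k T" "K \<in> T" "x \<in> interior K"
  shows "v differentiable (at x)"
proof -
  obtain p D where p: "\<forall>x. (p has_derivative D x) (at x)" "\<forall>x\<in>interior K. v x = p x"
    using Vh_cell[OF assms(1,2)] by blast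
  have "(v has_derivative D x) (at x)"
    by (rule has_derivative_transform_within_open[OF p(1)[rule_format] open_interior assms(3)]) (use p in auto)
  then show ?thesis by (auto simp: differentiable_def)
qed

lemma Vh_grad_regular:
  assumes "v \<in> Vh k T" "K \<in> T"
  shows "regular_on (interior K) (grad v)"
proof -
  obtain p D where p: "\<forall>x. (p has_derivative D x) (at x)" "\<forall>x\<in>interior K. v x = p x"
      "\<forall>t. continuous_on UNIV (\<lambda>x. D x t)"
    using Vh_cell[OF assms] by blast
  show ?thesis
  proof (rule regular_onI)
    show "continuous_on UNIV (\<lambda>x. \<chi> i j. D x (axis j 1) $ i)"
      using p(3) by (intro continuous_on_vec_lambda continuous_on_component) auto
    fix x assume x: "x \<in> interior K"
    have d: "(v has_derivative D x) (at x)"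
      by (rule has_derivative_transform_within_open[OF p(1)[rule_format] open_interior x]) (use p in auto)
    then have "D x = frechet_derivative v (at x)" by (rule frechet_derivative_at)
    then show "grad v x = (\<chi> i j. D x (axis j 1) $ i)"
      unfolding grad_def jacobian_def matrix_def by simp
  qed
qed

lemma continuous_transpose: "continuous_on UNIV (transpose :: real^'n^'n \<Rightarrow> _)"
  unfolding transpose_def by (intro continuous_on_vec_lambda continuous_on_component continuous_on_id)

lemma continuous_trace: "continuous_on UNIV (trace :: real^'n^'n \<Rightarrow> real)"
  unfolding trace_def by (intro continuous_on_sum continuous_on_component continuous_on_id)

lemma continuous_matrix_vector: "continuous_on UNIV (\<lambda>A. A *v n)" for n :: "real^'n"
  unfolding matrix_vector_mult_def
  by (intro continuous_on_vec_lambda continuous_on_sum continuous_on_mult continuous_on_component continuous_on_id continuous_on_const)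

lemma Vh_strain_regular: "v \<in> Vh k T \<Longrightarrow> K \<in> T \<Longrightarrow> regular_on (interior K) (strain v)"
  unfolding strain_def
  by (intro regular_on_scaleR regular_on_const regular_on_add regular_on_map[OF continuous_transpose] Vh_grad_regular)

lemma Vh_divergence_regular: "v \<in> Vh k T \<Longrightarrow> K \<in> T \<Longrightarrow> regular_on (interior K) (divergence v)"
  unfolding divergence_def by (intro regular_on_map[OF continuous_trace] Vh_grad_regular)

text \<open>The interior is dense in the simplex, so the limit defining the trace is unique at
  boundary points as well.\<close>

lemma cell_trace_eq:
  fixes K :: "(real^'n) set" and g :: "real^'n \<Rightarrow> 'b::t2_space"
  assumes K: "int CARD('n) simplex K" "2 \<le> CARD('n)" and p: "continuous_on UNIV p"
    and gp: "\<And>x. x \<in> interior K \<Longrightarrow> g x = p x" and x: "x \<in> K"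
  shows "cell_trace K g x = p x"
  unfolding cell_trace_def
proof (rule tendsto_Lim)
  have "x islimpt interior K"
  proof (cases "x \<in> interior K")
    case True
    then show ?thesis using interior_limit_point[of x "interior K"] by simp
  next
    case False
    then show ?thesis using x cell_data(4)[OF K] by (auto simp: closure_def)
  qed
  then show "at x within interior K \<noteq> bot" by (simp add: trivial_limit_within)
  have "(p \<longlongrightarrow> p x) (at x within interior K)"
    using p continuous_on_eq_continuous_at[OF open_UNIV] by (auto simp: isCont_def intro: tendsto_within_subset)
  then show "(g \<longlongrightarrow> p x) (at x within interior K)"
    by (rule Lim_transform_eventually) (use gp in \<open>auto simp: eventually_at_filter\<close>)
qed

lemma cell_trace_regular:
  fixes K :: "(real^'n) set" and g :: "real^'n \<Rightarrow> 'b::t2_space"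
  assumes K: "int CARD('n) simplex K" "2 \<le> CARD('n)" and g: "regular_on (interior K) g"
  shows "regular_on K (cell_trace K g)"
proof -
  obtain p where p: "continuous_on UNIV p" "\<forall>x\<in>interior K. g x = p x" using g by (auto simp: regular_on_def)
  show ?thesis
    by (rule regular_onI[OF p(1)]) (use cell_trace_eq[OF K p(1)] p(2) in auto)
qed

lemma cell_trace_linear:
  fixes K :: "(real^'n) set" and g h :: "real^'n \<Rightarrow> 'b::real_normed_vector"
  assumes K: "int CARD('n) simplex K" "2 \<le> CARD('n)"
    and g: "regular_on (interior K) g" and h: "regular_on (interior K) h" and x: "x \<in> K"
  shows "(\<And>y. y \<in> interior K \<Longrightarrow> f y = g y + h y) \<Longrightarrow> cell_trace K f x = cell_trace K g x + cell_trace K h x"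
    and "(\<And>y. y \<in> interior K \<Longrightarrow> f y = c *\<^sub>R g y) \<Longrightarrow> cell_trace K f x = c *\<^sub>R cell_trace K g x"
proof -
  obtain p where p: "continuous_on UNIV p" "\<forall>x\<in>interior K. g x = p x" using g by (auto simp: regular_on_def)
  obtain q where q: "continuous_on UNIV q" "\<forall>x\<in>interior K. h x = q x" using h by (auto simp: regular_on_def)
  have tr: "cell_trace K g x = p x" "cell_trace K h x = q x"
    using p q by (auto intro!: cell_trace_eq[OF K _ _ x])
  show "cell_trace K f x = cell_trace K g x + cell_trace K h x" if "\<And>y. y \<in> interior K \<Longrightarrow> f y = g y + h y"
    unfolding tr by (rule cell_trace_eq[OF K _ _ x]) (use p q that in \<open>auto intro: continuous_intros\<close>)
  show "cell_trace K f x = c *\<^sub>R cell_trace K g x" if "\<And>y. y \<in> interior K \<Longrightarrow> f y = c *\<^sub>R g y"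
    unfolding tr by (rule cell_trace_eq[OF K _ _ x]) (use p that in \<open>auto intro: continuous_intros\<close>)
qed

lemma Vbarh_regular:
  assumes "v \<in> Vbarh k \<Omega> \<Omega>s Ts" "F \<in> facets Ts"
  shows "regular_on (rel_interior F) v"
proof -
  obtain p where p: "p \<in> Pk_vec k" "\<forall>x\<in>F. v x = p x" using assms by (auto simp: Vbarh_def)
  show ?thesis
    by (rule regular_onI[OF Pk_vec_continuous_on[OF p(1)]]) (use p(2) rel_interior_subset[of F] in auto)
qed

lemma Qh_regular:
  assumes "q \<in> Qh k \<Omega> T" "K \<in> T"
  shows "regular_on (interior K) q"
proof -
  obtain p where p: "p \<in> Pk (k - 1)" "\<forall>x\<in>interior K. q x = p x" using assms by (auto simp: Qh_def)
  show ?thesis by (rule regular_onI[OF Pk_continuous_on[OF p(1)]]) (use p(2) in auto)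
qed

lemma Qbarh_regular:
  assumes "q \<in> Qbarh k T" "F \<in> facets T"
  shows "regular_on (rel_interior F) q"
proof -
  obtain p where p: "p \<in> Pk k" "\<forall>x\<in>rel_interior F. q x = p x" using assms by (auto simp: Qbarh_def)
  show ?thesis by (rule regular_onI[OF Pk_continuous_on[OF p(1)]]) (use p(2) in auto)
qed

section \<open>The discrete spaces are finite dimensional\<close>

lemma piecewise_finite_span:
  fixes R :: "'i \<Rightarrow> (real^'n) set"
  assumes "finite I"
  shows "\<exists>A. finite A \<and> {v. (\<forall>i\<in>I. \<exists>p\<in>Pk k. \<forall>x\<in>R i. v x = p x) \<and> (\<forall>x. x \<notin> (\<Union>i\<in>I. R i) \<longrightarrow> v x = 0)} \<subseteq> span A"
proof -
  \<comment> \<open>\<open>sel\<close> chooses one of the pieces containing a point, as closed pieces overlap.\<close>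
  define sel where "sel x = (SOME i. i \<in> I \<and> x \<in> R i)" for x
  define cut where "cut i p = (\<lambda>x. if x \<in> R i \<and> sel x = i then p x else 0 :: real)" for i p
  define A where "A = (\<Union>i\<in>I. cut i ` mono_fun ` {e. sum e UNIV \<le> k})"
  have sel: "sel x \<in> I \<and> x \<in> R (sel x)" if "x \<in> (\<Union>i\<in>I. R i)" for x
    unfolding sel_def by (rule someI_ex) (use that in auto)
  have cut_lin: "linear (cut i)" for i
    by (intro linearI) (auto simp: cut_def fun_eq_iff)
  have cut_span: "cut i p \<in> span A" if "i \<in> I" "p \<in> Pk k" for i p
  proof -
    have "cut i p \<in> cut i ` span (mono_fun ` {e. sum e UNIV \<le> k})"
      using that(2) unfolding Pk_eq_span by blast
    also have "\<dots> = span (cut i ` mono_fun ` {e. sum e UNIV \<le> k})"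
      using linear_span_image[OF cut_lin] by blast
    also have "\<dots> \<subseteq> span A" unfolding A_def using that(1) by (intro span_mono) blast
    finally show ?thesis .
  qed
  have "v \<in> span A" if v: "\<forall>i\<in>I. \<exists>p\<in>Pk k. \<forall>x\<in>R i. v x = p x" "\<forall>x. x \<notin> (\<Union>i\<in>I. R i) \<longrightarrow> v x = 0" for v
  proof -
    obtain p where p: "\<forall>i\<in>I. p i \<in> Pk k \<and> (\<forall>x\<in>R i. v x = p i x)" using v(1) by metis
    have "v = (\<Sum>i\<in>I. cut i (p i))"
    proof
      fix x
      show "v x = (\<Sum>i\<in>I. cut i (p i)) x"
      proof (cases "x \<in> (\<Union>i\<in>I. R i)")
        case True
        have "(\<Sum>i\<in>I. cut i (p i) x) = (\<Sum>i\<in>I. if sel x = i then v x else 0)"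
          by (rule sum.cong) (use p sel[OF True] in \<open>auto simp: cut_def\<close>)
        then show ?thesis using sel[OF True] assms by (simp add: sum_fun_apply)
      next
        case False
        then have "(\<Sum>i\<in>I. cut i (p i) x) = 0" by (intro sum.neutral) (auto simp: cut_def)
        then show ?thesis using v(2) False by (simp add: sum_fun_apply)
      qed
    qed
    then show ?thesis using p cut_span by (auto intro!: span_sum)
  qed
  moreover have "finite A" unfolding A_def using assms finite_multi_indices by blast
  ultimately show ?thesis by (intro exI[of _ A]) auto
qed

lemma vector_finite_span:
  fixes S :: "(real^'n \<Rightarrow> real) set"
  assumes "finite A" "S \<subseteq> span A"
  shows "\<exists>B. finite B \<and> {v :: real^'n \<Rightarrow> real^'n. \<forall>i. (\<lambda>x. v x $ i) \<in> S} \<subseteq> span B"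
proof -
  define emb where "emb i f = (\<lambda>x. f x *\<^sub>R axis i 1 :: real^'n)" for i and f :: "real^'n \<Rightarrow> real"
  define B where "B = (\<Union>i\<in>UNIV. emb i ` A)"
  have lin: "linear (emb i)" for i by (intro linearI) (auto simp: emb_def fun_eq_iff scaleR_add_left)
  have emb_span: "emb i f \<in> span B" if "f \<in> S" for i f
  proof -
    have "emb i f \<in> span (emb i ` A)" using assms(2) that linear_span_image[OF lin, of i A] by blast
    also have "\<dots> \<subseteq> span B" unfolding B_def by (intro span_mono) blast
    finally show ?thesis .
  qed
  have "v \<in> span B" if "\<forall>i. (\<lambda>x. v x $ i) \<in> S" for v :: "real^'n \<Rightarrow> real^'n"
  proof -
    have "v = (\<Sum>i\<in>UNIV. emb i (\<lambda>x. v x $ i))"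
    proof
      fix x
      show "v x = (\<Sum>i\<in>UNIV. emb i (\<lambda>x. v x $ i)) x"
        unfolding sum_fun_apply emb_def using basis_expansion[of "v x"] by (simp add: scalar_mult_eq_scaleR)
    qed
    then show ?thesis using emb_span[OF that[rule_format]] span_sum[of UNIV "\<lambda>i. emb i (\<lambda>x. v x $ i)" B] by simp
  qed
  moreover have "finite B" unfolding B_def using assms(1) by simp
  ultimately show ?thesis by (intro exI[of _ B]) auto
qed

lemma Times_finite_span:
  assumes "\<exists>A. finite A \<and> S \<subseteq> span A" "\<exists>B. finite B \<and> S' \<subseteq> span B"
  shows "\<exists>D. finite D \<and> S \<times> S' \<subseteq> span D"
proof -
  obtain A B where AB: "finite A" "S \<subseteq> span A" "finite B" "S' \<subseteq> span B" using assms by blast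
  define l where "l = (\<lambda>a::'a. (a, 0::'b))"
  define r where "r = (\<lambda>b::'b. (0::'a, b))"
  have lin: "linear l" "linear r" by (auto intro!: linearI simp: l_def r_def)
  have "S \<times> S' \<subseteq> span (l ` A \<union> r ` B)"
  proof
    fix x assume "x \<in> S \<times> S'"
    then obtain a b where ab: "a \<in> S" "b \<in> S'" "x = (a, b)" by auto
    have "l a \<in> span (l ` A)" using AB ab linear_span_image[OF lin(1), of A] by blast
    moreover have "r b \<in> span (r ` B)" using AB ab linear_span_image[OF lin(2), of B] by blast
    ultimately have "l a + r b \<in> span (l ` A \<union> r ` B)"
      by (meson span_add span_mono subsetD sup_ge1 sup_ge2)
    then show "x \<in> span (l ` A \<union> r ` B)" by (simp add: l_def r_def ab)
  qed
  then show ?thesis using AB by (intro exI[of _ "l ` A \<union> r ` B"]) simp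
qed

lemma finite_cell_spaces:
  fixes T :: "(real^'n) set set"
  assumes "finite T"
  shows "\<exists>A. finite A \<and> Vh k T \<subseteq> span A" "\<exists>A. finite A \<and> Qh k \<Omega> T \<subseteq> span A"
proof -
  obtain A where A: "finite A" "{v. (\<forall>K\<in>T. \<exists>p\<in>Pk k. \<forall>x\<in>interior K. v x = p x) \<and>
      (\<forall>x. x \<notin> (\<Union>K\<in>T. interior K) \<longrightarrow> v x = 0)} \<subseteq> span A"
    using piecewise_finite_span[OF assms, of k interior] by (elim exE conjE)
  obtain B where B: "finite B" "{v :: real^'n \<Rightarrow> real^'n. \<forall>i. (\<lambda>x. v x $ i) \<in> {v. (\<forall>K\<in>T. \<exists>p\<in>Pk k. \<forall>x\<in>interior K. v x = p x) \<and>
      (\<forall>x. x \<notin> (\<Union>K\<in>T. interior K) \<longrightarrow> v x = 0)}} \<subseteq> span B"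
    using vector_finite_span[OF A] by (elim exE conjE)
  have "Vh k T \<subseteq> {v :: real^'n \<Rightarrow> real^'n. \<forall>i. (\<lambda>x. v x $ i) \<in> {v. (\<forall>K\<in>T. \<exists>p\<in>Pk k. \<forall>x\<in>interior K. v x = p x) \<and>
      (\<forall>x. x \<notin> (\<Union>K\<in>T. interior K) \<longrightarrow> v x = 0)}}"
    proof (intro subsetI CollectI allI conjI ballI impI)
    fix v :: "real^'n \<Rightarrow> real^'n" and i assume v: "v \<in> Vh k T"
    show "\<exists>p\<in>Pk k. \<forall>x\<in>interior K. v x $ i = p x" if K: "K \<in> T" for K
    proof -
      obtain p where "p \<in> Pk_vec k" "\<forall>x\<in>interior K. v x = p x" using v K by (auto simp: Vh_def)
      then show ?thesis by (intro bexI[of _ "\<lambda>x. p x $ i"]) (auto simp: Pk_vec_def)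
    qed
    show "v x $ i = 0" if "x \<notin> (\<Union>K\<in>T. interior K)" for x
      using v that by (simp add: Vh_def)
  qed
  then show "\<exists>A. finite A \<and> Vh k T \<subseteq> span A"
    using B by (intro exI[of _ B] conjI B(1)) (rule order_trans)
  obtain A' where A': "finite A'" "{v. (\<forall>K\<in>T. \<exists>p\<in>Pk (k - 1). \<forall>x\<in>interior K. v x = p x) \<and>
      (\<forall>x. x \<notin> (\<Union>K\<in>T. interior K) \<longrightarrow> v x = 0)} \<subseteq> span A'"
    using piecewise_finite_span[OF assms, of "k - 1" interior] by (elim exE conjE)
  have "Qh k \<Omega> T \<subseteq> {v. (\<forall>K\<in>T. \<exists>p\<in>Pk (k - 1). \<forall>x\<in>interior K. v x = p x) \<and>
      (\<forall>x. x \<notin> (\<Union>K\<in>T. interior K) \<longrightarrow> v x = 0)}"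
    by (auto simp: Qh_def)
  then show "\<exists>A. finite A \<and> Qh k \<Omega> T \<subseteq> span A"
    using A' by (intro exI[of _ A'] conjI A'(1)) (rule order_trans)
qed

text \<open>For \<open>Vbarh\<close> continuity and the boundary condition are dropped: a finite set
  whose span contains the larger space is enough.\<close>

lemma finite_facet_spaces:
  fixes T :: "(real^'n) set set"
  assumes "finite (facets T)"
  shows "\<exists>A. finite A \<and> Vbarh k \<Omega> \<Omega>s T \<subseteq> span A" "\<exists>A. finite A \<and> Qbarh k T \<subseteq> span A"
proof -
  obtain A where A: "finite A" "{v. (\<forall>F\<in>facets T. \<exists>p\<in>Pk k. \<forall>x\<in>F. v x = p x) \<and>
      (\<forall>x. x \<notin> (\<Union>F\<in>facets T. F) \<longrightarrow> v x = 0)} \<subseteq> span A"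
    using piecewise_finite_span[OF assms, of k "\<lambda>F. F"] by (elim exE conjE)
  obtain B where B: "finite B" "{v :: real^'n \<Rightarrow> real^'n. \<forall>i. (\<lambda>x. v x $ i) \<in> {v. (\<forall>F\<in>facets T. \<exists>p\<in>Pk k. \<forall>x\<in>F. v x = p x) \<and>
      (\<forall>x. x \<notin> (\<Union>F\<in>facets T. F) \<longrightarrow> v x = 0)}} \<subseteq> span B"
    using vector_finite_span[OF A] by (elim exE conjE)
  have "Vbarh k \<Omega> \<Omega>s T \<subseteq> {v :: real^'n \<Rightarrow> real^'n. \<forall>i. (\<lambda>x. v x $ i) \<in> {v. (\<forall>F\<in>facets T. \<exists>p\<in>Pk k. \<forall>x\<in>F. v x = p x) \<and>
      (\<forall>x. x \<notin> (\<Union>F\<in>facets T. F) \<longrightarrow> v x = 0)}}"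
    proof (intro subsetI CollectI allI conjI ballI impI)
    fix v :: "real^'n \<Rightarrow> real^'n" and i assume v: "v \<in> Vbarh k \<Omega> \<Omega>s T"
    show "\<exists>p\<in>Pk k. \<forall>x\<in>F. v x $ i = p x" if F: "F \<in> facets T" for F
    proof -
      obtain p where "p \<in> Pk_vec k" "\<forall>x\<in>F. v x = p x" using v F by (auto simp: Vbarh_def)
      then show ?thesis by (intro bexI[of _ "\<lambda>x. p x $ i"]) (auto simp: Pk_vec_def)
    qed
    show "v x $ i = 0" if "x \<notin> (\<Union>F\<in>facets T. F)" for x
      using v that by (simp add: Vbarh_def)
  qed
  then show "\<exists>A. finite A \<and> Vbarh k \<Omega> \<Omega>s T \<subseteq> span A"
    using B by (intro exI[of _ B] conjI B(1)) (rule order_trans)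
  show "\<exists>A. finite A \<and> Qbarh k T \<subseteq> span A"
    unfolding Qbarh_def by (rule piecewise_finite_span[OF assms])
qed

lemma subspace_piecewise:
  fixes P :: "('a \<Rightarrow> 'b::real_vector) set"
  assumes "subspace P"
  shows "subspace {v. \<forall>i\<in>I. \<exists>p\<in>P. \<forall>x\<in>R i. v x = p x}"
  unfolding subspace_def
proof (intro conjI ballI allI CollectI)
  show "\<exists>p\<in>P. \<forall>x\<in>R i. 0 x = p x" for i using subspace_0[OF assms] by (intro bexI[of _ 0]) auto
  fix v i assume v: "v \<in> {v. \<forall>i\<in>I. \<exists>p\<in>P. \<forall>x\<in>R i. v x = p x}" and i: "i \<in> I"
  then obtain p where p: "p \<in> P" "\<forall>x\<in>R i. v x = p x" by blast
  then show "\<exists>p\<in>P. \<forall>x\<in>R i. (c *\<^sub>R v) x = p x" for c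
    using subspace_scale[OF assms p(1)] by (intro bexI[of _ "c *\<^sub>R p"]) auto
  fix w assume "w \<in> {v. \<forall>i\<in>I. \<exists>p\<in>P. \<forall>x\<in>R i. v x = p x}"
  then obtain q where q: "q \<in> P" "\<forall>x\<in>R i. w x = q x" using i by blast
  show "\<exists>p\<in>P. \<forall>x\<in>R i. (v + w) x = p x"
    using subspace_add[OF assms p(1) q(1)] p q by (intro bexI[of _ "p + q"]) auto
qed

lemma subspace_vanishing: "subspace {v :: 'a \<Rightarrow> 'b::real_vector. \<forall>x\<in>Z. v x = 0}"
  by (auto simp: subspace_def)

lemma subspace_Vh: "subspace (Vh k T)"
proof -
  have "Vh k T = {v. \<forall>K\<in>T. \<exists>p\<in>Pk_vec k. \<forall>x\<in>interior K. v x = p x} \<inter> {v. \<forall>x\<in>- (\<Union>K\<in>T. interior K). v x = 0}"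
    by (auto simp: Vh_def)
  then show ?thesis by (simp only: subspace_inter subspace_piecewise[OF subspace_Pk_vec] subspace_vanishing)
qed

lemma subspace_Qbarh: "subspace (Qbarh k T)"
proof -
  have "Qbarh k T = {v. \<forall>F\<in>facets T. \<exists>p\<in>Pk k. \<forall>x\<in>rel_interior F. v x = p x} \<inter> {v. \<forall>x\<in>- (\<Union>F\<in>facets T. rel_interior F). v x = 0}"
    by (auto simp: Qbarh_def)
  then show ?thesis by (simp only: subspace_inter subspace_piecewise[OF subspace_Pk] subspace_vanishing)
qed

lemma subspace_Vbarh: "subspace (Vbarh k \<Omega> \<Omega>s Ts)"
proof -
  have eq: "Vbarh k \<Omega> \<Omega>s Ts = {v. \<forall>F\<in>facets Ts. \<exists>p\<in>Pk_vec k. \<forall>x\<in>F. v x = p x} \<inter> {v. \<forall>x\<in>frontier \<Omega> \<inter> frontier \<Omega>s. v x = 0}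
      \<inter> {v. continuous_on (\<Union>(facets Ts)) v} \<inter> {v. \<forall>x\<in>- \<Union>(facets Ts). v x = 0}"
    by (auto simp: Vbarh_def)
  have "subspace {v :: real^'a \<Rightarrow> real^'a. continuous_on (\<Union>(facets Ts)) v}"
    by (auto simp: subspace_def plus_fun_def scaleR_fun_def zero_fun_def intro!: continuous_intros)
  then show ?thesis unfolding eq
    by (simp only: subspace_inter subspace_piecewise[OF subspace_Pk_vec] subspace_vanishing)
qed

text \<open>The product is dominated by the sum of the two squares.\<close>

lemma L2_on_inner_integrable:
  fixes f g :: "real^'n \<Rightarrow> 'b::euclidean_space"
  assumes f: "L2_on D f" and D: "D \<in> sets lebesgue" and g: "g \<in> borel_measurable (lebesgue_on D)"
    and g2: "set_integrable lebesgue D (\<lambda>x. g x \<bullet> g x)"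
  shows "set_integrable lebesgue D (\<lambda>x. f x \<bullet> g x)"
proof -
  have iff: "integrable (lebesgue_on D) h \<longleftrightarrow> set_integrable lebesgue D h" for h :: "real^'n \<Rightarrow> real"
    unfolding set_integrable_def using integrable_restrict_space[of D lebesgue h] D by simp
  have "integrable (lebesgue_on D) (\<lambda>x. f x \<bullet> g x)"
  proof (rule Bochner_Integration.integrable_bound)
    show "integrable (lebesgue_on D) (\<lambda>x. (norm (f x))\<^sup>2 + g x \<bullet> g x)"
      using f g2 unfolding L2_on_def iff[symmetric] by auto
    show "(\<lambda>x. f x \<bullet> g x) \<in> borel_measurable (lebesgue_on D)"
      using f g unfolding L2_on_def by (intro borel_measurable_inner) auto
    have "\<bar>f x \<bullet> g x\<bar> \<le> (norm (f x))\<^sup>2 + g x \<bullet> g x" for x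
    proof -
      have "\<bar>f x \<bullet> g x\<bar> \<le> norm (f x) * norm (g x)" by (rule Cauchy_Schwarz_ineq2)
      also have "\<dots> \<le> (norm (f x))\<^sup>2 + (norm (g x))\<^sup>2"
        using sum_squares_bound[of "norm (f x)" "norm (g x)"] mult_nonneg_nonneg[OF norm_ge_zero norm_ge_zero, of "f x" "g x"] by linarith
      finally show ?thesis by (simp add: power2_norm_eq_inner)
    qed
    then show "AE x in lebesgue_on D. norm (f x \<bullet> g x) \<le> norm ((norm (f x))\<^sup>2 + g x \<bullet> g x)"
      by (intro AE_I2) (simp add: abs_of_nonneg)
  qed
  then show ?thesis unfolding iff .
qed

section \<open>The velocity and pressure spaces on the coupled mesh\<close>

context stokes_darcy
begin

definition VV :: "nat \<Rightarrow> 'n velocity set" where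
  "VV k = Vh k (Ts \<union> Td) \<times> Vbarh k \<Omega> \<Omega>s Ts"

definition QQ :: "nat \<Rightarrow> 'n pressure set" where
  "QQ k = Qh k \<Omega> (Ts \<union> Td) \<times> Qbarh k Ts \<times> Qbarh k Td"

lemma Xh_eq: "Xh k \<Omega> \<Omega>s Ts Td = VV k \<times> QQ k"
  by (simp add: Xh_def VV_def QQ_def)

lemma region_integrable:
  fixes g :: "real^'n \<Rightarrow> real"
  assumes D: "D \<in> sets lebesgue" "D \<subseteq> \<Union>T0" "T0 \<subseteq> Ts \<union> Td"
    and g: "\<And>K. K \<in> T0 \<Longrightarrow> regular_on (interior K) g"
  shows "set_integrable lebesgue D g"
proof -
  have "set_integrable lebesgue (\<Union>K\<in>T0. K) g"
  proof (rule set_integrable_UN)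
    show "finite T0" using D(3) finite_T finite_subset by blast
    fix K assume K: "K \<in> T0"
    then have KT: "K \<in> Ts \<union> Td" using D(3) by blast
    show "set_integrable lebesgue K g" by (rule cell_integrable[OF cell(1,2)[OF KT] g[OF K]])
    show "K \<in> sets lebesgue" by (rule fmeasurableD[OF lmeasurable_compact[OF cell(1)[OF KT]]])
  qed
  then show ?thesis by (rule set_integrable_subset) (use D in simp_all)
qed

lemma region_sets: "\<Omega> \<in> sets lebesgue" "\<Omega>s \<in> sets lebesgue" "\<Omega>d \<in> sets lebesgue"
  using regions_open by auto

lemma region_cover: "\<Omega> \<subseteq> \<Union>(Ts \<union> Td)" "\<Omega>s \<subseteq> \<Union>Ts" "\<Omega>d \<subseteq> \<Union>Td"
  using closure_subset closure_\<Omega> Union_Ts Union_Td by blast+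

text \<open>The mean value is additive only on integrable functions, so integrability over
  \<open>\<Omega>\<close> is derived from the piecewise polynomial structure before the zero-mean
  condition is added.\<close>

lemma subspace_Qh: "subspace (Qh k \<Omega> (Ts \<union> Td))"
proof -
  let ?S = "{v. \<forall>K\<in>Ts \<union> Td. \<exists>p\<in>Pk (k - 1). \<forall>x\<in>interior K. v x = p x} \<inter> {v. \<forall>x\<in>- (\<Union>K\<in>Ts \<union> Td. interior K). v x = 0}"
  have S: "subspace ?S" by (simp only: subspace_inter subspace_piecewise[OF subspace_Pk] subspace_vanishing)
  have int: "set_integrable lebesgue \<Omega> v" if v: "v \<in> ?S" for v
  proof (rule region_integrable[OF region_sets(1) region_cover(1) order_refl])
    fix K assume "K \<in> Ts \<union> Td"
    then obtain p where p: "p \<in> Pk (k - 1)" "\<forall>x\<in>interior K. v x = p x" using v by blast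
    show "regular_on (interior K) v" by (rule regular_onI[OF Pk_continuous_on[OF p(1)]]) (use p(2) in auto)
  qed
  have eq: "Qh k \<Omega> (Ts \<union> Td) = {v \<in> ?S. (LINT x:\<Omega>|lebesgue. v x) = 0}"
    by (auto simp: Qh_def)
  show ?thesis unfolding eq subspace_def
  proof (intro conjI ballI allI CollectI)
    show "0 \<in> ?S" "(LINT x:\<Omega>|lebesgue. 0 x) = 0"
      using subspace_0[OF S] by (simp_all add: set_lebesgue_integral_def)
    fix v assume v: "v \<in> {v \<in> ?S. (LINT x:\<Omega>|lebesgue. v x) = 0}"
    then show "c *\<^sub>R v \<in> ?S" "(LINT x:\<Omega>|lebesgue. (c *\<^sub>R v) x) = 0" for c
      using subspace_scale[OF S, of v c] by simp_all
    fix w assume w: "w \<in> {v \<in> ?S. (LINT x:\<Omega>|lebesgue. v x) = 0}"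
    show "v + w \<in> ?S" using subspace_add[OF S, of v w] v w by simp
    show "(LINT x:\<Omega>|lebesgue. (v + w) x) = 0"
      using set_integral_add(2)[OF int int, of v w] v w by simp
  qed
qed

lemma subspace_VV: "subspace (VV k)" and subspace_QQ: "subspace (QQ k)"
  unfolding VV_def QQ_def
  by (intro subspace_Times subspace_Vh subspace_Vbarh subspace_Qh subspace_Qbarh)+

lemma finite_facets: "finite (facets Ts)" "finite (facets Td)"
  unfolding facets_def using finite_Ts finite_Td cell(6) by auto

lemma finite_span_Xh: "\<exists>A. finite A \<and> VV k \<times> QQ k \<subseteq> span A"
  unfolding VV_def QQ_def
  by (intro Times_finite_span finite_cell_spaces finite_facet_spaces finite_T finite_facets)

section \<open>Linearity and symmetry of the forms\<close>

lemma linear_on_bdry: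
  fixes G :: "'v::real_vector \<Rightarrow> real^'n \<Rightarrow> real^'n \<Rightarrow> real"
  assumes K: "K \<in> Ts \<union> Td"
    and reg: "\<And>F v. F \<in> cell_facets K \<Longrightarrow> v \<in> V \<Longrightarrow> regular_on (rel_interior F) (G v (out_normal K F))"
    and lin: "\<And>F x. F \<in> cell_facets K \<Longrightarrow> x \<in> rel_interior F \<Longrightarrow> linear_on V (\<lambda>v. G v (out_normal K F) x)"
  shows "linear_on V (\<lambda>v. bdry_integral K (G v))"
  unfolding bdry_integral_def
  by (intro linear_on_sum_functionals linear_on_facet cell_facet(1)[OF K] reg lin)

lemma linear_on_interface:
  fixes G :: "'v::real_vector \<Rightarrow> real^'n \<Rightarrow> real^'n \<Rightarrow> real"
  assumes T0: "T0 \<subseteq> Ts \<union> Td"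
    and reg: "\<And>K F v. K \<in> T0 \<Longrightarrow> F \<in> cell_facets K \<Longrightarrow> F \<in> I \<Longrightarrow> v \<in> V \<Longrightarrow> regular_on (rel_interior F) (G v (out_normal K F))"
    and lin: "\<And>K F x. K \<in> T0 \<Longrightarrow> F \<in> cell_facets K \<Longrightarrow> F \<in> I \<Longrightarrow> x \<in> rel_interior F \<Longrightarrow> linear_on V (\<lambda>v. G v (out_normal K F) x)"
  shows "linear_on V (\<lambda>v. interface_integral T0 I (G v))"
  unfolding interface_integral_def
proof (intro linear_on_sum_functionals)
  fix K F assume KF: "K \<in> T0" "F \<in> cell_facets K \<inter> I"
  then have "K \<in> Ts \<union> Td" using T0 by blast
  then show "linear_on V (\<lambda>v. facet_integral F (G v (out_normal K F)))"
    using KF by (intro linear_on_facet[OF cell_facet(1)[of K]] reg lin) auto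
qed

lemma trace_regular:
  assumes "K \<in> Ts \<union> Td" "F \<in> cell_facets K" "regular_on (interior K) g"
  shows "regular_on (rel_interior F) (cell_trace K g)"
  by (rule regular_on_subset[OF cell_trace_regular[OF cells dim2 assms(3)]])
    (use assms cell_facet(2)[OF assms(1,2)] rel_interior_subset[of F] in auto)

lemma facet_point: "K \<in> Ts \<union> Td \<Longrightarrow> F \<in> cell_facets K \<Longrightarrow> x \<in> rel_interior F \<Longrightarrow> x \<in> K"
  using cell_facet(2) rel_interior_subset by blast

lemma trace_linear:
  assumes "K \<in> Ts \<union> Td" "x \<in> K" "u \<in> Vh k (Ts \<union> Td)" "v \<in> Vh k (Ts \<union> Td)"
  shows "cell_trace K (u + v) x = cell_trace K u x + cell_trace K v x"
    "cell_trace K (c *\<^sub>R u) x = c *\<^sub>R cell_trace K u x"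
    "cell_trace K (strain (u + v)) x = cell_trace K (strain u) x + cell_trace K (strain v) x"
    "cell_trace K (strain (c *\<^sub>R u)) x = c *\<^sub>R cell_trace K (strain u) x"
proof -
  note r = Vh_regular[OF assms(3,1)] Vh_regular[OF assms(4,1)]
  note s = Vh_strain_regular[OF assms(3,1)] Vh_strain_regular[OF assms(4,1)]
  note d = Vh_differentiable[OF assms(3,1)] Vh_differentiable[OF assms(4,1)]
  show "cell_trace K (u + v) x = cell_trace K u x + cell_trace K v x"
    by (rule cell_trace_linear(1)[OF cells[OF assms(1)] dim2 r assms(2)]) simp
  show "cell_trace K (c *\<^sub>R u) x = c *\<^sub>R cell_trace K u x"
    by (rule cell_trace_linear(2)[OF cells[OF assms(1)] dim2 r assms(2)]) simp
  show "cell_trace K (strain (u + v)) x = cell_trace K (strain u) x + cell_trace K (strain v) x"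
    by (rule cell_trace_linear(1)[OF cells[OF assms(1)] dim2 s assms(2)]) (rule strain_linear(1)[OF d])
  show "cell_trace K (strain (c *\<^sub>R u)) x = c *\<^sub>R cell_trace K (strain u) x"
    by (rule cell_trace_linear(2)[OF cells[OF assms(1)] dim2 s assms(2)]) (rule strain_linear(2)[OF d(1) d(1)])
qed

lemma facets_of_cell: "K \<in> T0 \<Longrightarrow> F \<in> cell_facets K \<Longrightarrow> F \<in> facets T0"
  by (auto simp: facets_def)

lemma linear_a_stokes:
  assumes u: "u \<in> VV k"
  shows "linear_on (VV k) (a_stokes \<mu> \<beta> Ts u)"
proof -
  obtain w wb where uw: "u = (w, wb)" "w \<in> Vh k (Ts \<union> Td)" "wb \<in> Vbarh k \<Omega> \<Omega>s Ts"
    using u by (auto simp: VV_def)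
  have v: "fst v \<in> Vh k (Ts \<union> Td)" "snd v \<in> Vbarh k \<Omega> \<Omega>s Ts" if "v \<in> VV k" for v
    using that by (auto simp: VV_def)
  have eq: "a_stokes \<mu> \<beta> Ts u = (\<lambda>v. (\<Sum>K\<in>Ts. LINT x:K|lebesgue. 2 * \<mu> * (strain w x \<bullet> strain (fst v) x))
    + (\<Sum>K\<in>Ts. bdry_integral K (\<lambda>n x. 2 * \<beta> * \<mu> / diameter K *
         ((cell_trace K w x - wb x) \<bullet> (cell_trace K (fst v) x - snd v x))))
    - (\<Sum>K\<in>Ts. bdry_integral K (\<lambda>n x. 2 * \<mu> *
         ((cell_trace K (strain w) x *v n) \<bullet> (cell_trace K (fst v) x - snd v x))))
    - (\<Sum>K\<in>Ts. bdry_integral K (\<lambda>n x. 2 * \<mu> *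
         ((cell_trace K (strain (fst v)) x *v n) \<bullet> (cell_trace K w x - wb x)))))"
    by (auto simp: a_stokes_def uw case_prod_beta fun_eq_iff)
  show ?thesis unfolding eq
  proof (intro linear_on_minus linear_on_plus linear_on_sum_functionals)
    fix K assume KTs: "K \<in> Ts"
    then have K: "K \<in> Ts \<union> Td" by blast
    show "linear_on (VV k) (\<lambda>v. LINT x:K|lebesgue. 2 * \<mu> * (strain w x \<bullet> strain (fst v) x))"
    proof (rule linear_on_cell[OF cell(1,2)[OF K]])
      show "regular_on (interior K) (\<lambda>x. 2 * \<mu> * (strain w x \<bullet> strain (fst v) x))" if "v \<in> VV k" for v
        using uw v[OF that] K by (intro regular_on_mult regular_on_const regular_on_inner Vh_strain_regular)
      show "linear_on (VV k) (\<lambda>v. 2 * \<mu> * (strain w x \<bullet> strain (fst v) x))" if x: "x \<in> interior K" for x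
        using strain_linear[OF Vh_differentiable[OF v(1) K x] Vh_differentiable[OF v(1) K x]]
        by (auto simp: linear_on_def inner_add_right algebra_simps)
    qed
    have jump: "regular_on (rel_interior F) (\<lambda>x. cell_trace K g x - gb x)"
      if F: "F \<in> cell_facets K" and g: "g \<in> Vh k (Ts \<union> Td)" "gb \<in> Vbarh k \<Omega> \<Omega>s Ts" for F g gb
      by (rule regular_on_diff[OF trace_regular[OF K F Vh_regular[OF g(1) K]] Vbarh_regular[OF g(2) facets_of_cell[OF KTs F]]])
    have stress: "regular_on (rel_interior F) (\<lambda>x. cell_trace K (strain g) x *v n)"
      if F: "F \<in> cell_facets K" and g: "g \<in> Vh k (Ts \<union> Td)" for F g n
      by (rule regular_on_map[OF continuous_matrix_vector trace_regular[OF K F Vh_strain_regular[OF g K]]])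
    note tr = jump[OF _ uw(2,3)] jump[OF _ v] stress[OF _ uw(2)] stress[OF _ v(1)]
    have lin1: "linear_on (VV k) (\<lambda>v. y \<bullet> (cell_trace K (fst v) x - snd v x))"
      if "F \<in> cell_facets K" "x \<in> rel_interior F" for F x y
      using trace_linear(1,2)[OF K facet_point[OF K that] v(1) v(1)]
      by (auto simp: linear_on_def inner_add_right inner_diff_right algebra_simps)
    have lin2: "linear_on (VV k) (\<lambda>v. (cell_trace K (strain (fst v)) x *v n) \<bullet> y)"
      if "F \<in> cell_facets K" "x \<in> rel_interior F" for F x y n
      using trace_linear(3,4)[OF K facet_point[OF K that] v(1) v(1)]
      by (auto simp: linear_on_def matrix_vector_mult_add_rdistrib inner_add_left scaleR_matrix_vector_assoc[symmetric])
    show "linear_on (VV k) (\<lambda>v. bdry_integral K (\<lambda>n x. 2 * \<beta> * \<mu> / diameter K *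
         ((cell_trace K w x - wb x) \<bullet> (cell_trace K (fst v) x - snd v x))))"
      by (rule linear_on_bdry[OF K]) (intro regular_on_mult regular_on_const regular_on_inner tr linear_on_cmult lin1; assumption)+
    show "linear_on (VV k) (\<lambda>v. bdry_integral K (\<lambda>n x. 2 * \<mu> *
         ((cell_trace K (strain w) x *v n) \<bullet> (cell_trace K (fst v) x - snd v x))))"
      by (rule linear_on_bdry[OF K]) (intro regular_on_mult regular_on_const regular_on_inner tr linear_on_cmult lin1; assumption)+
    show "linear_on (VV k) (\<lambda>v. bdry_integral K (\<lambda>n x. 2 * \<mu> *
         ((cell_trace K (strain (fst v)) x *v n) \<bullet> (cell_trace K w x - wb x))))"
      by (rule linear_on_bdry[OF K]) (intro regular_on_mult regular_on_const regular_on_inner tr linear_on_cmult lin2; assumption)+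
  qed
qed

lemma interface_facet: "F \<in> interface_facets Ts Td \<Longrightarrow> F \<in> facets Ts \<and> F \<in> facets Td"
  by (simp add: interface_facets_def)

lemma tangential_linear: "linear (tangential n)"
  by (intro linearI) (auto simp: tangential_def inner_add_left algebra_simps)

lemma continuous_tangential: "continuous_on UNIV (tangential n)"
  unfolding tangential_def by (intro continuous_intros)

lemma linear_a_h:
  assumes u: "u \<in> VV k"
  shows "linear_on (VV k) (a_h \<mu> \<kappa> \<alpha> \<beta> \<Omega>d Ts Td u)"
  unfolding a_h_def
proof (intro linear_on_plus linear_a_stokes[OF u])
  have uV: "fst u \<in> Vh k (Ts \<union> Td)" "snd u \<in> Vbarh k \<Omega> \<Omega>s Ts" using u by (auto simp: VV_def)
  have v: "fst v \<in> Vh k (Ts \<union> Td)" "snd v \<in> Vbarh k \<Omega> \<Omega>s Ts" if "v \<in> VV k" for v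
    using that by (auto simp: VV_def)
  have int: "set_integrable lebesgue \<Omega>d (\<lambda>x. inverse \<kappa> * (fst u x \<bullet> fst v x))" if "v \<in> VV k" for v
    using uV(1) v(1)[OF that]
    by (intro region_integrable[OF region_sets(3) region_cover(3)] regular_on_mult regular_on_const regular_on_inner)
      (auto intro: Vh_regular)
  show "linear_on (VV k) (\<lambda>v. a_darcy \<kappa> \<Omega>d (fst u) (fst v))"
    unfolding linear_on_def a_darcy_def
  proof (intro conjI ballI allI)
    fix v w assume vw: "v \<in> VV k" "w \<in> VV k"
    show "(LINT x:\<Omega>d|lebesgue. inverse \<kappa> * (fst u x \<bullet> fst (v + w) x)) =
        (LINT x:\<Omega>d|lebesgue. inverse \<kappa> * (fst u x \<bullet> fst v x)) + (LINT x:\<Omega>d|lebesgue. inverse \<kappa> * (fst u x \<bullet> fst w x))"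
      using set_integral_add(2)[OF int[OF vw(1)] int[OF vw(2)]] by (simp add: inner_add_right distrib_left)
    show "(LINT x:\<Omega>d|lebesgue. inverse \<kappa> * (fst u x \<bullet> fst (c *\<^sub>R v) x)) =
        c * (LINT x:\<Omega>d|lebesgue. inverse \<kappa> * (fst u x \<bullet> fst v x))" for c
      by (simp add: mult.left_commute[of _ c])
  qed
  show "linear_on (VV k) (\<lambda>v. a_interface \<kappa> \<alpha> Ts Td (snd u) (snd v))"
    unfolding a_interface_def
  proof (rule linear_on_interface)
    fix K F x assume "K \<in> Ts" "F \<in> cell_facets K"
    then have F: "F \<in> facets Ts" by (rule facets_of_cell)
    show "regular_on (rel_interior F) (\<lambda>x. \<alpha> / sqrt \<kappa> * (tangential (out_normal K F) (snd u x) \<bullet> tangential (out_normal K F) (snd v x)))"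
      if "v \<in> VV k" for v
      using uV(2) v(2)[OF that] F
      by (intro regular_on_mult regular_on_const regular_on_inner regular_on_map[OF continuous_tangential] Vbarh_regular)
    show "linear_on (VV k) (\<lambda>v. \<alpha> / sqrt \<kappa> * (tangential (out_normal K F) (snd u x) \<bullet> tangential (out_normal K F) (snd v x)))"
      by (rule linear_on_cmult)
        (auto simp: linear_on_def linear_add[OF tangential_linear] linear_scale[OF tangential_linear] inner_add_right)
  qed auto
qed

lemma linear_b_h_velocity:
  assumes q: "q \<in> Qh k \<Omega> (Ts \<union> Td)" and T0: "T0 \<subseteq> Ts \<union> Td" and qb: "qb \<in> Qbarh k T0"
  shows "linear_on (Vh k (Ts \<union> Td)) (b_h T0 q qb)"
  unfolding b_h_def
proof (intro linear_on_plus linear_on_uminus linear_on_sum_functionals)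
  fix K assume KT0: "K \<in> T0"
  then have K: "K \<in> Ts \<union> Td" using T0 by blast
  show "linear_on (Vh k (Ts \<union> Td)) (\<lambda>v. LINT x:K|lebesgue. q x * divergence v x)"
  proof (rule linear_on_cell[OF cell(1,2)[OF K]])
    show "regular_on (interior K) (\<lambda>x. q x * divergence v x)" if "v \<in> Vh k (Ts \<union> Td)" for v
      using q that K by (intro regular_on_mult Vh_divergence_regular Qh_regular)
    show "linear_on (Vh k (Ts \<union> Td)) (\<lambda>v. q x * divergence v x)" if x: "x \<in> interior K" for x
      using divergence_linear[OF Vh_differentiable[OF _ K x] Vh_differentiable[OF _ K x]]
      by (auto simp: linear_on_def algebra_simps)
  qed
  show "linear_on (Vh k (Ts \<union> Td)) (\<lambda>v. bdry_integral K (\<lambda>n x. qb x * (cell_trace K v x \<bullet> n)))"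
  proof (rule linear_on_bdry[OF K])
    fix F assume F: "F \<in> cell_facets K"
    show "regular_on (rel_interior F) (\<lambda>x. qb x * (cell_trace K v x \<bullet> out_normal K F))" if "v \<in> Vh k (Ts \<union> Td)" for v
      using qb that K F facets_of_cell[OF KT0 F]
      by (intro regular_on_mult regular_on_inner regular_on_const trace_regular Vh_regular Qbarh_regular)
    show "linear_on (Vh k (Ts \<union> Td)) (\<lambda>v. qb x * (cell_trace K v x \<bullet> out_normal K F))" if x: "x \<in> rel_interior F" for x
      using trace_linear(1,2)[OF K facet_point[OF K F x]]
      by (auto simp: linear_on_def inner_add_left algebra_simps)
  qed
qed

lemma linear_b_I_velocity:
  assumes T0: "T0 = Ts \<or> T0 = Td" and qb: "qb \<in> Qbarh k T0"
  shows "linear_on (Vbarh k \<Omega> \<Omega>s Ts) (b_I T0 (interface_facets Ts Td) qb)"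
  unfolding b_I_def
proof (intro linear_on_uminus linear_on_interface)
  show "T0 \<subseteq> Ts \<union> Td" using T0 by blast
  fix K F x assume KF: "K \<in> T0" "F \<in> cell_facets K" "F \<in> interface_facets Ts Td"
  show "regular_on (rel_interior F) (\<lambda>x. qb x * (v x \<bullet> out_normal K F))" if "v \<in> Vbarh k \<Omega> \<Omega>s Ts" for v
    by (intro regular_on_mult regular_on_inner regular_on_const Qbarh_regular[OF qb facets_of_cell[OF KF(1,2)]]
        Vbarh_regular[OF that conjunct1[OF interface_facet[OF KF(3)]]])
  show "linear_on (Vbarh k \<Omega> \<Omega>s Ts) (\<lambda>v. qb x * (v x \<bullet> out_normal K F))"
    by (auto simp: linear_on_def inner_add_left algebra_simps)
qed

lemma linear_b_total_velocity:
  assumes q: "q \<in> QQ k"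
  shows "linear_on (VV k) (b_total Ts Td q)"
proof -
  obtain p ps pd where qp: "q = (p, ps, pd)" "p \<in> Qh k \<Omega> (Ts \<union> Td)" "ps \<in> Qbarh k Ts" "pd \<in> Qbarh k Td"
    using q by (auto simp: QQ_def)
  have eq: "b_total Ts Td q = (\<lambda>v. (b_h Ts p ps (fst v) + b_I Ts (interface_facets Ts Td) ps (snd v))
    + (b_h Td p pd (fst v) + b_I Td (interface_facets Ts Td) pd (snd v)))"
    by (auto simp: b_total_def qp case_prod_beta fun_eq_iff)
  have proj: "fst ` VV k \<subseteq> Vh k (Ts \<union> Td)" "snd ` VV k \<subseteq> Vbarh k \<Omega> \<Omega>s Ts" by (auto simp: VV_def)
  show ?thesis unfolding eq
    by (intro linear_on_plus linear_on_compose[OF linear_fst proj(1)] linear_on_compose[OF linear_snd proj(2)]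
        linear_b_h_velocity linear_b_I_velocity qp) auto
qed

lemma linear_b_total_pressure:
  assumes v: "v \<in> VV k"
  shows "linear_on (QQ k) (\<lambda>q. b_total Ts Td q v)"
proof -
  obtain w wb where vw: "v = (w, wb)" "w \<in> Vh k (Ts \<union> Td)" "wb \<in> Vbarh k \<Omega> \<Omega>s Ts"
    using v by (auto simp: VV_def)
  have q: "fst q \<in> Qh k \<Omega> (Ts \<union> Td)" "fst (snd q) \<in> Qbarh k Ts" "snd (snd q) \<in> Qbarh k Td" if "q \<in> QQ k" for q
    using that by (auto simp: QQ_def)
  have vol: "linear_on (QQ k) (\<lambda>q. \<Sum>K\<in>T0. LINT x:K|lebesgue. fst q x * divergence w x)"
    if "T0 \<subseteq> Ts \<union> Td" for T0
  proof (intro linear_on_sum_functionals linear_on_cell)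
    fix K assume "K \<in> T0"
    then have K: "K \<in> Ts \<union> Td" using that by blast
    show "compact K" "convex K" using cell(1,2)[OF K] by auto
    show "regular_on (interior K) (\<lambda>x. fst q x * divergence w x)" if "q \<in> QQ k" for q
      using q(1)[OF that] vw K by (intro regular_on_mult Vh_divergence_regular Qh_regular)
  qed (auto simp: linear_on_def algebra_simps)
  have bdry: "linear_on (QQ k) (\<lambda>q. \<Sum>K\<in>T0. bdry_integral K (\<lambda>n x. f q x * (cell_trace K w x \<bullet> n)))"
    if "T0 \<subseteq> Ts \<union> Td" "\<And>q. q \<in> QQ k \<Longrightarrow> f q \<in> Qbarh k T0" "linear f" for T0 and f :: "'n pressure \<Rightarrow> real^'n \<Rightarrow> real"
  proof (intro linear_on_sum_functionals linear_on_bdry)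
    fix K assume KT0: "K \<in> T0"
    then show K: "K \<in> Ts \<union> Td" using that(1) by blast
    show "regular_on (rel_interior F) (\<lambda>x. f q x * (cell_trace K w x \<bullet> out_normal K F))" if "F \<in> cell_facets K" "q \<in> QQ k" for F q
      using \<open>q \<in> QQ k \<Longrightarrow> f q \<in> Qbarh k T0\<close> vw K that facets_of_cell[OF KT0 that(1)]
      by (intro regular_on_mult regular_on_inner regular_on_const trace_regular Vh_regular Qbarh_regular)
  qed (use that(3) in \<open>auto simp: linear_on_def linear_add linear_scale algebra_simps\<close>)
  have iface: "linear_on (QQ k) (\<lambda>q. interface_integral T0 (interface_facets Ts Td) (\<lambda>n x. f q x * (wb x \<bullet> n)))"
    if "T0 \<subseteq> Ts \<union> Td" "\<And>q. q \<in> QQ k \<Longrightarrow> f q \<in> Qbarh k T0" "linear f" for T0 and f :: "'n pressure \<Rightarrow> real^'n \<Rightarrow> real"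
  proof (rule linear_on_interface[OF that(1)])
    fix K F q assume KF: "K \<in> T0" "F \<in> cell_facets K" "F \<in> interface_facets Ts Td" "q \<in> QQ k"
    show "regular_on (rel_interior F) (\<lambda>x. f q x * (wb x \<bullet> out_normal K F))"
      by (intro regular_on_mult regular_on_inner regular_on_const Qbarh_regular[OF that(2)[OF KF(4)] facets_of_cell[OF KF(1,2)]]
        Vbarh_regular[OF vw(3) conjunct1[OF interface_facet[OF KF(3)]]])
  qed (use that(3) in \<open>auto simp: linear_on_def linear_add linear_scale algebra_simps\<close>)
  have l: "linear (\<lambda>q::'n pressure. fst (snd q))" "linear (\<lambda>q::'n pressure. snd (snd q))"
    by (auto intro!: linearI)
  have eq: "(\<lambda>q. b_total Ts Td q v) = (\<lambda>q.
      ((- (\<Sum>K\<in>Ts. LINT x:K|lebesgue. fst q x * divergence w x)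
        + (\<Sum>K\<in>Ts. bdry_integral K (\<lambda>n x. fst (snd q) x * (cell_trace K w x \<bullet> n))))
       + (- interface_integral Ts (interface_facets Ts Td) (\<lambda>n x. fst (snd q) x * (wb x \<bullet> n))))
    + ((- (\<Sum>K\<in>Td. LINT x:K|lebesgue. fst q x * divergence w x)
        + (\<Sum>K\<in>Td. bdry_integral K (\<lambda>n x. snd (snd q) x * (cell_trace K w x \<bullet> n))))
       + (- interface_integral Td (interface_facets Ts Td) (\<lambda>n x. snd (snd q) x * (wb x \<bullet> n)))))"
    by (auto simp: b_total_def b_h_def b_I_def vw case_prod_beta fun_eq_iff)
  show ?thesis unfolding eq
    by (intro linear_on_plus linear_on_uminus vol bdry iface l q) auto
qed

lemma B_h_eq: "B_h \<mu> \<kappa> \<alpha> \<beta> \<Omega>d Ts Td w y =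
    a_h \<mu> \<kappa> \<alpha> \<beta> \<Omega>d Ts Td (fst w) (fst y) + b_total Ts Td (snd w) (fst y) + b_total Ts Td (snd y) (fst w)"
  by (simp add: B_h_def case_prod_beta)

lemma linear_B_h:
  assumes w: "w \<in> VV k \<times> QQ k"
  shows "linear_on (VV k \<times> QQ k) (B_h \<mu> \<kappa> \<alpha> \<beta> \<Omega>d Ts Td w)"
proof -
  have w': "fst w \<in> VV k" "snd w \<in> QQ k" using w by auto
  have proj: "fst ` (VV k \<times> QQ k) \<subseteq> VV k" "snd ` (VV k \<times> QQ k) \<subseteq> QQ k" by auto
  have "linear_on (VV k \<times> QQ k) (\<lambda>y. a_h \<mu> \<kappa> \<alpha> \<beta> \<Omega>d Ts Td (fst w) (fst y) + b_total Ts Td (snd w) (fst y)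
      + b_total Ts Td (snd y) (fst w))"
    by (intro linear_on_plus linear_on_compose[OF linear_fst proj(1)] linear_a_h[OF w'(1)]
        linear_b_total_velocity[OF w'(2)] linear_on_compose[OF linear_snd proj(2) linear_b_total_pressure[OF w'(1)]])
  then show ?thesis unfolding B_h_eq[abs_def] .
qed

text \<open>Exchanging the arguments exchanges the two consistency sums; all other terms are
  symmetric in themselves.\<close>

lemma a_h_sym: "a_h \<mu> \<kappa> \<alpha> \<beta> \<Omega>d Ts Td u v = a_h \<mu> \<kappa> \<alpha> \<beta> \<Omega>d Ts Td v u"
proof -
  have "a_stokes \<mu> \<beta> Ts u v = a_stokes \<mu> \<beta> Ts v u"
    unfolding a_stokes_def case_prod_beta by (simp add: inner_commute)
  then show ?thesis unfolding a_h_def a_darcy_def a_interface_def by (simp add: inner_commute)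
qed

lemma B_h_sym: "B_h \<mu> \<kappa> \<alpha> \<beta> \<Omega>d Ts Td w y = B_h \<mu> \<kappa> \<alpha> \<beta> \<Omega>d Ts Td y w"
  unfolding B_h_eq using a_h_sym[of \<mu> \<kappa> \<alpha> \<beta> "fst w" "fst y"] by simp

text \<open>Additivity of the integrals requires integrable products; this is where square
  integrability of the data enters.\<close>

lemma linear_source:
  fixes fs :: "real^'n \<Rightarrow> real^'n" and fd :: "real^'n \<Rightarrow> real"
  assumes fs: "L2_on \<Omega>s fs" and fd: "L2_on \<Omega>d fd"
  shows "linear_on (VV k \<times> QQ k) (\<lambda>y. (LINT x:\<Omega>s|lebesgue. fs x \<bullet> fst (fst y) x) + (LINT x:\<Omega>d|lebesgue. fd x * fst (snd y) x))"
proof -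
  have meas: "g \<in> borel_measurable (lebesgue_on D)" if "set_integrable lebesgue D g" "D \<in> sets lebesgue" for g :: "real^'n \<Rightarrow> real" and D
    using that integrable_restrict_space[of D lebesgue g] unfolding set_integrable_def by auto
  have s: "set_integrable lebesgue \<Omega>s (\<lambda>x. fs x \<bullet> v x)" if v: "v \<in> Vh k (Ts \<union> Td)" for v
  proof (rule L2_on_inner_integrable[OF fs region_sets(2)])
    have r: "regular_on (interior K) v" if "K \<in> Ts" for K using Vh_regular[OF v] that by auto
    show "set_integrable lebesgue \<Omega>s (\<lambda>x. v x \<bullet> v x)"
      by (rule region_integrable[OF region_sets(2) region_cover(2)]) (auto intro: regular_on_inner r)
    show "v \<in> borel_measurable (lebesgue_on \<Omega>s)"
      by (subst borel_measurable_euclidean_space)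
        (auto intro!: meas[OF region_integrable[OF region_sets(2) region_cover(2)] region_sets(2)] regular_on_inner r)
  qed
  have d: "set_integrable lebesgue \<Omega>d (\<lambda>x. fd x * q x)" if q: "q \<in> Qh k \<Omega> (Ts \<union> Td)" for q
  proof -
    have r: "regular_on (interior K) q" if "K \<in> Td" for K using Qh_regular[OF q] that by auto
    have "set_integrable lebesgue \<Omega>d (\<lambda>x. fd x \<bullet> q x)"
    proof (rule L2_on_inner_integrable[OF fd region_sets(3)])
      show "set_integrable lebesgue \<Omega>d (\<lambda>x. q x \<bullet> q x)"
        by (rule region_integrable[OF region_sets(3) region_cover(3)]) (auto intro: regular_on_mult r)
      show "q \<in> borel_measurable (lebesgue_on \<Omega>d)"
        by (intro meas[OF region_integrable[OF region_sets(3) region_cover(3)] region_sets(3)] r) auto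
    qed
    then show ?thesis by simp
  qed
  have y: "fst (fst y) \<in> Vh k (Ts \<union> Td)" "fst (snd y) \<in> Qh k \<Omega> (Ts \<union> Td)" if "y \<in> VV k \<times> QQ k" for y
    using that by (auto simp: VV_def QQ_def)
  show ?thesis
    unfolding linear_on_def
  proof (intro conjI ballI allI)
    fix v w assume vw: "v \<in> VV k \<times> QQ k" "w \<in> VV k \<times> QQ k"
    show "(LINT x:\<Omega>s|lebesgue. fs x \<bullet> fst (fst (v + w)) x) + (LINT x:\<Omega>d|lebesgue. fd x * fst (snd (v + w)) x) =
       ((LINT x:\<Omega>s|lebesgue. fs x \<bullet> fst (fst v) x) + (LINT x:\<Omega>d|lebesgue. fd x * fst (snd v) x)) +
       ((LINT x:\<Omega>s|lebesgue. fs x \<bullet> fst (fst w) x) + (LINT x:\<Omega>d|lebesgue. fd x * fst (snd w) x))"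
      using set_integral_add(2)[OF s[OF y(1)[OF vw(1)]] s[OF y(1)[OF vw(2)]]]
        set_integral_add(2)[OF d[OF y(2)[OF vw(1)]] d[OF y(2)[OF vw(2)]]]
      by (simp add: inner_add_right distrib_left)
    show "(LINT x:\<Omega>s|lebesgue. fs x \<bullet> fst (fst (c *\<^sub>R v)) x) + (LINT x:\<Omega>d|lebesgue. fd x * fst (snd (c *\<^sub>R v)) x) =
       c * ((LINT x:\<Omega>s|lebesgue. fs x \<bullet> fst (fst v) x) + (LINT x:\<Omega>d|lebesgue. fd x * fst (snd v) x))" for c
      by (simp add: mult.left_commute[of _ c] distrib_left)
  qed
qed

end

section \<open>Kernel of the velocity norm\<close>

context stokes_darcy
begin

lemma facet_closure_rel_interior:
  assumes "K \<in> Ts \<union> Td" "F \<in> cell_facets K"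
  shows "closure (rel_interior F) = F"
  using convex_closure_rel_interior[OF cell_facet(4)[OF assms]] compact_imp_closed[OF cell_facet(3)[OF assms]] by simp

lemma velocity_kernel:
  assumes u: "(w, wb) \<in> VV k" and zero: "norm_v_sq \<Omega>d Ts Td (w, wb) \<le> 0"
  shows "w = 0" "wb = 0"
proof -
  have w: "w \<in> Vh k (Ts \<union> Td)" and wb: "wb \<in> Vbarh k \<Omega> \<Omega>s Ts" using u by (auto simp: VV_def)
  let ?I = "interface_facets Ts Td"
  let ?g = "\<lambda>K. LINT x:K|lebesgue. (norm (grad w x))\<^sup>2"
  let ?j = "\<lambda>K n x. (norm (cell_trace K w x - wb x))\<^sup>2"
  let ?t = "\<lambda>n x. (norm (tangential n (wb x)))\<^sup>2"
  have reg_g: "regular_on (interior K) (\<lambda>x. (norm (grad w x))\<^sup>2)" if "K \<in> Ts" for K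
    unfolding power2_norm_eq_inner using that by (intro regular_on_inner Vh_grad_regular[OF w]) auto
  have reg_j: "regular_on (rel_interior F) (?j K n)" if "K \<in> Ts" "F \<in> cell_facets K" for K F n
    unfolding power2_norm_eq_inner
    using trace_regular[OF _ that(2) Vh_regular[OF w]] Vbarh_regular[OF wb facets_of_cell[OF that]] that
    by (intro regular_on_inner regular_on_diff) auto
  have reg_t: "regular_on (rel_interior F) (?t n)" if "K \<in> Ts" "F \<in> cell_facets K" for K F n
    unfolding power2_norm_eq_inner
    by (intro regular_on_inner regular_on_map[OF continuous_tangential] Vbarh_regular[OF wb facets_of_cell[OF that]])
  have nn_g: "0 \<le> ?g K" for K
    unfolding set_lebesgue_integral_def by (rule integral_nonneg_AE) auto
  have nn_f: "0 \<le> facet_integral F (?j K n)" if "K \<in> Ts" "F \<in> cell_facets K" for K F n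
    using that cell_facet(1)[of K F] by (intro facet_integral_nonneg(1) reg_j) auto
  have nn_j: "0 \<le> bdry_integral K (?j K)" if "K \<in> Ts" for K
    unfolding bdry_integral_def by (intro sum_nonneg nn_f that)
  have nn_t: "0 \<le> facet_integral F (?t n)" if "K \<in> Ts" "F \<in> cell_facets K" for K F n
    using that cell_facet(1)[of K F] by (intro facet_integral_nonneg(1) reg_t) auto
  have nn_I: "0 \<le> interface_integral Ts ?I ?t"
    unfolding interface_integral_def by (intro sum_nonneg) (auto intro: nn_t)
  have nn_d: "0 \<le> (LINT x:\<Omega>d|lebesgue. (norm (w x))\<^sup>2)"
    unfolding set_lebesgue_integral_def by (rule integral_nonneg_AE) auto
  have dia: "0 \<le> inverse (diameter K)" if "K \<in> Ts" for K
    using that cell(1)[of K] by (simp add: diameter_ge_0 compact_imp_bounded)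
  have nn_K: "0 \<le> ?g K + inverse (diameter K) * bdry_integral K (?j K)" if "K \<in> Ts" for K
    using nn_g nn_j[OF that] dia[OF that] by simp
  have sum0: "(\<Sum>K\<in>Ts. ?g K + inverse (diameter K) * bdry_integral K (?j K)) + (LINT x:\<Omega>d|lebesgue. (norm (w x))\<^sup>2)
      + interface_integral Ts ?I ?t \<le> 0"
    using zero by (simp add: norm_v_sq_def)
  moreover have nn_S: "0 \<le> (\<Sum>K\<in>Ts. ?g K + inverse (diameter K) * bdry_integral K (?j K))"
    by (intro sum_nonneg nn_K)
  ultimately have S0: "(\<Sum>K\<in>Ts. ?g K + inverse (diameter K) * bdry_integral K (?j K)) = 0"
    and D0: "(LINT x:\<Omega>d|lebesgue. (norm (w x))\<^sup>2) = 0" and I0: "interface_integral Ts ?I ?t = 0"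
    using nn_d nn_I by linarith+
  have K0: "?g K + inverse (diameter K) * bdry_integral K (?j K) = 0" if "K \<in> Ts" for K
    using S0 sum_nonneg_eq_0_iff[OF finite_Ts nn_K] that by simp
  have grad0: "grad w x = 0" if "K \<in> Ts" "x \<in> interior K" for K x
  proof -
    have "?g K = 0" using K0[OF that(1)] nn_g[of K] mult_nonneg_nonneg[OF dia[OF that(1)] nn_j[OF that(1)]] by linarith
    then have "(norm (grad w x))\<^sup>2 = 0"
      using that cell(1,2)[of K] by (intro cell_integral_zero_imp_zero[OF _ _ reg_g[OF that(1)]]) auto
    then show ?thesis by simp
  qed
  have jump0: "cell_trace K w x = wb x" if K: "K \<in> Ts" and F: "F \<in> cell_facets K" and x: "x \<in> rel_interior F" for K F x
  proof -
    have KT: "K \<in> Ts \<union> Td" using K by blast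
    have "inverse (diameter K) * bdry_integral K (?j K) = 0"
      using K0[OF K] nn_g[of K] mult_nonneg_nonneg[OF dia[OF K] nn_j[OF K]] by linarith
    \<comment> \<open>As \<open>inverse 0\<close> is 0, a zero diameter would erase the jump term;
      two distinct points of the cell exclude it.\<close>
    moreover have "diameter K > 0"
    proof -
      obtain y where y: "y \<in> interior K" using cell(3)[OF KT] by blast
      have "x \<in> F" using x rel_interior_subset by blast
      then have "x \<noteq> y" "x \<in> K" using cell_facet(2,8)[OF KT F] y by auto
      moreover have "dist x y \<le> diameter K"
        using diameter_bounded_bound[OF compact_imp_bounded[OF cell(1)[OF KT]] \<open>x \<in> K\<close>] y interior_subset by blast
      ultimately show ?thesis using zero_less_dist_iff[of x y] by linarith
    qed
    ultimately have "bdry_integral K (?j K) = 0" by simp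
    then have "facet_integral F (?j K (out_normal K F)) = 0"
      unfolding bdry_integral_def using sum_nonneg_eq_0_iff[OF cell(6)[OF KT] nn_f[OF K]] F by simp
    then have "(norm (cell_trace K w x - wb x))\<^sup>2 = 0"
      by (intro facet_integral_nonneg(2)[OF cell_facet(1)[OF KT F] reg_j[OF K F] _ _ x]) auto
    then show ?thesis by simp
  qed
  have tan0: "tangential (out_normal K F) (wb x) = 0"
    if K: "K \<in> Ts" and F: "F \<in> cell_facets K" "F \<in> ?I" and x: "x \<in> rel_interior F" for K F x
  proof -
    have KT: "K \<in> Ts \<union> Td" using K by blast
    have nn: "0 \<le> (\<Sum>F\<in>cell_facets K \<inter> ?I. facet_integral F (?t (out_normal K F)))" if "K \<in> Ts" for K
      by (intro sum_nonneg) (auto intro: nn_t[OF that])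
    have "(\<Sum>F\<in>cell_facets K \<inter> ?I. facet_integral F (?t (out_normal K F))) = 0"
      using I0 sum_nonneg_eq_0_iff[OF finite_Ts nn] K unfolding interface_integral_def by simp
    then have "facet_integral F (?t (out_normal K F)) = 0"
      using sum_nonneg_eq_0_iff[of "cell_facets K \<inter> ?I" "\<lambda>F. facet_integral F (?t (out_normal K F))"]
        cell(6)[OF KT] nn_t[OF K] F by simp
    then have "(norm (tangential (out_normal K F) (wb x)))\<^sup>2 = 0"
      by (intro facet_integral_nonneg(2)[OF cell_facet(1)[OF KT F(1)] reg_t[OF K F(1)] _ _ x]) auto
    then show ?thesis by simp
  qed
  have "\<exists>c. \<forall>x\<in>interior K. w x = c" if K: "K \<in> Ts" for K
  proof -
    have KT: "K \<in> Ts \<union> Td" using K by blast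
    have "(w has_derivative (\<lambda>h. 0)) (at x within interior K)" if "x \<in> interior K" for x
      using grad_has_derivative[OF Vh_differentiable[OF w KT that]] grad0[OF K that]
      by (simp add: has_derivative_at_withinI)
    then show ?thesis
      using has_derivative_zero_constant[OF convex_interior[OF cell(2)[OF KT]], of w] by blast
  qed
  then obtain c where c: "\<And>K x. K \<in> Ts \<Longrightarrow> x \<in> interior K \<Longrightarrow> w x = c K" by metis
  \<comment> \<open>Continuity of \<open>wb\<close> carries the cell constant from the open facet to
    its relative boundary. This matters where a facet touches \<open>\<Gamma>\<^sup>s\<close> in an
    edge or a vertex only.\<close>
  have wbc: "wb x = c K" if K: "K \<in> Ts" and F: "F \<in> cell_facets K" and x: "x \<in> F" for K F x
  proof -
    have KT: "K \<in> Ts \<union> Td" using K by blast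
    have cl: "closure (rel_interior F) = F" by (rule facet_closure_rel_interior[OF KT F])
    have "F \<subseteq> \<Union>(facets Ts)" using facets_of_cell[OF K F] by blast
    then have cont: "continuous_on (closure (rel_interior F)) wb"
      using wb continuous_on_subset unfolding cl Vbarh_def by blast
    have "wb y = c K" if "y \<in> rel_interior F" for y
    proof -
      have "cell_trace K w y = c K"
        by (rule cell_trace_eq[OF cells[OF KT] dim2 continuous_on_const c[OF K]]) (use facet_point[OF KT F that] in auto)
      then show ?thesis using jump0[OF K F that] by simp
    qed
    then show ?thesis using continuous_constant_on_closure[OF cont, of "c K" x] x cl by auto
  qed
  have "c K0 = 0" if K0: "K0 \<in> Ts" for K0
  proof (rule ccontr)
    assume ne: "c K0 \<noteq> 0"
    define W where "W = {K \<in> Ts. c K = c K0}"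
    show False
    proof (rule no_rigid_patch[OF ne])
      show "W \<subseteq> Ts" "W \<noteq> {}" using K0 by (auto simp: W_def)
      fix K assume KW: "K \<in> W"
      then have K: "K \<in> Ts" "c K = c K0" by (auto simp: W_def)
      have KT: "K \<in> Ts \<union> Td" using K by blast
      show "K' \<in> W" if K': "K' \<in> Ts" "K \<noteq> K'" "K \<inter> K' \<in> cell_facets K" "K \<inter> K' \<in> cell_facets K'" for K'
      proof -
        obtain x where "x \<in> K \<inter> K'" using cell_facet(5)[OF KT K'(3)] rel_interior_subset by blast
        then have "c K' = c K" using wbc[OF K(1) K'(3)] wbc[OF K'(1,4)] by simp
        then show ?thesis using K'(1) K by (simp add: W_def)
      qed
      show "\<exists>r. \<forall>x\<in>K \<inter> K'. c K0 \<bullet> x = r" if K': "K' \<in> Td" "K \<inter> K' \<in> cell_facets K" "K \<inter> K' \<in> cell_facets K'" for K'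
      proof -
        let ?n = "out_normal K (K \<inter> K')"
        have I: "K \<inter> K' \<in> ?I" using K' K by (auto simp: interface_facets_def facets_def)
        obtain y where y: "y \<in> rel_interior (K \<inter> K')" using cell_facet(5)[OF KT K'(2)] by blast
        then have yF: "y \<in> K \<inter> K'" using rel_interior_subset by blast
        have "tangential ?n (c K) = 0" using tan0[OF K(1) K'(2) I y] wbc[OF K(1) K'(2) yF] by simp
        \<comment> \<open>The constant velocity is normal to the interface facet, so its inner
          product with the points of the facet is constant.\<close>
        then have par: "c K0 = (c K0 \<bullet> ?n) *\<^sub>R ?n" using K by (simp add: tangential_def)
        have "c K0 \<bullet> x = (c K0 \<bullet> ?n) * (?n \<bullet> y)" if "x \<in> K \<inter> K'" for x
        proof -
          have "c K0 \<bullet> x = (c K0 \<bullet> ?n) * (?n \<bullet> x)" by (subst par) simp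
          then show ?thesis using cell_facet(7)[OF KT K'(2) that yF] by simp
        qed
        then show ?thesis by blast
      qed
      show "F \<inter> (frontier \<Omega> \<inter> frontier \<Omega>s) = {}" if F: "F \<in> cell_facets K" for F
      proof (rule ccontr)
        assume "F \<inter> (frontier \<Omega> \<inter> frontier \<Omega>s) \<noteq> {}"
        then obtain x where x: "x \<in> F" "x \<in> frontier \<Omega> \<inter> frontier \<Omega>s" by blast
        have "wb x = 0" using wb x(2) by (simp add: Vbarh_def)
        moreover have "wb x = c K" by (rule wbc[OF K(1) F x(1)])
        ultimately show False using ne K by simp
      qed
    qed
  qed
  then have ws: "w x = 0" if "K \<in> Ts" "x \<in> interior K" for K x using c that by simp
  \<comment> \<open>In the Darcy region the norm contains the velocity itself, so no constants are
    left over.\<close>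
  have wd: "w x = 0" if K: "K \<in> Td" "x \<in> interior K" for K x
  proof -
    have "(norm (w x))\<^sup>2 = 0"
    proof (rule set_integral_zero_imp_zero[where S = \<Omega>d and U = "interior K" and f = "\<lambda>x. (norm (w x))\<^sup>2"])
      show "set_integrable lebesgue \<Omega>d (\<lambda>x. (norm (w x))\<^sup>2)"
        unfolding power2_norm_eq_inner
        by (rule region_integrable[OF region_sets(3) region_cover(3)]) (auto intro!: regular_on_inner Vh_regular[OF w])
      have "\<exists>p\<in>Pk_vec k. \<forall>x\<in>interior K. w x = p x" using w K(1) unfolding Vh_def by blast
      then obtain p where p: "p \<in> Pk_vec k" "\<forall>x\<in>interior K. w x = p x" by blast
      have "continuous_on (interior K) w"
        using Pk_vec_continuous_on[OF p(1), of "interior K"] p(2) by (simp cong: continuous_on_cong)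
      then show "continuous_on (interior K) (\<lambda>x. (norm (w x))\<^sup>2)" by (intro continuous_intros)
    qed (use D0 K interior_Td in auto)
    then show ?thesis by simp
  qed
  show "w = 0"
  proof
    fix x
    show "w x = 0 x"
      using ws wd w by (cases "x \<in> (\<Union>K\<in>Ts \<union> Td. interior K)") (auto simp: Vh_def)
  qed
  show "wb = 0"
  proof
    fix x
    show "wb x = 0 x"
    proof (cases "x \<in> \<Union>(facets Ts)")
      case True
      then obtain K F where "K \<in> Ts" "F \<in> cell_facets K" "x \<in> F" by (auto simp: facets_def)
      then show ?thesis using wbc \<open>\<And>K0. K0 \<in> Ts \<Longrightarrow> c K0 = 0\<close> by simp
    next
      case False
      then show ?thesis using wb by (simp add: Vbarh_def)
    qed
  qed
qed

end

section \<open>Kernel of the divergence form on a cell\<close>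

context full_simplex
begin

text \<open>The test fields \<open>lam m x * \<phi> x\<close> in the direction \<open>m - l\<close> first show, with \<open>\<phi> = lam l x * D\<^sub>m\<^sub>-\<^sub>l P\<close>,
  that \<open>P\<close> is constant. What remains is that \<open>s l - P\<close> is orthogonal on the facet to all \<open>lam m x * \<phi> x\<close>,
  and these span the polynomials of degree \<open>k\<close> there since \<open>x = (\<Sum>m\<noteq>l. lam m x *\<^sub>R m)\<close>.\<close>

lemma pressure_constant:
  assumes k: "1 \<le> k" and P: "P \<in> Pk (k - 1)" and s: "\<And>l. l \<in> C \<Longrightarrow> s l \<in> Pk k"
    and main: "\<And>l m \<phi> D. l \<in> C \<Longrightarrow> m \<in> C \<Longrightarrow> l \<noteq> m \<Longrightarrow> \<phi> \<in> Pk (k - 1) \<Longrightarrow> \<forall>x. (\<phi> has_derivative D x) (at x) \<Longrightarrow>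
      (LINT x:K|lebesgue. P x * (\<phi> x + lam m x * D x (m - l))) =
      (nrm l \<bullet> (m - l)) * facet_integral (fac l) (\<lambda>x. s l x * (lam m x * \<phi> x))"
  shows "\<exists>c. (\<forall>x\<in>interior K. P x = c) \<and> (\<forall>l\<in>C. \<forall>x\<in>rel_interior (fac l). s l x = c)"
proof -
  obtain E where E: "\<forall>x. (P has_derivative E x) (at x)" "\<forall>t. (\<lambda>x. E x t) \<in> Pk (k - 1 - 1)"
      "k - 1 = 0 \<longrightarrow> E = (\<lambda>x t. 0)"
    using P by (rule Pk_has_derivative)
  have contE: "continuous_on UNIV (\<lambda>x. E x t)" for t using E(2) Pk_continuous_on by blast
  have contP: "continuous_on UNIV P" by (rule Pk_continuous_on[OF P])
  have facet: "is_facet (fac l)" if "l \<in> C" for l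
    unfolding is_facet_def using that full_simplex_axioms by blast
  have reg: "regular_on A f" if "continuous_on UNIV f" for A and f :: "real^'n \<Rightarrow> real"
    by (rule regular_onI[OF that]) simp
  have cell_int: "set_integrable lebesgue K f" if "continuous_on UNIV f" for f :: "real^'n \<Rightarrow> real"
    by (rule set_integral_compact(2)[OF compact_K continuous_on_subset[OF that]]) simp
  have H: "nrm l \<bullet> (m - l) \<noteq> 0" if "l \<in> C" "m \<in> C" "l \<noteq> m" for l m
    using nrm_inner_edge[OF that(1,2,1)] lam_vertex that a_nonzero[OF that(1)] by simp
  \<comment> \<open>The divergence theorem for the product of \<open>\<phi>\<close> and
    \<open>P\<close>, minus \<open>main\<close>: the terms with the derivative of
    \<open>\<phi>\<close> cancel.\<close>
  have by_parts: "(LINT x:K|lebesgue. lam m x * \<phi> x * E x (m - l)) =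
      - (nrm l \<bullet> (m - l)) * facet_integral (fac l) (\<lambda>x. (s l x - P x) * (lam m x * \<phi> x))"
    if lm: "l \<in> C" "m \<in> C" "l \<noteq> m" and \<phi>: "\<phi> \<in> Pk (k - 1)" for l m \<phi>
  proof -
    obtain D where D: "\<forall>x. (\<phi> has_derivative D x) (at x)" "\<forall>t. (\<lambda>x. D x t) \<in> Pk (k - 1 - 1)"
        "k - 1 = 0 \<longrightarrow> D = (\<lambda>x t. 0)"
      using \<phi> by (rule Pk_has_derivative)
    have contD: "continuous_on UNIV (\<lambda>x. D x t)" for t using D(2) Pk_continuous_on by blast
    have cont\<phi>: "continuous_on UNIV \<phi>" by (rule Pk_continuous_on[OF \<phi>])
    note conts = continuous_lam contD contE contP cont\<phi>
    have "((\<lambda>x. \<phi> x * P x) has_derivative (\<lambda>t. \<phi> x * E x t + D x t * P x)) (at x)" for x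
      using D(1) E(1) by (intro has_derivative_mult) auto
    then have "(LINT x:K|lebesgue. \<phi> x * P x + lam m x * (\<phi> x * E x (m - l) + D x (m - l) * P x)) =
        (nrm l \<bullet> (m - l)) * facet_integral (fac l) (\<lambda>x. lam m x * (\<phi> x * P x))"
      by (rule divergence_theorem_edge[OF lm]) (intro continuous_intros conts)
    moreover have "(\<lambda>x. \<phi> x * P x + lam m x * (\<phi> x * E x (m - l) + D x (m - l) * P x))
        = (\<lambda>x. lam m x * \<phi> x * E x (m - l) + P x * (\<phi> x + lam m x * D x (m - l)))"
      by (auto simp: algebra_simps)
    moreover have "(LINT x:K|lebesgue. lam m x * \<phi> x * E x (m - l) + P x * (\<phi> x + lam m x * D x (m - l)))
        = (LINT x:K|lebesgue. lam m x * \<phi> x * E x (m - l)) + (LINT x:K|lebesgue. P x * (\<phi> x + lam m x * D x (m - l)))"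
      by (intro set_integral_add cell_int continuous_intros conts)
    ultimately have e1: "(LINT x:K|lebesgue. lam m x * \<phi> x * E x (m - l)) =
        (nrm l \<bullet> (m - l)) * facet_integral (fac l) (\<lambda>x. lam m x * (\<phi> x * P x))
        - (nrm l \<bullet> (m - l)) * facet_integral (fac l) (\<lambda>x. s l x * (lam m x * \<phi> x))"
      using main[OF lm \<phi> D(1)] by simp
    have e2: "facet_integral (fac l) (\<lambda>x. (s l x - P x) * (lam m x * \<phi> x)) =
        facet_integral (fac l) (\<lambda>x. s l x * (lam m x * \<phi> x)) - facet_integral (fac l) (\<lambda>x. P x * (lam m x * \<phi> x))"
      unfolding left_diff_distrib
      by (intro facet_integral_diff facet lm reg continuous_intros conts Pk_continuous_on[OF s[OF lm(1)]])
    have e3: "(\<lambda>x. lam m x * (\<phi> x * P x)) = (\<lambda>x. P x * (lam m x * \<phi> x))" by auto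
    show ?thesis unfolding e1 e2 e3 by (simp only: right_diff_distrib mult_minus_left minus_diff_eq)
  qed
  have E_edge: "E x (m - l) = 0" if lm: "l \<in> C" "m \<in> C" "l \<noteq> m" and x: "x \<in> interior K" for l m x
  proof (cases "k - 1 = 0")
    \<comment> \<open>Here \<open>P\<close> is constant, and the test function of the other case
      would exceed the degree \<open>k - 1\<close>.\<close>
    case True
    then show ?thesis using E(3) by simp
  next
    case False
    \<comment> \<open>The factor \<open>lam l\<close> removes the facet term and leaves a square
      with a positive weight in the volume. The degree is still \<open>k - 1\<close> because a
      derivative of \<open>P\<close> has degree one less.\<close>
    define \<phi> where "\<phi> = (\<lambda>x. lam l x * E x (m - l))"
    have "\<phi> \<in> Pk (Suc (k - 1 - 1))" unfolding \<phi>_def lam_def using E(2) by (intro Pk_affine_mult) auto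
    moreover have "Suc (k - 1 - 1) = k - 1" using False by arith
    ultimately have \<phi>: "\<phi> \<in> Pk (k - 1)" by simp
    have "facet_integral (fac l) (\<lambda>x. (s l x - P x) * (lam m x * \<phi> x)) = facet_integral (fac l) (\<lambda>x. 0)"
      by (rule facet_integral_cong[OF facet[OF lm(1)]]) (auto simp: \<phi>_def rel_interior_fac[OF lm(1)])
    then have z: "(LINT x:K|lebesgue. lam m x * \<phi> x * E x (m - l)) = 0"
      unfolding by_parts[OF lm \<phi>] by simp
    have "lam m x * \<phi> x * E x (m - l) = 0"
    proof (rule cell_integral_zero_imp_zero[OF compact_K convex_convex_hull _ _ z x])
      show "regular_on (interior K) (\<lambda>x. lam m x * \<phi> x * E x (m - l))"
        unfolding \<phi>_def by (intro reg continuous_intros contE)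
      show "0 \<le> lam m y * \<phi> y * E y (m - l)" if "y \<in> interior K" for y
      proof -
        have "lam m y * \<phi> y * E y (m - l) = (lam m y * lam l y) * (E y (m - l))\<^sup>2"
          by (simp add: \<phi>_def power2_eq_square)
        moreover have "0 \<le> (lam m y * lam l y) * (E y (m - l))\<^sup>2"
          using that lm unfolding interior_K by (simp add: less_imp_le)
        ultimately show ?thesis by (simp only:)
      qed
    qed
    then show ?thesis using x lm unfolding interior_K \<phi>_def by auto
  qed
  have E0: "E x h = 0" if x: "x \<in> interior K" for x h
  proof -
    obtain l where l: "l \<in> C" using C_other by blast
    have lin: "linear (E x)" using E(1) has_derivative_linear by blast
    \<comment> \<open>The changes of the barycentric coordinates sum to zero, so every direction is
      a combination of the edges issuing from one vertex \<open>l\<close>.\<close>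
    have "h = (\<Sum>m\<in>C. lam m (x + h) *\<^sub>R m) - (\<Sum>m\<in>C. lam m x *\<^sub>R m) - ((\<Sum>m\<in>C. lam m (x + h)) - (\<Sum>m\<in>C. lam m x)) *\<^sub>R l"
      unfolding combination_lam sum_lam by simp
    also have "\<dots> = (\<Sum>m\<in>C. (lam m (x + h) - lam m x) *\<^sub>R (m - l))"
      by (simp add: sum_subtractf[symmetric] scaleR_sum_left algebra_simps sum.distrib)
    finally have "E x h = E x (\<Sum>m\<in>C. (lam m (x + h) - lam m x) *\<^sub>R (m - l))" by simp
    also have "\<dots> = (\<Sum>m\<in>C. (lam m (x + h) - lam m x) * E x (m - l))"
      by (simp add: linear_sum[OF lin] linear_scale[OF lin])
    also have "\<dots> = 0"
    proof (rule sum.neutral, rule ballI)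
      fix m assume m: "m \<in> C"
      show "(lam m (x + h) - lam m x) * E x (m - l) = 0"
        using E_edge[OF l m _ x] linear_0[OF lin] by (cases "l = m") auto
    qed
    finally show ?thesis .
  qed
  have "(P has_derivative (\<lambda>h. 0)) (at x within interior K)" if "x \<in> interior K" for x
  proof -
    have "E x = (\<lambda>h. 0)" using E0[OF that] by auto
    then show ?thesis using E(1) by (metis has_derivative_at_withinI)
  qed
  then obtain c where c: "\<And>x. x \<in> interior K \<Longrightarrow> P x = c"
    using has_derivative_zero_constant[OF convex_interior[OF convex_convex_hull], of C P] by blast
  have "continuous_on (closure (interior K)) P" by (rule continuous_on_subset[OF contP]) simp
  then have cK: "P x = c" if "x \<in> K" for x
    by (rule continuous_constant_on_closure[OF _ c]) (use that closure_interior_K in auto)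
  have "s l x = c" if l: "l \<in> C" and x: "x \<in> rel_interior (fac l)" for l x
  proof -
    have facK: "y \<in> K" if "y \<in> rel_interior (fac l)" for y
      using that rel_interior_subset mem_fac[OF l] by blast
    define R where "R = (\<lambda>x. s l x - c)"
    have R: "R \<in> Pk k" unfolding R_def by (intro Pk_diff s l Pk_const)
    have contR: "continuous_on UNIV R" by (rule Pk_continuous_on[OF R])
    have ortho1: "facet_integral (fac l) (\<lambda>x. R x * (lam m x * \<phi> x)) = 0"
      if m: "m \<in> C - {l}" and \<phi>: "\<phi> \<in> Pk (k - 1)" for m \<phi>
    proof -
      have lm: "l \<in> C" "m \<in> C" "l \<noteq> m" using l m by auto
      have "(LINT x:K|lebesgue. lam m x * \<phi> x * E x (m - l)) = (LINT x:K|lebesgue. 0)"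
        by (rule cell_integral_cong[OF compact_K convex_convex_hull]) (auto simp: E0)
      then have "(nrm l \<bullet> (m - l)) * facet_integral (fac l) (\<lambda>x. (s l x - P x) * (lam m x * \<phi> x)) = 0"
        unfolding by_parts[OF lm \<phi>] by (simp add: set_lebesgue_integral_def)
      then have "facet_integral (fac l) (\<lambda>x. (s l x - P x) * (lam m x * \<phi> x)) = 0" using H[OF lm] by simp
      moreover have "facet_integral (fac l) (\<lambda>x. R x * (lam m x * \<phi> x)) = facet_integral (fac l) (\<lambda>x. (s l x - P x) * (lam m x * \<phi> x))"
      proof (rule facet_integral_cong[OF facet[OF l]])
        show "regular_on (rel_interior (fac l)) (\<lambda>x. (s l x - P x) * (lam m x * \<phi> x))"
          by (intro reg continuous_intros contP Pk_continuous_on[OF s[OF l]] Pk_continuous_on[OF \<phi>])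
      qed (use cK facK in \<open>auto simp: R_def\<close>)
      ultimately show ?thesis by simp
    qed
    have ortho: "facet_integral (fac l) (\<lambda>x. R x * M x) = 0" if "M \<in> Pk k" for M
      using that
    proof -
      have "M \<in> Pk k \<and> facet_integral (fac l) (\<lambda>x. R x * M x) = 0"
        using \<open>M \<in> Pk k\<close>
      proof (induction rule: Pk_induct)
        case zero
        then show ?case by (simp add: Pk_zero)
      next
        case (add p q)
        then have "facet_integral (fac l) (\<lambda>x. R x * p x + R x * q x) =
            facet_integral (fac l) (\<lambda>x. R x * p x) + facet_integral (fac l) (\<lambda>x. R x * q x)"
          by (intro facet_integral_add facet l reg continuous_intros contR) (auto intro: Pk_continuous_on)
        then show ?case using add by (simp add: distrib_left Pk_add)
      next
        case (scale c p)
        then show ?case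
          using facet_integral_scale[of "fac l" c "\<lambda>x. R x * p x"] by (simp add: mult.left_commute Pk_scale)
      next
        case (mono e)
        \<comment> \<open>On the facet 1 is the sum of the \<open>lam m x\<close>, and
          \<open>x $ i\<close> is the sum of the \<open>lam m x * m $ i\<close>. So every monomial
          splits into terms with a factor \<open>lam m x\<close> and a cofactor of degree at most
          \<open>k - 1\<close>.\<close>
        obtain \<phi> where \<phi>: "\<And>m. \<phi> m \<in> Pk (k - 1)"
            "\<And>x. x \<in> rel_interior (fac l) \<Longrightarrow> mono_fun e x = (\<Sum>m\<in>C - {l}. lam m x * \<phi> m x)"
        proof (cases rule: mono_fun_cases[of e])
          case 1
          have "mono_fun e x = (\<Sum>m\<in>C - {l}. lam m x * 1)" if "x \<in> rel_interior (fac l)" for x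
            using that combination_minus(1)[OF l, of x] 1(2) unfolding rel_interior_fac[OF l] by simp
          then show ?thesis using that[of "\<lambda>m x. 1"] Pk_const by blast
        next
          case (2 i e')
          have "mono_fun e x = (\<Sum>m\<in>C - {l}. lam m x * (m $ i * mono_fun e' x))" if "x \<in> rel_interior (fac l)" for x
          proof -
            have "x $ i = (\<Sum>m\<in>C - {l}. lam m x *\<^sub>R m) $ i"
              using that combination_minus(2)[OF l, of x] unfolding rel_interior_fac[OF l] by simp
            then have "x $ i = (\<Sum>m\<in>C - {l}. lam m x * m $ i)" by simp
            then show ?thesis unfolding 2(2)[of x] by (simp add: sum_distrib_right mult.assoc)
          qed
          moreover have "(\<lambda>x. m $ i * mono_fun e' x) \<in> Pk (k - 1)" for m
            using 2(1) mono by (intro Pk_scale mono_fun_in_Pk) simp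
          ultimately show ?thesis using that[of "\<lambda>m x. m $ i * mono_fun e' x"] by blast
        qed
        have cont: "continuous_on UNIV (\<lambda>x. R x * (lam m x * \<phi> m x))" for m
          by (intro continuous_intros contR Pk_continuous_on[OF \<phi>(1)])
        have "facet_integral (fac l) (\<lambda>x. R x * mono_fun e x) = facet_integral (fac l) (\<lambda>x. \<Sum>m\<in>C - {l}. R x * (lam m x * \<phi> m x))"
        proof (rule facet_integral_cong[OF facet[OF l]])
          show "regular_on (rel_interior (fac l)) (\<lambda>x. \<Sum>m\<in>C - {l}. R x * (lam m x * \<phi> m x))"
            by (intro regular_on_sum reg cont)
        qed (simp add: \<phi>(2) sum_distrib_left)
        also have "\<dots> = (\<Sum>m\<in>C - {l}. facet_integral (fac l) (\<lambda>x. R x * (lam m x * \<phi> m x)))"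
          by (intro facet_integral_sum facet l reg cont)
        also have "\<dots> = 0" using ortho1 \<phi>(1) by simp
        finally show ?case using mono mono_fun_in_Pk by blast
      qed
      then show ?thesis by blast
    qed
    \<comment> \<open>\<open>R\<close> has degree \<open>k\<close>, so it may be tested with
      itself.\<close>
    have "R x * R x = 0"
      by (rule facet_integral_nonneg(2)[OF facet[OF l] _ _ ortho[OF R] x]) (auto intro!: reg continuous_intros contR)
    then show ?thesis by (simp add: R_def)
  qed
  then show ?thesis using c by (intro exI[of _ c] conjI ballI) simp_all
qed

end

text \<open>The test fields have a fixed direction \<open>t\<close>; for these the trace of the
  gradient is the derivative along \<open>t\<close>.\<close>

lemma divergence_direction:
  fixes f :: "real^'n \<Rightarrow> real"
  assumes "(f has_derivative f') (at x)"
  shows "divergence (\<lambda>x. f x *\<^sub>R t) x = f' t"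
proof -
  have lin: "linear f'" using assms has_derivative_linear by blast
  have exp: "f' h = (\<Sum>j\<in>UNIV. f' (axis j 1) * h $ j)" for h :: "real^'n"
  proof -
    have "f' h = f' (\<Sum>j\<in>UNIV. h $ j *\<^sub>R axis j 1)" using basis_expansion[of h] by (simp add: scalar_mult_eq_scaleR)
    then show ?thesis by (simp add: linear_sum[OF lin] linear_scale[OF lin] mult.commute)
  qed
  have "grad (\<lambda>x. f x *\<^sub>R t) x = (\<chi> i j. t $ i * f' (axis j 1))"
  proof (rule grad_eqI)
    have "(\<chi> i j. t $ i * f' (axis j 1)) *v h = f' h *\<^sub>R t" for h
      unfolding matrix_vector_mult_def by (simp add: vec_eq_iff exp[of h] sum_distrib_left sum_distrib_right mult_ac)
    then show "((\<lambda>x. f x *\<^sub>R t) has_derivative (\<lambda>h. (\<chi> i j. t $ i * f' (axis j 1)) *v h)) (at x)"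
      using has_derivative_scaleR_left[OF assms, of t] by simp
  qed
  then show ?thesis using exp[of t] by (simp add: divergence_def trace_def mult.commute)
qed

lemma divergence_transform:
  assumes "\<And>y. y \<in> interior K \<Longrightarrow> v y = w y" "x \<in> interior K" "w differentiable (at x)"
  shows "divergence v x = divergence w x"
proof -
  have "(v has_derivative (\<lambda>h. grad w x *v h)) (at x)"
    by (rule has_derivative_transform_within_open[OF grad_has_derivative[OF assms(3)] open_interior assms(2)])
      (use assms(1) in auto)
  then show ?thesis by (simp add: divergence_def grad_eqI)
qed

context stokes_darcy
begin

section \<open>Pressures annihilated by all velocities\<close>

text \<open>A velocity supported in one open cell has zero divergence inside every other cell and
  zero trace from there, so the cells decouple.\<close>

lemma b_h_local:
  assumes T0: "T0 \<subseteq> Ts \<union> Td" and K: "K \<in> Ts \<union> Td" and v: "\<And>x. x \<notin> interior K \<Longrightarrow> v x = 0"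
  shows "b_h T0 q qb v = (if K \<in> T0 then - (LINT x:K|lebesgue. q x * divergence v x)
      + bdry_integral K (\<lambda>n x. qb x * (cell_trace K v x \<bullet> n)) else 0)"
proof -
  have other: "(LINT x:K'|lebesgue. q x * divergence v x) = 0"
      "bdry_integral K' (\<lambda>n x. qb x * (cell_trace K' v x \<bullet> n)) = 0" if "K' \<in> T0" "K' \<noteq> K" for K'
  proof -
    have K': "K' \<in> Ts \<union> Td" using that T0 by blast
    have v0: "v x = 0" if "x \<in> interior K'" for x
      using v interior_eq[OF K' K that] \<open>K' \<noteq> K\<close> by blast
    have "divergence v x = 0" if x: "x \<in> interior K'" for x
    proof -
      have "divergence v x = divergence (\<lambda>x. 0 *\<^sub>R 0) x"
        by (rule divergence_transform[OF _ x]) (auto simp: v0)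
      also have "\<dots> = 0" by (rule divergence_direction[where f' = "\<lambda>h. 0"]) simp
      finally show ?thesis .
    qed
    then have "(LINT x:K'|lebesgue. q x * divergence v x) = (LINT x:K'|lebesgue. 0)"
      by (intro cell_integral_cong cell(1,2)[OF K']) auto
    then show "(LINT x:K'|lebesgue. q x * divergence v x) = 0" by (simp add: set_lebesgue_integral_def)
    have "facet_integral F (\<lambda>x. qb x * (cell_trace K' v x \<bullet> n)) = facet_integral F (\<lambda>x. 0)" if F: "F \<in> cell_facets K'" for F n
    proof (rule facet_integral_cong[OF cell_facet(1)[OF K' F]])
      fix x assume "x \<in> rel_interior F"
      then have "cell_trace K' v x = 0"
        by (intro cell_trace_eq[OF cells[OF K'] dim2 continuous_on_const v0] facet_point[OF K' F])
      then show "qb x * (cell_trace K' v x \<bullet> n) = 0" by simp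
    qed auto
    then show "bdry_integral K' (\<lambda>n x. qb x * (cell_trace K' v x \<bullet> n)) = 0" by (simp add: bdry_integral_def)
  qed
  have fin: "finite T0" using T0 finite_T finite_subset by blast
  show ?thesis
  proof (cases "K \<in> T0")
    case True
    have "(\<Sum>K'\<in>T0 - {K}. LINT x:K'|lebesgue. q x * divergence v x) = 0"
      "(\<Sum>K'\<in>T0 - {K}. bdry_integral K' (\<lambda>n x. qb x * (cell_trace K' v x \<bullet> n))) = 0"
      using other by (auto intro!: sum.neutral)
    then show ?thesis using True unfolding b_h_def sum.remove[OF fin True] by simp
  next
    case False
    then have "(\<Sum>K'\<in>T0. LINT x:K'|lebesgue. q x * divergence v x) = 0"
      "(\<Sum>K'\<in>T0. bdry_integral K' (\<lambda>n x. qb x * (cell_trace K' v x \<bullet> n))) = 0"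
      using other by (auto intro!: sum.neutral)
    then show ?thesis using False unfolding b_h_def by simp
  qed
qed

lemma b_I_zero: "b_I T0 I pb 0 = 0"
  by (simp add: b_I_def interface_integral_def)

lemma b_h_zero:
  assumes "T0 \<subseteq> Ts \<union> Td"
  shows "b_h T0 q qb 0 = 0"
proof (cases "T0 = {}")
  case False
  then obtain K where "K \<in> T0" by blast
  then have K: "K \<in> Ts \<union> Td" using assms by blast
  have "divergence 0 x = 0" for x :: "real^'n" by (simp add: divergence_def grad_zero trace_def)
  moreover have "facet_integral F (\<lambda>x. qb x * (cell_trace K 0 x \<bullet> n)) = 0" if "K \<in> T0" "F \<in> cell_facets K" for K F and n :: "real^'n"
  proof -
    have K: "K \<in> Ts \<union> Td" using that assms by blast
    have "facet_integral F (\<lambda>x. qb x * (cell_trace K 0 x \<bullet> n)) = facet_integral F (\<lambda>x. 0)"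
    proof (rule facet_integral_cong[OF cell_facet(1)[OF K that(2)]])
      fix x assume "x \<in> rel_interior F"
      then have "cell_trace K 0 x = (0 :: real^'n)"
        by (intro cell_trace_eq[OF cells[OF K] dim2 continuous_on_const] facet_point[OF K that(2)]) auto
      then show "qb x * (cell_trace K 0 x \<bullet> n) = 0" by simp
    qed auto
    then show ?thesis by simp
  qed
  ultimately show ?thesis by (simp add: b_h_def bdry_integral_def set_lebesgue_integral_def)
qed (simp add: b_h_def)

lemma pressure_cell:
  assumes k: "1 \<le> k" and q: "(p, ps, pd) \<in> QQ k" and zero: "\<And>v. v \<in> VV k \<Longrightarrow> b_total Ts Td (p, ps, pd) v = 0"
    and T0: "(T0 = Ts \<and> pb = ps) \<or> (T0 = Td \<and> pb = pd)" and KT0: "K \<in> T0"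
  shows "\<exists>c. (\<forall>x\<in>interior K. p x = c) \<and> (\<forall>F\<in>cell_facets K. \<forall>x\<in>rel_interior F. pb x = c)"
proof -
  have K: "K \<in> Ts \<union> Td" using T0 KT0 by blast
  have pQ: "p \<in> Qh k \<Omega> (Ts \<union> Td)" and pbQ: "pb \<in> Qbarh k T0" using q T0 by (auto simp: QQ_def)
  obtain C a b where simp: "full_simplex C a b" and Keq: "K = convex hull C"
    using full_simplex_exists[OF cells[OF K] dim2] .
  interpret S: full_simplex C a b by (rule simp)
  have facets: "S.fac l \<in> cell_facets K" if "l \<in> C" for l unfolding Keq S.cell_facets_K using that by blast
  have "\<exists>P\<in>Pk (k - 1). \<forall>x\<in>interior K. p x = P x" using pQ K unfolding Qh_def by blast
  then obtain P where P: "P \<in> Pk (k - 1)" "\<And>x. x \<in> interior K \<Longrightarrow> p x = P x" by blast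
  have "\<exists>s\<in>Pk k. \<forall>x\<in>rel_interior (S.fac l). pb x = s x" if "l \<in> C" for l
    using pbQ facets_of_cell[OF KT0 facets[OF that]] unfolding Qbarh_def by blast
  then obtain s where s: "\<And>l. l \<in> C \<Longrightarrow> s l \<in> Pk k" "\<And>l x. l \<in> C \<Longrightarrow> x \<in> rel_interior (S.fac l) \<Longrightarrow> pb x = s l x"
    by metis
  have "\<exists>c. (\<forall>x\<in>interior S.K. P x = c) \<and> (\<forall>l\<in>C. \<forall>x\<in>rel_interior (S.fac l). s l x = c)"
  proof (rule S.pressure_constant[OF k P(1) s(1)])
    fix l m :: "real^'n" and \<phi> :: "real^'n \<Rightarrow> real" and D :: "real^'n \<Rightarrow> real^'n \<Rightarrow> real"
    assume lm: "l \<in> C" "m \<in> C" "l \<noteq> m" and \<phi>: "\<phi> \<in> Pk (k - 1)" and D: "\<forall>x. (\<phi> has_derivative D x) (at x)"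
    define t where "t = m - l"
    define f where "f = (\<lambda>x. S.lam m x * \<phi> x)"
    \<comment> \<open>\<open>Vh\<close> requires no continuity across facets, so the field may be
      cut off at the boundary of the cell; its trace from inside is still
      \<open>f x *\<^sub>R t\<close>.\<close>
    define v where "v = (\<lambda>x. if x \<in> interior K then f x *\<^sub>R t else 0)"
    have fPk: "f \<in> Pk k"
      using Pk_affine_mult[OF \<phi>, of "a m" "b m"] k unfolding f_def S.lam_def by simp
    have contf: "continuous_on UNIV f" by (rule Pk_continuous_on[OF fPk])
    have vV: "v \<in> Vh k (Ts \<union> Td)"
      unfolding Vh_def
    proof (intro CollectI conjI ballI allI impI)
      fix K' assume K': "K' \<in> Ts \<union> Td"
      show "\<exists>p\<in>Pk_vec k. \<forall>x\<in>interior K'. v x = p x"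
      proof (cases "K' = K")
        case True
        then show ?thesis using Pk_vec_scaleR[OF fPk, of t]
          by (intro bexI[of _ "\<lambda>x. f x *\<^sub>R t"]) (auto simp: v_def)
      next
        case False
        then show ?thesis using subspace_0[OF subspace_Pk_vec[of k]] interior_eq[OF K' K]
          by (intro bexI[of _ 0]) (auto simp: v_def)
      qed
    next
      fix x assume "x \<notin> (\<Union>K\<in>Ts \<union> Td. interior K)"
      then show "v x = 0" using K by (auto simp: v_def)
    qed
    have v0: "v x = 0" if "x \<notin> interior K" for x using that by (simp add: v_def)
    have "(v, 0) \<in> VV k" using vV subspace_0[OF subspace_Vbarh] by (simp add: VV_def)
    then have "b_h Ts p ps v + b_h Td p pd v = 0"
      using zero[of "(v, 0)"] by (simp add: b_total_def b_I_zero)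
    then have "- (LINT x:K|lebesgue. p x * divergence v x) + bdry_integral K (\<lambda>n x. pb x * (cell_trace K v x \<bullet> n)) = 0"
      using T0 KT0 meshes_disjoint b_h_local[where q = p and qb = ps, OF Un_upper1 K v0] b_h_local[where q = p and qb = pd, OF Un_upper2 K v0]
      by (auto split: if_splits)
    then have eq: "(LINT x:K|lebesgue. p x * divergence v x) = bdry_integral K (\<lambda>n x. pb x * (cell_trace K v x \<bullet> n))"
      by simp
    obtain D' where D': "\<forall>x. (\<phi> has_derivative D' x) (at x)" "\<forall>t. (\<lambda>x. D' x t) \<in> Pk (k - 1 - 1)"
        "k - 1 = 0 \<longrightarrow> D' = (\<lambda>x t. 0)"
      using \<phi> by (rule Pk_has_derivative)
    \<comment> \<open>Uniqueness of the derivative identifies the given \<open>D\<close> with the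
      polynomial one and so makes it continuous in \<open>x\<close>.\<close>
    have "D = D'" using D D'(1) has_derivative_unique by blast
    then have contD: "continuous_on UNIV (\<lambda>x. D x t)" using D'(2) Pk_continuous_on by blast
    have edge: "a m \<bullet> t = 1"
      using S.lam_vertex[OF lm(2,2)] S.lam_vertex[OF lm(2,1)] lm(3) by (simp add: t_def S.lam_def inner_diff_right)
    have div: "divergence v x = \<phi> x + S.lam m x * D x t" if x: "x \<in> interior K" for x
    proof -
      have "(S.lam m has_derivative (\<lambda>h. a m \<bullet> h)) (at x)"
        unfolding S.lam_def by (auto intro!: derivative_eq_intros)
      then have d: "(f has_derivative (\<lambda>h. S.lam m x * D x h + (a m \<bullet> h) * \<phi> x)) (at x)"
        unfolding f_def using D by (intro has_derivative_mult) auto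
      have "divergence v x = divergence (\<lambda>x. f x *\<^sub>R t) x"
        by (rule divergence_transform[OF _ x])
          (use has_derivative_scaleR_left[OF d, of t] in \<open>auto simp: v_def differentiable_def\<close>)
      then show ?thesis using divergence_direction[OF d, of t] edge by simp
    qed
    have "(LINT x:K|lebesgue. p x * divergence v x) = (LINT x:K|lebesgue. P x * (\<phi> x + S.lam m x * D x t))"
    proof (rule cell_integral_cong[OF cell(1,2)[OF K]])
      have "continuous_on UNIV (\<lambda>x. P x * (\<phi> x + S.lam m x * D x t))"
        by (intro continuous_intros S.continuous_lam contD Pk_continuous_on[OF P(1)] Pk_continuous_on[OF \<phi>])
      then show "regular_on (interior K) (\<lambda>x. P x * (\<phi> x + S.lam m x * D x t))" by (rule regular_onI) simp
    qed (simp add: P(2) div)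
    moreover have "bdry_integral K (\<lambda>n x. pb x * (cell_trace K v x \<bullet> n))
        = (S.nrm l \<bullet> t) * facet_integral (S.fac l) (\<lambda>x. s l x * f x)"
    proof -
      \<comment> \<open>\<open>f\<close> vanishes on the facet opposite \<open>m\<close>, and
        \<open>t\<close> is tangent to every facet containing both \<open>l\<close> and
        \<open>m\<close>; only the facet opposite \<open>l\<close> remains.\<close>
      have piece: "facet_integral (S.fac i) (\<lambda>x. pb x * (cell_trace K v x \<bullet> out_normal K (S.fac i)))
          = (if i = l then (S.nrm l \<bullet> t) * facet_integral (S.fac l) (\<lambda>x. s l x * f x) else 0)" if i: "i \<in> C" for i
      proof -
        have n: "out_normal K (S.fac i) = S.nrm i" unfolding Keq by (rule S.out_normal_fac[OF i])
        have fi: "is_facet (S.fac i)" by (rule cell_facet(1)[OF K facets[OF i]])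
        have tr: "cell_trace K v x = f x *\<^sub>R t" if "x \<in> rel_interior (S.fac i)" for x
          by (rule cell_trace_eq[OF cells[OF K] dim2 _ _ facet_point[OF K facets[OF i] that]])
            (use contf in \<open>auto simp: v_def intro!: continuous_intros\<close>)
        have reg: "regular_on (rel_interior (S.fac i)) (\<lambda>x. (S.nrm i \<bullet> t) * (s i x * f x))"
          by (rule regular_onI[of "\<lambda>x. (S.nrm i \<bullet> t) * (s i x * f x)"])
            (intro continuous_intros contf Pk_continuous_on[OF s(1)[OF i]], simp)
        have "facet_integral (S.fac i) (\<lambda>x. pb x * (cell_trace K v x \<bullet> out_normal K (S.fac i)))
            = facet_integral (S.fac i) (\<lambda>x. (S.nrm i \<bullet> t) * (s i x * f x))"
          by (rule facet_integral_cong[OF fi reg]) (simp add: n tr s(2)[OF i] inner_commute)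
        also have "\<dots> = (S.nrm i \<bullet> t) * facet_integral (S.fac i) (\<lambda>x. s i x * f x)"
          by (rule facet_integral_scale)
        also have "\<dots> = (if i = l then (S.nrm l \<bullet> t) * facet_integral (S.fac l) (\<lambda>x. s l x * f x) else 0)"
        proof (cases "i = m")
          case True
          have "facet_integral (S.fac i) (\<lambda>x. s i x * f x) = facet_integral (S.fac i) (\<lambda>x. 0)"
            by (rule facet_integral_cong[OF fi]) (auto simp: f_def True S.rel_interior_fac[OF lm(2)])
          then show ?thesis using True lm(3) by simp
        next
          case False
          then show ?thesis
            using S.nrm_inner_edge[OF lm(1,2) i] S.lam_vertex[OF i lm(1)] S.lam_vertex[OF i lm(2)]
            by (auto simp: t_def)
        qed
        finally show ?thesis .
      qed
      have "bdry_integral K (\<lambda>n x. pb x * (cell_trace K v x \<bullet> n))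
          = (\<Sum>i\<in>C. facet_integral (S.fac i) (\<lambda>x. pb x * (cell_trace K v x \<bullet> out_normal K (S.fac i))))"
        unfolding bdry_integral_def Keq S.cell_facets_K by (simp add: sum.reindex[OF S.inj_fac])
      also have "\<dots> = (\<Sum>i\<in>C. if i = l then (S.nrm l \<bullet> t) * facet_integral (S.fac l) (\<lambda>x. s l x * f x) else 0)"
        by (rule sum.cong[OF refl piece])
      also have "\<dots> = (S.nrm l \<bullet> t) * facet_integral (S.fac l) (\<lambda>x. s l x * f x)"
        using S.finite_C lm(1) by simp
      finally show ?thesis .
    qed
    ultimately show "(LINT x:S.K|lebesgue. P x * (\<phi> x + S.lam m x * D x (m - l))) =
        (S.nrm l \<bullet> (m - l)) * facet_integral (S.fac l) (\<lambda>x. s l x * (S.lam m x * \<phi> x))"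
      using eq unfolding Keq t_def f_def by simp
  qed
  then obtain c where c: "\<forall>x\<in>interior K. P x = c" "\<forall>l\<in>C. \<forall>x\<in>rel_interior (S.fac l). s l x = c"
    unfolding Keq by blast
  have "pb x = c" if "F \<in> cell_facets K" "x \<in> rel_interior F" for F x
  proof -
    obtain l where l: "l \<in> C" "F = S.fac l" using \<open>F \<in> cell_facets K\<close> unfolding Keq S.cell_facets_K by blast
    then show ?thesis using c(2) s(2)[OF l(1)] that(2) by simp
  qed
  then show ?thesis using c(1) P(2) by auto
qed

section \<open>Pressures across the interface\<close>

text \<open>An interface facet already has a cell on the other side, so a second cell on this side
  would be its third.\<close>

lemma facet_cell_unique:
  assumes F: "F \<in> interface_facets Ts Td" and T0: "T0 = Ts \<or> T0 = Td"
    and K: "K1 \<in> T0" "K2 \<in> T0" "F \<in> cell_facets K1" "F \<in> cell_facets K2"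
  shows "K1 = K2"
proof -
  obtain Ks Kd where KK: "Ks \<in> Ts" "F \<in> cell_facets Ks" "Kd \<in> Td" "F \<in> cell_facets Kd"
    using F by (auto simp: interface_facets_def facets_def)
  show ?thesis
  proof (cases "T0 = Ts")
    case True
    then have "Kd \<noteq> K1" "Kd \<noteq> K2" using K KK meshes_disjoint by blast+
    then show ?thesis using two_cells_per_facet[of Kd K1 K2 F] K KK True by blast
  next
    case False
    then have "T0 = Td" using T0 by blast
    moreover from this have "Ks \<noteq> K1" "Ks \<noteq> K2" using K KK meshes_disjoint by blast+
    ultimately show ?thesis using two_cells_per_facet[of Ks K1 K2 F] K KK by blast
  qed
qed

text \<open>Exchanging the sums over cells and facets counts each facet once, with its only cell on
  this side. In this form the two sides of the interface can be compared.\<close>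

lemma interface_integral_eq:
  assumes T0: "T0 = Ts \<or> T0 = Td" and cl: "\<And>F. F \<in> interface_facets Ts Td \<Longrightarrow> cl F \<in> T0 \<and> F \<in> cell_facets (cl F)"
  shows "interface_integral T0 (interface_facets Ts Td) g
    = (\<Sum>F\<in>interface_facets Ts Td. facet_integral F (g (out_normal (cl F) F)))"
proof -
  let ?I = "interface_facets Ts Td"
  have fin: "finite T0" "finite ?I" using T0 finite_Ts finite_Td finite_facets by (auto simp: interface_facets_def)
  have "interface_integral T0 ?I g = (\<Sum>K\<in>T0. \<Sum>F\<in>?I. if F \<in> cell_facets K then facet_integral F (g (out_normal K F)) else 0)"
    unfolding interface_integral_def
  proof (rule sum.cong[OF refl])
    fix K
    have "cell_facets K \<inter> ?I = {F \<in> ?I. F \<in> cell_facets K}" by blast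
    then show "(\<Sum>F\<in>cell_facets K \<inter> ?I. facet_integral F (g (out_normal K F)))
        = (\<Sum>F\<in>?I. if F \<in> cell_facets K then facet_integral F (g (out_normal K F)) else 0)"
      using sum.inter_filter[OF fin(2), of "\<lambda>F. facet_integral F (g (out_normal K F))" "\<lambda>F. F \<in> cell_facets K"] by simp
  qed
  also have "\<dots> = (\<Sum>F\<in>?I. \<Sum>K\<in>T0. if F \<in> cell_facets K then facet_integral F (g (out_normal K F)) else 0)"
    by (rule sum.swap)
  also have "\<dots> = (\<Sum>F\<in>?I. facet_integral F (g (out_normal (cl F) F)))"
  proof (rule sum.cong[OF refl])
    fix F assume F: "F \<in> ?I"
    have "(\<Sum>K\<in>T0. if F \<in> cell_facets K then facet_integral F (g (out_normal K F)) else 0)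
        = (\<Sum>K\<in>T0. if K = cl F then facet_integral F (g (out_normal (cl F) F)) else 0)"
      by (rule sum.cong[OF refl]) (use cl[OF F] facet_cell_unique[OF F T0] in auto)
    then show "(\<Sum>K\<in>T0. if F \<in> cell_facets K then facet_integral F (g (out_normal K F)) else 0)
        = facet_integral F (g (out_normal (cl F) F))"
      using cl[OF F] fin(1) by simp
  qed
  finally show ?thesis .
qed

lemma interface_integral_opposite:
  "interface_integral Td (interface_facets Ts Td) (\<lambda>n x. v x \<bullet> n)
    = - interface_integral Ts (interface_facets Ts Td) (\<lambda>n x. v x \<bullet> n)"
proof -
  let ?I = "interface_facets Ts Td"
  have "\<forall>F\<in>?I. \<exists>K. K \<in> Ts \<and> F \<in> cell_facets K" "\<forall>F\<in>?I. \<exists>K. K \<in> Td \<and> F \<in> cell_facets K"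
    by (auto simp: interface_facets_def facets_def)
  then obtain cs cd where cs: "\<And>F. F \<in> ?I \<Longrightarrow> cs F \<in> Ts \<and> F \<in> cell_facets (cs F)"
      and cd: "\<And>F. F \<in> ?I \<Longrightarrow> cd F \<in> Td \<and> F \<in> cell_facets (cd F)"
    by metis
  have "facet_integral F (\<lambda>x. v x \<bullet> out_normal (cd F) F) = - facet_integral F (\<lambda>x. v x \<bullet> out_normal (cs F) F)" if F: "F \<in> ?I" for F
  proof -
    have "cs F \<noteq> cd F" using cs[OF F] cd[OF F] meshes_disjoint by auto
    then have "out_normal (cd F) F = - out_normal (cs F) F"
      using opposite_normals[of "cs F" "cd F" F] cs[OF F] cd[OF F] by blast
    then show ?thesis using facet_integral_scale[of F "-1" "\<lambda>x. v x \<bullet> out_normal (cs F) F"] by simp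
  qed
  then show ?thesis
    using interface_integral_eq[of Ts cs "\<lambda>n x. v x \<bullet> n"] interface_integral_eq[of Td cd "\<lambda>n x. v x \<bullet> n"] cs cd
    by (simp add: sum_negf)
qed

text \<open>The cells meeting \<open>S\<close> cover the closure of \<open>S\<close>. One that
  contains a point of the open facet must have \<open>F\<close> as a facet, and on one side of the
  interface that cell is unique.\<close>

lemma cell_meets_component:
  assumes R: "(T0 = Ts \<and> R = \<Omega>s) \<or> (T0 = Td \<and> R = \<Omega>d)" and S: "S \<in> components R"
    and F: "F \<in> interface_facets Ts Td" and K: "K \<in> T0" "F \<in> cell_facets K"
    and x: "x \<in> rel_interior F" "x \<in> closure S"
  shows "interior K \<inter> S \<noteq> {}"
proof -
  have R': "open R" "R \<subseteq> \<Union>T0" "T0 \<subseteq> Ts \<union> Td" using R regions_open region_cover by auto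
  have S': "open S" "S \<subseteq> R" using S open_components[OF R'(1)] in_components_subset by auto
  let ?L = "{L \<in> T0. interior L \<inter> S \<noteq> {}}"
  have "S \<subseteq> \<Union>?L"
  proof
    fix y assume y: "y \<in> S"
    then obtain L where L: "L \<in> T0" "y \<in> L" using S' R' by blast
    then have "y \<in> closure (interior L)" using cell(4)[of L] R'(3) by auto
    then have "interior L \<inter> S \<noteq> {}" using S'(1) y open_Int_closure_eq_empty[of S "interior L"] by blast
    then show "y \<in> \<Union>?L" using L by blast
  qed
  moreover have "closed (\<Union>?L)" using R'(3) by (intro closed_Union_cells) blast
  ultimately have "x \<in> \<Union>?L" using closure_minimal x(2) by blast
  then obtain L where L: "L \<in> T0" "interior L \<inter> S \<noteq> {}" "x \<in> L" by blast
  have "L = K"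
  proof (rule ccontr)
    assume "L \<noteq> K"
    then have "F \<in> cell_facets L"
      using rel_interior_facet_cell[of K L F x] K L x R'(3) by blast
    then show False using facet_cell_unique[OF F, of T0 L K] R L(1) K \<open>L \<noteq> K\<close> by blast
  qed
  then show ?thesis using L by blast
qed

lemma component_of_cell:
  assumes R: "(T0 = Ts \<and> R = \<Omega>s) \<or> (T0 = Td \<and> R = \<Omega>d)" and K: "K \<in> T0"
  shows "\<exists>S\<in>components R. interior K \<subseteq> S \<and> K \<subseteq> closure S"
proof -
  have KT: "K \<in> Ts \<union> Td" using R K by blast
  have "interior K \<subseteq> R" using R K interior_Ts interior_Td by blast
  moreover have "R \<noteq> {}" using calculation cell(3)[OF KT] by blast
  moreover have "connected (interior K)" using convex_interior[OF cell(2)[OF KT]] convex_connected by blast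
  ultimately obtain S where "S \<in> components R" "interior K \<subseteq> S" using exists_component_superset by metis
  then show ?thesis using closure_mono[of "interior K" S] cell(4)[OF KT] by auto
qed

text \<open>Facet velocities couple the two facet pressures only through normal fluxes of opposite
  sign. A resolving velocity lives where \<open>S\<close> and \<open>D\<close> touch, and there both
  pressures are the constants of these components. Hence the difference of the constants times a
  nonzero flux is zero.\<close>

lemma pressure_interface:
  assumes resolved: "interface_resolved k \<Omega> \<Omega>s \<Omega>d Ts Td" and q: "(p, ps, pd) \<in> QQ k"
    and zero: "\<And>v. v \<in> VV k \<Longrightarrow> b_total Ts Td (p, ps, pd) v = 0"
    and cs: "\<And>K F x. K \<in> Ts \<Longrightarrow> F \<in> cell_facets K \<Longrightarrow> x \<in> rel_interior F \<Longrightarrow> ps x = c K"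
    and cd: "\<And>K F x. K \<in> Td \<Longrightarrow> F \<in> cell_facets K \<Longrightarrow> x \<in> rel_interior F \<Longrightarrow> pd x = c K"
    and K: "K \<in> Ts" "K' \<in> Td" and F: "F \<in> cell_facets K" "F \<in> cell_facets K'"
  shows "c K = c K'"
proof -
  let ?I = "interface_facets Ts Td"
  have FI: "F \<in> ?I" using K F by (auto simp: interface_facets_def facets_def)
  obtain S where S: "S \<in> components \<Omega>s" "interior K \<subseteq> S" "K \<subseteq> closure S"
    using component_of_cell[of Ts \<Omega>s K] K by blast
  obtain D where D: "D \<in> components \<Omega>d" "interior K' \<subseteq> D" "K' \<subseteq> closure D"
    using component_of_cell[of Td \<Omega>d K'] K by blast
  have "F \<subseteq> closure S \<inter> closure D"
    using cell_facet(2)[of K F] cell_facet(2)[of K' F] K F S D by blast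
  then obtain v where v: "v \<in> Vbarh k \<Omega> \<Omega>s Ts" "\<forall>x\<in>\<Union>?I. x \<notin> closure S \<inter> closure D \<longrightarrow> v x = 0"
      "interface_integral Ts ?I (\<lambda>n x. v x \<bullet> n) \<noteq> 0"
    using resolved S(1) D(1) FI unfolding interface_resolved_def by metis
  \<comment> \<open>Where \<open>v\<close> is nonzero on the interface, the point lies in the
    closure of the component \<open>C\<close>. The adjacent cell then meets \<open>C\<close> and
    carries the same constant as \<open>L\<close>.\<close>
  have localize: "interface_integral T0 ?I (\<lambda>n x. pb x * (v x \<bullet> n)) = c L * interface_integral T0 ?I (\<lambda>n x. v x \<bullet> n)"
    if T0: "(T0 = Ts \<and> R = \<Omega>s) \<or> (T0 = Td \<and> R = \<Omega>d)" and pb: "\<And>K F x. K \<in> T0 \<Longrightarrow> F \<in> cell_facets K \<Longrightarrow> x \<in> rel_interior F \<Longrightarrow> pb x = c K"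
      and C: "C \<in> components R" "interior L \<subseteq> C" "closure S \<inter> closure D \<subseteq> closure C" and L: "L \<in> T0"
    for T0 R pb C L
  proof -
    have R': "open R" "R \<subseteq> \<Union>T0" "T0 \<subseteq> Ts \<union> Td" using T0 regions_open region_cover by auto
    \<comment> \<open>Inside a component, cells sharing a facet share its facet pressure, so their
      constants agree.\<close>
    have const: "c K1 = c L" if "K1 \<in> T0" "interior K1 \<inter> C \<noteq> {}" for K1
    proof (rule cells_constant[of C T0 c])
      show "open C" "connected C" "C \<subseteq> \<Union>T0"
        using C(1) open_components[OF R'(1)] in_components_connected in_components_subset R'(2) by blast+
      show "c K1 = c K2" if KK: "K1 \<in> T0" "K2 \<in> T0" "K1 \<inter> K2 \<in> cell_facets K1" "K1 \<inter> K2 \<in> cell_facets K2" for K1 K2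
      proof -
        have "K1 \<in> Ts \<union> Td" using KK R' by blast
        then obtain y where y: "y \<in> rel_interior (K1 \<inter> K2)" using cell_facet(5) KK(3) by blast
        then show ?thesis using pb[OF KK(1,3) y] pb[OF KK(2,4) y] by simp
      qed
      show "interior L \<inter> C \<noteq> {}" using C(2) cell(3)[of L] L R'(3) by blast
    qed (use that L R' in auto)
    have "facet_integral F1 (\<lambda>x. pb x * (v x \<bullet> out_normal K1 F1)) = c L * facet_integral F1 (\<lambda>x. v x \<bullet> out_normal K1 F1)"
      if KF: "K1 \<in> T0" "F1 \<in> cell_facets K1" "F1 \<in> ?I" for K1 F1
    proof -
      have K1: "K1 \<in> Ts \<union> Td" using KF R' by blast
      have "pb x * (v x \<bullet> out_normal K1 F1) = c L * (v x \<bullet> out_normal K1 F1)" if x: "x \<in> rel_interior F1" for x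
      proof (cases "x \<in> closure C")
        case True
        then have "c K1 = c L"
          using const[OF KF(1)] cell_meets_component[OF T0 C(1) KF(3) KF(1,2) x] by blast
        then show ?thesis using pb[OF KF(1,2) x] by simp
      next
        case False
        moreover have "x \<in> \<Union>?I" using x rel_interior_subset KF(3) by blast
        ultimately have "v x = 0" using v(2) C(3) by blast
        then show ?thesis by simp
      qed
      moreover have "regular_on (rel_interior F1) (\<lambda>x. c L * (v x \<bullet> out_normal K1 F1))"
        by (intro regular_on_mult regular_on_inner regular_on_const Vbarh_regular[OF v(1) conjunct1[OF interface_facet[OF KF(3)]]])
      ultimately have "facet_integral F1 (\<lambda>x. pb x * (v x \<bullet> out_normal K1 F1)) = facet_integral F1 (\<lambda>x. c L * (v x \<bullet> out_normal K1 F1))"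
        by (intro facet_integral_cong cell_facet(1)[OF K1 KF(2)])
      then show ?thesis by (simp add: facet_integral_scale)
    qed
    then show ?thesis unfolding interface_integral_def sum_distrib_left by (auto intro!: sum.cong)
  qed
  have "(0, v) \<in> VV k" using v(1) subspace_0[OF subspace_Vh] by (simp add: VV_def)
  then have "b_I Ts ?I ps v + b_I Td ?I pd v = 0"
    using zero[of "(0, v)"] by (simp add: b_total_def b_h_zero)
  moreover have "b_I Ts ?I ps v = - (c K * interface_integral Ts ?I (\<lambda>n x. v x \<bullet> n))"
    unfolding b_I_def using localize[of Ts \<Omega>s ps S K] cs S K by auto
  moreover have "b_I Td ?I pd v = - (c K' * interface_integral Td ?I (\<lambda>n x. v x \<bullet> n))"
    unfolding b_I_def using localize[of Td \<Omega>d pd D K'] cd D K by auto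
  ultimately have "(c K' - c K) * interface_integral Ts ?I (\<lambda>n x. v x \<bullet> n) = 0"
    using interface_integral_opposite[of v] by (simp add: algebra_simps)
  then show ?thesis using v(3) by simp
qed

section \<open>Triviality of the pressure kernel\<close>

lemma pressure_kernel:
  assumes k: "1 \<le> k" and resolved: "interface_resolved k \<Omega> \<Omega>s \<Omega>d Ts Td" and q: "(p, ps, pd) \<in> QQ k"
    and zero: "\<And>v. v \<in> VV k \<Longrightarrow> b_total Ts Td (p, ps, pd) v = 0"
  shows "p = 0" "ps = 0" "pd = 0"
proof -
  have pQ: "p \<in> Qh k \<Omega> (Ts \<union> Td)" and psQ: "ps \<in> Qbarh k Ts" and pdQ: "pd \<in> Qbarh k Td"
    using q by (auto simp: QQ_def)
  have "\<exists>c. (\<forall>x\<in>interior K. p x = c) \<and> (K \<in> Ts \<longrightarrow> (\<forall>F\<in>cell_facets K. \<forall>x\<in>rel_interior F. ps x = c))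
      \<and> (K \<in> Td \<longrightarrow> (\<forall>F\<in>cell_facets K. \<forall>x\<in>rel_interior F. pd x = c))" if "K \<in> Ts \<union> Td" for K
  proof (cases "K \<in> Ts")
    case True
    then show ?thesis using pressure_cell[OF k q zero, of Ts ps K] meshes_disjoint by blast
  next
    case False
    then show ?thesis using pressure_cell[OF k q zero, of Td pd K] that by blast
  qed
  then obtain c where c: "\<And>K. K \<in> Ts \<union> Td \<Longrightarrow> (\<forall>x\<in>interior K. p x = c K) \<and> (K \<in> Ts \<longrightarrow> (\<forall>F\<in>cell_facets K. \<forall>x\<in>rel_interior F. ps x = c K))
      \<and> (K \<in> Td \<longrightarrow> (\<forall>F\<in>cell_facets K. \<forall>x\<in>rel_interior F. pd x = c K))"
    by metis
  have cs: "ps x = c K" if "K \<in> Ts" "F \<in> cell_facets K" "x \<in> rel_interior F" for K F x using c[of K] that by blast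
  have cd: "pd x = c K" if "K \<in> Td" "F \<in> cell_facets K" "x \<in> rel_interior F" for K F x using c[of K] that by blast
  have iface: "c K = c K'" if "K \<in> Ts" "K' \<in> Td" "F \<in> cell_facets K" "F \<in> cell_facets K'" for K K' F
    by (rule pressure_interface[where c = c, OF resolved q zero _ _ that]) (use cs cd in auto)
  have const: "c K1 = c K2" if KK: "K1 \<in> Ts \<union> Td" "K2 \<in> Ts \<union> Td" for K1 K2
  proof (rule cells_constant[of \<Omega> "Ts \<union> Td" c])
    show "open \<Omega>" "connected \<Omega>" "\<Omega> \<subseteq> \<Union>(Ts \<union> Td)"
      using regions_open domain region_cover by (auto simp: stokes_darcy_domain_def)
    have meets: "interior K \<inter> \<Omega> \<noteq> {}" if "K \<in> Ts \<union> Td" for K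
      using that interior_Ts[of K] interior_Td[of K] regions_subset cell(3)[OF that] by blast
    show "interior K1 \<inter> \<Omega> \<noteq> {}" "interior K2 \<inter> \<Omega> \<noteq> {}" using meets KK by auto
    fix K K' assume K: "K \<in> Ts \<union> Td" "K' \<in> Ts \<union> Td" and F: "K \<inter> K' \<in> cell_facets K" "K \<inter> K' \<in> cell_facets K'"
    obtain y where y: "y \<in> rel_interior (K \<inter> K')" using cell_facet(5)[OF K(1) F(1)] by blast
    consider "K \<in> Ts" "K' \<in> Ts" | "K \<in> Td" "K' \<in> Td" | "K \<in> Ts" "K' \<in> Td" | "K \<in> Td" "K' \<in> Ts" using K by blast
    then show "c K = c K'"
    proof cases
      case 1
      then show ?thesis using cs[OF 1(1) F(1) y] cs[OF 1(2) F(2) y] by simp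
    next
      case 2
      then show ?thesis using cd[OF 2(1) F(1) y] cd[OF 2(2) F(2) y] by simp
    next
      case 3
      then show ?thesis by (rule iface[OF _ _ F])
    next
      case 4
      then show ?thesis using iface[OF 4(2,1) F(2,1)] by simp
    qed
  qed (use KK in auto)
  have c0: "c K = 0" if K: "K \<in> Ts \<union> Td" for K
  proof -
    \<comment> \<open>\<open>p\<close> takes only the values \<open>c K\<close> and 0, so
      \<open>c K * p x\<close> is nonnegative everywhere, while its integral vanishes by the
      zero-mean condition.\<close>
    have px: "p x = c K \<or> p x = 0" for x
    proof (cases "x \<in> (\<Union>K\<in>Ts \<union> Td. interior K)")
      case True
      then obtain K' where "K' \<in> Ts \<union> Td" "x \<in> interior K'" by blast
      then show ?thesis using c[of K'] const[OF _ K, of K'] by auto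
    next
      case False
      then show ?thesis using pQ unfolding Qh_def by blast
    qed
    obtain x where x: "x \<in> interior K" using cell(3)[OF K] by blast
    have "c K * p x = 0"
    proof (rule set_integral_zero_imp_zero[where S = \<Omega> and U = "interior K" and f = "\<lambda>x. c K * p x"])
      show "set_integrable lebesgue \<Omega> (\<lambda>x. c K * p x)"
        using region_integrable[OF region_sets(1) region_cover(1) order_refl Qh_regular[OF pQ]] by simp
      show "0 \<le> c K * p x" for x using px[of x] by auto
      have "(LINT x:\<Omega>|lebesgue. p x) = 0" using pQ unfolding Qh_def by blast
      then show "(LINT x:\<Omega>|lebesgue. c K * p x) = 0" by simp
      show "interior K \<subseteq> \<Omega>" using K interior_Ts interior_Td regions_subset by blast
      have "continuous_on (interior K) (\<lambda>x. c K * c K)" by simp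
      then show "continuous_on (interior K) (\<lambda>x. c K * p x)" using c[OF K] by (simp cong: continuous_on_cong)
    qed (use x in auto)
    then show ?thesis using c[OF K] x by simp
  qed
  show "p = 0"
  proof
    fix x
    show "p x = 0 x"
    proof (cases "x \<in> (\<Union>K\<in>Ts \<union> Td. interior K)")
      case True
      then obtain K' where "K' \<in> Ts \<union> Td" "x \<in> interior K'" by blast
      then show ?thesis using c[of K'] c0[of K'] by auto
    next
      case False
      then have "p x = 0" using pQ unfolding Qh_def by blast
      then show ?thesis by simp
    qed
  qed
  show "ps = 0"
  proof
    fix x
    show "ps x = 0 x"
    proof (cases "x \<in> (\<Union>F\<in>facets Ts. rel_interior F)")
      case True
      then obtain K F where "K \<in> Ts" "F \<in> cell_facets K" "x \<in> rel_interior F" by (auto simp: facets_def)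
      then show ?thesis using cs c0 by simp
    next
      case False
      then have "ps x = 0" using psQ unfolding Qbarh_def by blast
      then show ?thesis by simp
    qed
  qed
  show "pd = 0"
  proof
    fix x
    show "pd x = 0 x"
    proof (cases "x \<in> (\<Union>F\<in>facets Td. rel_interior F)")
      case True
      then obtain K F where "K \<in> Td" "F \<in> cell_facets K" "x \<in> rel_interior F" by (auto simp: facets_def)
      then show ?thesis using cd c0 by simp
    next
      case False
      then have "pd x = 0" using pdQ unfolding Qbarh_def by blast
      then show ?thesis by simp
    qed
  qed
qed

end

section \<open>Facet bubbles\<close>

context stokes_darcy
begin

text \<open>The half balls in the two cells fill a ball in the closure of \<open>\<Omega>\<close>.
  So an interface facet can touch the outer boundary only at its relative boundary, where the bubble
  vanishes.\<close>

lemma interface_facet_interior: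
  assumes K: "K \<in> Ts" "K' \<in> Td" and F: "F \<in> cell_facets K" "F \<in> cell_facets K'" and x: "x \<in> rel_interior F"
  shows "x \<in> \<Omega>"
proof -
  have KT: "K \<in> Ts \<union> Td" "K' \<in> Ts \<union> Td" "K \<noteq> K'" using K meshes_disjoint by auto
  let ?n = "out_normal K F"
  have n: "out_normal K' F = - ?n" by (rule opposite_normals[OF KT F])
  obtain e where e: "e > 0" "\<forall>z. dist x z < e \<longrightarrow> (?n \<bullet> (z - x) \<le> 0 \<longrightarrow> z \<in> K) \<and> (?n \<bullet> (z - x) < 0 \<longrightarrow> z \<in> interior K)"
    using facet_below_normal[OF cells[OF KT(1)] dim2 F(1) x] by blast
  obtain e' where e': "e' > 0" "\<forall>z. dist x z < e' \<longrightarrow> (- ?n \<bullet> (z - x) \<le> 0 \<longrightarrow> z \<in> K') \<and> (- ?n \<bullet> (z - x) < 0 \<longrightarrow> z \<in> interior K')"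
    using facet_below_normal[OF cells[OF KT(2)] dim2 F(2) x] unfolding n by blast
  have "ball x (min e e') \<subseteq> K \<union> K'"
  proof
    fix z assume "z \<in> ball x (min e e')"
    then have z: "dist x z < e" "dist x z < e'" by auto
    show "z \<in> K \<union> K'" using e(2) e'(2) z by (cases "?n \<bullet> (z - x) \<le> 0") auto
  qed
  also have "\<dots> \<subseteq> closure \<Omega>" unfolding closure_\<Omega> using K by blast
  finally have "x \<in> interior (closure \<Omega>)" using e e' by (intro interiorI[OF open_ball]) auto
  then show ?thesis using interior_closure by simp
qed

text \<open>The bubble is the product of the barycentric coordinates of the facet's vertices, which
  are as many as the dimension. It vanishes on the relative boundary and thus extends by zero
  continuously to the other facets; it is positive inside, so multiplied by the normal it has
  positive flux.\<close>

lemma interface_resolved_of_degree: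
  assumes k: "CARD('n) \<le> k"
  shows "interface_resolved k \<Omega> \<Omega>s \<Omega>d Ts Td"
  unfolding interface_resolved_def
proof (intro ballI impI)
  fix S D assume SD: "S \<in> components \<Omega>s" "D \<in> components \<Omega>d"
    and ex: "\<exists>F\<in>interface_facets Ts Td. F \<subseteq> closure S \<inter> closure D"
  let ?I = "interface_facets Ts Td"
  obtain F where F: "F \<in> ?I" "F \<subseteq> closure S \<inter> closure D" using ex by blast
  obtain K K' where K: "K \<in> Ts" "F \<in> cell_facets K" and K': "K' \<in> Td" "F \<in> cell_facets K'"
    using F(1) by (auto simp: interface_facets_def facets_def)
  have KT: "K \<in> Ts \<union> Td" using K by blast
  obtain C a b l where simp: "full_simplex C a b" and Keq: "K = convex hull C" and l: "l \<in> C"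
    and Feq: "F = convex hull (C - {l})"
    using cell_facet_data[OF cells[OF KT] dim2 K(2)] .
  interpret S: full_simplex C a b by (rule simp)
  define bub where "bub = (\<lambda>x. \<Prod>m\<in>C - {l}. S.lam m x)"
  define \<nu> where "\<nu> = out_normal K F"
  have \<nu>: "\<nu> \<bullet> \<nu> = 1" using cell_facet(6)[OF KT K(2)] by (simp add: \<nu>_def norm_eq_1)
  have "card (C - {l}) \<le> k" using S.card_C l S.finite_C k by (simp add: card_Diff_singleton)
  then have bubPk: "bub \<in> Pk k"
    unfolding bub_def S.lam_def using S.finite_C by (intro Pk_affine_prod) auto
  have bub_pos: "bub x > 0" if "x \<in> rel_interior F" for x
    using that S.rel_interior_fac[OF l] unfolding Feq bub_def by (intro prod_pos) auto
  have bub_bdry: "bub x = 0" if xF: "x \<in> F" and xr: "x \<notin> rel_interior F" for x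
  proof -
    have "x \<in> S.K" "S.lam l x = 0" using xF S.mem_fac[OF l] unfolding Feq by auto
    moreover obtain m where m: "m \<in> C - {l}" "\<not> 0 < S.lam m x"
      using xr \<open>S.lam l x = 0\<close> S.rel_interior_fac[OF l] unfolding Feq by auto
    ultimately have "S.lam m x = 0" using S.mem_K[of x] by force
    then show ?thesis unfolding bub_def using m S.finite_C by (intro prod_zero) auto
  qed
  define v where "v = (\<lambda>x. if x \<in> F then bub x *\<^sub>R \<nu> else 0)"
  have unique: "K1 = K" if "K1 \<in> Ts" "F \<in> cell_facets K1" for K1
    using facet_cell_unique[OF F(1), of Ts K1 K] that K by blast
  \<comment> \<open>A Stokes cell containing a point of the open facet \<open>F\<close> must be
    \<open>K\<close>, and another facet of \<open>K\<close> meets \<open>F\<close> only in its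
    relative boundary.\<close>
  have off: "v x = 0" if F': "F' \<in> facets Ts" "F' \<noteq> F" and x: "x \<in> F'" for F' x
  proof (cases "x \<in> F")
    case True
    obtain K1 where K1: "K1 \<in> Ts" "F' \<in> cell_facets K1" using F' by (auto simp: facets_def)
    have "x \<notin> rel_interior F"
    proof
      assume xr: "x \<in> rel_interior F"
      have K1T: "K1 \<in> Ts \<union> Td" using K1 by blast
      have "x \<in> K1" using cell_facet(2)[OF K1T K1(2)] x by blast
      then have "F \<in> cell_facets K1"
        using rel_interior_facet_cell[OF KT K1T _ K(2) xr] K(2) by (cases "K = K1") auto
      then have "K1 = K" using unique K1 by blast
      then have "F' \<in> S.fac ` C" using K1(2) Keq S.cell_facets_K by simp
      then obtain l' where l': "l' \<in> C" "F' = S.fac l'" by blast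
      then have "l' \<noteq> l" using F'(2) Feq by auto
      then have "0 < S.lam l' x" using xr l' S.rel_interior_fac[OF l] unfolding Feq by auto
      moreover have "S.lam l' x = 0" using x l' S.mem_fac[OF l'(1)] by auto
      ultimately show False by simp
    qed
    then show ?thesis using bub_bdry True by (simp add: v_def)
  qed (simp add: v_def)
  have Fs: "F \<in> facets Ts" using K by (auto simp: facets_def)
  have vV: "v \<in> Vbarh k \<Omega> \<Omega>s Ts"
    unfolding Vbarh_def
  proof (intro CollectI conjI ballI allI impI)
    fix F' assume F': "F' \<in> facets Ts"
    show "\<exists>p\<in>Pk_vec k. \<forall>x\<in>F'. v x = p x"
    proof (cases "F' = F")
      case True
      then show ?thesis using Pk_vec_scaleR[OF bubPk, of \<nu>]
        by (intro bexI[of _ "\<lambda>x. bub x *\<^sub>R \<nu>"]) (auto simp: v_def)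
    next
      case False
      then show ?thesis using off[OF F' False] subspace_0[OF subspace_Pk_vec[of k]]
        by (intro bexI[of _ 0]) auto
    qed
  next
    fix x assume x: "x \<in> frontier \<Omega> \<inter> frontier \<Omega>s"
    show "v x = 0"
    proof (cases "x \<in> F")
      case True
      have "x \<notin> rel_interior F"
        using interface_facet_interior[OF K(1) K'(1) K(2) K'(2), of x] x regions_open(1)
        by (auto simp: frontier_def interior_open)
      then show ?thesis using bub_bdry True by (simp add: v_def)
    qed (simp add: v_def)
  next
    have eq: "\<Union>(facets Ts) = F \<union> \<Union>(facets Ts - {F})" using Fs by blast
    show "continuous_on (\<Union>(facets Ts)) v"
      unfolding eq
    proof (rule continuous_on_closed_Un)
      have compact: "compact F'" if "F' \<in> facets Ts" for F'
        using that cell_facet(3) by (auto simp: facets_def)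
      show "closed F" using compact[OF Fs] compact_imp_closed by blast
      show "closed (\<Union>(facets Ts - {F}))"
        using finite_facets(1) compact compact_imp_closed by (intro closed_Union) auto
      have "continuous_on F (\<lambda>x. bub x *\<^sub>R \<nu>)"
        by (intro continuous_intros Pk_continuous_on[OF bubPk])
      then show "continuous_on F v" by (simp add: v_def cong: continuous_on_cong)
      have "v x = 0" if "x \<in> \<Union>(facets Ts - {F})" for x using that off by blast
      then show "continuous_on (\<Union>(facets Ts - {F})) v"
        by (subst continuous_on_cong[OF refl, of _ _ "\<lambda>x. 0"]) auto
    qed
  next
    fix x assume "x \<notin> \<Union>(facets Ts)"
    then have "x \<notin> F" using Fs by blast
    then show "v x = 0" by (simp add: v_def)
  qed
  moreover have "v x = 0" if "x \<in> \<Union>?I" "x \<notin> closure S \<inter> closure D" for x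
    using that F(2) by (auto simp: v_def)
  moreover have "interface_integral Ts ?I (\<lambda>n x. v x \<bullet> n) \<noteq> 0"
  proof
    assume zero: "interface_integral Ts ?I (\<lambda>n x. v x \<bullet> n) = 0"
    have pos: "0 \<le> v x \<bullet> out_normal K1 F1" if KF: "K1 \<in> Ts" "F1 \<in> cell_facets K1" and x: "x \<in> rel_interior F1" for K1 F1 x
    proof (cases "F1 = F")
      case True
      then have "K1 = K" using unique KF by blast
      moreover have "x \<in> F" using x True rel_interior_subset by blast
      ultimately show ?thesis using bub_pos[of x] x True \<nu> by (simp add: v_def \<nu>_def)
    next
      case False
      have "F1 \<in> facets Ts" using KF by (auto simp: facets_def)
      then have "v x = 0" using off[OF _ False] x rel_interior_subset by blast
      then show ?thesis by simp
    qed
    have reg: "regular_on (rel_interior F1) (\<lambda>x. v x \<bullet> n)" if "K1 \<in> Ts" "F1 \<in> cell_facets K1" for K1 F1 n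
      by (intro regular_on_inner regular_on_const Vbarh_regular[OF vV facets_of_cell[OF that]])
    have nn: "0 \<le> facet_integral F1 (\<lambda>x. v x \<bullet> out_normal K1 F1)" if KF: "K1 \<in> Ts" "F1 \<in> cell_facets K1" for K1 F1
      using facet_integral_nonneg(1)[OF cell_facet(1)[of K1 F1] reg[OF KF] pos[OF KF]] KF by blast
    have nn': "0 \<le> (\<Sum>F1\<in>cell_facets K1 \<inter> ?I. facet_integral F1 (\<lambda>x. v x \<bullet> out_normal K1 F1))" if "K1 \<in> Ts" for K1
      by (intro sum_nonneg) (auto intro: nn[OF that])
    have "(\<Sum>F1\<in>cell_facets K \<inter> ?I. facet_integral F1 (\<lambda>x. v x \<bullet> out_normal K F1)) = 0"
      using zero sum_nonneg_eq_0_iff[OF finite_Ts nn'] K(1) unfolding interface_integral_def by simp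
    then have z: "facet_integral F (\<lambda>x. v x \<bullet> out_normal K F) = 0"
      using sum_nonneg_eq_0_iff[of "cell_facets K \<inter> ?I" "\<lambda>F1. facet_integral F1 (\<lambda>x. v x \<bullet> out_normal K F1)"]
        cell(6)[OF KT] nn[OF K(1)] K(2) F(1) by simp
    obtain y where y: "y \<in> rel_interior F" using cell_facet(5)[OF KT K(2)] by blast
    have "v y \<bullet> out_normal K F = 0"
      by (rule facet_integral_nonneg(2)[OF cell_facet(1)[OF KT K(2)] reg[OF K] pos[OF K] z y])
    moreover have "y \<in> F" using y rel_interior_subset by blast
    ultimately show False using bub_pos[OF y] \<nu> by (simp add: v_def \<nu>_def)
  qed
  ultimately show "\<exists>v\<in>Vbarh k \<Omega> \<Omega>s Ts. (\<forall>x\<in>\<Union>?I. x \<notin> closure S \<inter> closure D \<longrightarrow> v x = 0) \<and>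
      interface_integral Ts ?I (\<lambda>n x. v x \<bullet> n) \<noteq> 0"
    by (intro bexI[of _ v] conjI ballI impI) auto
qed

section \<open>Well-posedness\<close>

lemma B_h_nondegenerate:
  assumes k: "1 \<le> k" and resolved: "interface_resolved k \<Omega> \<Omega>s \<Omega>d Ts Td"
    and coercive: "c > 0" "\<forall>v\<in>VV k. c * norm_v_sq \<Omega>d Ts Td v \<le> a_h \<mu> \<kappa> \<alpha> \<beta> \<Omega>d Ts Td v v"
    and w: "w \<in> VV k \<times> QQ k" and zero: "\<And>y. y \<in> VV k \<times> QQ k \<Longrightarrow> B_h \<mu> \<kappa> \<alpha> \<beta> \<Omega>d Ts Td w y = 0"
  shows "w = 0"
proof -
  obtain u q where wuq: "w = (u, q)" "u \<in> VV k" "q \<in> QQ k" using w by auto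
  have "(u, - q) \<in> VV k \<times> QQ k" using wuq subspace_neg[OF subspace_QQ] by simp
  then have "a_h \<mu> \<kappa> \<alpha> \<beta> \<Omega>d Ts Td u u + b_total Ts Td q u + b_total Ts Td (- q) u = 0"
    using zero[of "(u, - q)"] unfolding B_h_eq wuq(1) by simp
  moreover have "b_total Ts Td (- q) u = - b_total Ts Td q u"
    using linear_on_scale[OF linear_b_total_pressure[OF wuq(2)] wuq(3), of "-1"] by simp
  ultimately have "c * norm_v_sq \<Omega>d Ts Td u \<le> 0" using coercive(2) wuq(2) by force
  then have norm: "norm_v_sq \<Omega>d Ts Td u \<le> 0" using coercive(1) by (simp add: mult_le_0_iff)
  obtain u1 u2 where u12: "u = (u1, u2)" by (cases u)
  have u0: "u = 0"
    using velocity_kernel[OF wuq(2)[unfolded u12] norm[unfolded u12]] by (simp add: u12 zero_prod_def)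
  \<comment> \<open>With \<open>u = 0\<close>, testing with a pure velocity leaves only the coupling
    with the pressure.\<close>
  have bq: "b_total Ts Td q v = 0" if v: "v \<in> VV k" for v
  proof -
    have "(v, 0) \<in> VV k \<times> QQ k" using v subspace_0[OF subspace_QQ] by simp
    then have "a_h \<mu> \<kappa> \<alpha> \<beta> \<Omega>d Ts Td u v + b_total Ts Td q v + b_total Ts Td 0 u = 0"
      using zero[of "(v, 0)"] unfolding B_h_eq wuq(1) by simp
    moreover have "a_h \<mu> \<kappa> \<alpha> \<beta> \<Omega>d Ts Td u v = 0"
      using linear_on_scale[OF linear_a_h[OF v] wuq(2), of \<mu> \<kappa> \<alpha> \<beta> 0] u0
      by (simp add: a_h_sym[of _ _ _ _ _ v])
    moreover have "b_total Ts Td 0 u = 0"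
      using linear_on_scale[OF linear_b_total_pressure[OF wuq(2)] wuq(3), of 0] by simp
    ultimately show ?thesis by simp
  qed
  obtain p ps pd where q: "q = (p, ps, pd)" by (cases q)
  have "q = 0"
    using pressure_kernel[OF k resolved wuq(3)[unfolded q] bq[unfolded q]] by (simp add: q zero_prod_def)
  then show ?thesis using u0 wuq(1) by (simp add: zero_prod_def)
qed

end

theorem proposition1:
  fixes \<Omega> \<Omega>s \<Omega>d :: "(real^'n) set"
    and k :: nat
    and \<mu> \<kappa> \<alpha> \<beta> \<beta>0 :: real
    and MM :: "((real^'n) set set \<times> (real^'n) set set) set"
    and Ts Td :: "(real^'n) set set"
  assumes "CARD('n) = 2 \<or> CARD('n) = 3"
    and "stokes_darcy_domain \<Omega> \<Omega>s \<Omega>d"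
    and "k \<ge> 1"
    and "\<mu> > 0" and "\<kappa> > 0" and "\<alpha> > 0"
    and "\<forall>(T1, T2)\<in>MM. stokes_darcy_mesh \<Omega>s \<Omega>d T1 T2"
    and "coercivity_threshold k \<mu> \<kappa> \<alpha> \<Omega> \<Omega>s \<Omega>d MM \<beta>0"
    and "(Ts, Td) \<in> MM"
    and "k < CARD('n) \<Longrightarrow> interface_resolved k \<Omega> \<Omega>s \<Omega>d Ts Td"
    and "\<beta> > \<beta>0"
  shows "\<forall>(fs :: real^'n \<Rightarrow> real^'n) (fd :: real^'n \<Rightarrow> real).
           L2_on \<Omega>s fs \<longrightarrow> L2_on \<Omega>d fd \<longrightarrow>
           (\<exists>!w. w \<in> Xh k \<Omega> \<Omega>s Ts Td \<and>
              (\<forall>((v, vb), (q, qs, qd))\<in>Xh k \<Omega> \<Omega>s Ts Td.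
                 B_h \<mu> \<kappa> \<alpha> \<beta> \<Omega>d Ts Td w ((v, vb), (q, qs, qd)) =
                   (LINT x:\<Omega>s|lebesgue. fs x \<bullet> v x) + (LINT x:\<Omega>d|lebesgue. fd x * q x)))"
proof (intro allI impI)
  fix fs :: "real^'n \<Rightarrow> real^'n" and fd :: "real^'n \<Rightarrow> real"
  assume fs: "L2_on \<Omega>s fs" and fd: "L2_on \<Omega>d fd"
  interpret stokes_darcy \<Omega> \<Omega>s \<Omega>d Ts Td
    using assms(1,2,7,9) by unfold_locales auto
  \<comment> \<open>From the dimension on, the degree admits facet bubbles; below it the interface
    velocities are those of the hypothesis.\<close>
  have resolved: "interface_resolved k \<Omega> \<Omega>s \<Omega>d Ts Td"
    using assms(10) interface_resolved_of_degree[of k] by (cases "k < CARD('n)") auto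
  obtain c where c: "c > 0" "\<forall>v\<in>VV k. c * norm_v_sq \<Omega>d Ts Td v \<le> a_h \<mu> \<kappa> \<alpha> \<beta> \<Omega>d Ts Td v v"
    using assms(8,9,11) unfolding coercivity_threshold_def VV_def by fast
  obtain A where A: "finite A" "VV k \<times> QQ k \<subseteq> span A" using finite_span_Xh by blast
  define L where "L y = (LINT x:\<Omega>s|lebesgue. fs x \<bullet> fst (fst y) x) + (LINT x:\<Omega>d|lebesgue. fd x * fst (snd y) x)"
    for y :: "'n velocity \<times> 'n pressure"
  have "\<exists>!w. w \<in> VV k \<times> QQ k \<and> (\<forall>y\<in>VV k \<times> QQ k. B_h \<mu> \<kappa> \<alpha> \<beta> \<Omega>d Ts Td w y = L y)"
  proof (rule symmetric_form_unique_solution[OF _ A])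
    show "subspace (VV k \<times> QQ k)" by (intro subspace_Times subspace_VV subspace_QQ)
    show "B_h \<mu> \<kappa> \<alpha> \<beta> \<Omega>d Ts Td x y = B_h \<mu> \<kappa> \<alpha> \<beta> \<Omega>d Ts Td y x" for x y by (rule B_h_sym)
    show "linear_on (VV k \<times> QQ k) (B_h \<mu> \<kappa> \<alpha> \<beta> \<Omega>d Ts Td x)" if "x \<in> VV k \<times> QQ k" for x
      by (rule linear_B_h[OF that])
    show "x = 0" if "x \<in> VV k \<times> QQ k" "\<And>y. y \<in> VV k \<times> QQ k \<Longrightarrow> B_h \<mu> \<kappa> \<alpha> \<beta> \<Omega>d Ts Td x y = 0" for x
      by (rule B_h_nondegenerate[OF assms(3) resolved c that])
    show "linear_on (VV k \<times> QQ k) L" unfolding L_def[abs_def] by (rule linear_source[OF fs fd])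
  qed
  \<comment> \<open>The equation is stated for tuples; \<open>L\<close> reads the same components
    through projections.\<close>
  moreover have "(\<forall>((v, vb), (q, qs, qd))\<in>VV k \<times> QQ k. B_h \<mu> \<kappa> \<alpha> \<beta> \<Omega>d Ts Td w ((v, vb), (q, qs, qd)) =
      (LINT x:\<Omega>s|lebesgue. fs x \<bullet> v x) + (LINT x:\<Omega>d|lebesgue. fd x * q x))
      \<longleftrightarrow> (\<forall>y\<in>VV k \<times> QQ k. B_h \<mu> \<kappa> \<alpha> \<beta> \<Omega>d Ts Td w y = L y)" for w
    by (rule ball_cong[OF refl]) (auto simp: L_def)
  ultimately show "\<exists>!w. w \<in> Xh k \<Omega> \<Omega>s Ts Td \<and>
              (\<forall>((v, vb), (q, qs, qd))\<in>Xh k \<Omega> \<Omega>s Ts Td.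
                 B_h \<mu> \<kappa> \<alpha> \<beta> \<Omega>d Ts Td w ((v, vb), (q, qs, qd)) =
                   (LINT x:\<Omega>s|lebesgue. fs x \<bullet> v x) + (LINT x:\<Omega>d|lebesgue. fd x * q x))"
    unfolding Xh_eq by simp
qed

end
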